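(* Let $d\ge1$ be an integer, $0<s<d$, and $N\ge1$. If $\Lambda_N$ is attained, i.e. if there exists $\rho\in\mathcal A_N$ with $\mathcal G_N(\rho)/\mathcal L(\rho)=\Lambda_N$, then $$\Lambda_{N+1}>\Lambda_N .$$
   Context: Set $p:=1+s/d$. For an integer $N\ge1$, let $\mathcal A_N:=\{\rho\in L^1(\mathbb R^d)\cap L^p(\mathbb R^d):\rho\ge0,\ \int_{\mathbb R^d}\rho=N\}$. For a symmetric probability measure $P$ on $(\mathbb R^d)^N$ let $\rho_P:=\sum_{i=1}^N(\pi_i)_\#P$, where $\pi_i$ is the $i$-th coordinate projection; it is identified with its density when absolutely continuous. For $\rho\in\mathcal A_N$ let $$\mathcal W_N(\rho):=\min\Big\{\int_{(\mathbb R^d)^N}\sum_{1\le i<j\le N}\frac1{|x_i-x_j|^s}\,\mathrm dP:\ P\text{ a symmetric probability measure on }(\mathbb R^d)^N,\ \rho_P=\rho\Big\},$$ $$D(\rho):=\iint_{\mathbb R^d\times\mathbb R^d}\frac{\rho(x)\rho(y)}{|x-y|^s}\,\mathrm dx\,\mathrm dy,\quad \mathcal G_N(\rho):=\tfrac12D(\rho)-\mathcal W_N(\rho),\quad \mathcal L(\rho):=\int_{\mathbb R^d}\rho^p,$$ $$\Lambda_N:=\Lambda_N(s,d):=\sup_{\rho\in\mathcal A_N}\frac{\mathcal G_N(\rho)}{\mathcal L(\rho)}.$$ *)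

theory Defs
  imports "HOL-Probability.Probability"
begin

text \<open>
  The space \<open>\<real>\<^sup>d\<close> is a type \<open>'a :: euclidean_space\<close> with \<open>d = DIM('a)\<close>, and \<open>(\<real>\<^sup>d)\<^sup>N\<close> is the
  product space over the index set \<open>{..<N}\<close>, so that different values of \<open>N\<close> can be compared.
\<close>

definition p_exp :: "'a::euclidean_space itself \<Rightarrow> real \<Rightarrow> real" where
  "p_exp _ s = 1 + s / real DIM('a)"

text \<open>
  Elements of \<open>L\<^sup>1 \<inter> L\<^sup>p\<close> are represented by Borel functions; everything below depends only on
  the class modulo Lebesgue-null sets.
\<close>

definition admissible :: "real \<Rightarrow> nat \<Rightarrow> ('a::euclidean_space \<Rightarrow> real) set" where
  "admissible s N = {\<rho>. integrable lborel \<rho>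
     \<and> integrable lborel (\<lambda>x. \<bar>\<rho> x\<bar> powr p_exp TYPE('a) s)
     \<and> (AE x in lborel. 0 \<le> \<rho> x)
     \<and> (\<integral>x. \<rho> x \<partial>lborel) = real N}"

text \<open>
  Since \<open>0 powr s = 0\<close> and \<open>1 / 0 = \<infinity>\<close> in \<^typ>\<open>ennreal\<close>, the kernel is \<open>\<infinity>\<close> on the diagonal.
  This matters: a coupling may charge the diagonal even if its marginals have densities.
\<close>

definition riesz :: "real \<Rightarrow> 'a::euclidean_space \<Rightarrow> 'a \<Rightarrow> ennreal" where
  "riesz s x y = 1 / ennreal (norm (x - y) powr s)"

definition config_space :: "nat \<Rightarrow> (nat \<Rightarrow> 'a::euclidean_space) measure" where
  "config_space N = (\<Pi>\<^sub>M i\<in>{..<N}. borel)"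

definition symmetric_prob :: "nat \<Rightarrow> (nat \<Rightarrow> 'a::euclidean_space) measure \<Rightarrow> bool" where
  "symmetric_prob N P \<longleftrightarrow> prob_space P \<and> sets P = sets (config_space N)
     \<and> (\<forall>\<sigma>. \<sigma> permutes {..<N} \<longrightarrow>
          distr P (config_space N) (\<lambda>x. \<lambda>i\<in>{..<N}. x (\<sigma> i)) = P)"

definition one_body :: "nat \<Rightarrow> (nat \<Rightarrow> 'a::euclidean_space) measure \<Rightarrow> 'a measure" where
  "one_body N P = measure_of UNIV (sets borel)
     (\<lambda>A. \<Sum>i<N. emeasure (distr P borel (\<lambda>x. x i)) A)"

lemma emeasure_one_body:
  assumes "A \<in> sets borel"
  shows "emeasure (one_body N P) A = (\<Sum>i<N. emeasure (distr P borel (\<lambda>x. x i)) A)"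
proof (rule emeasure_measure_of[OF one_body_def])
  have "sets (one_body N P) = sets borel"
    unfolding one_body_def by (metis sets.sets_measure_of_eq space_borel)
  then show "A \<in> sets (one_body N P)" using assms by simp
  show "sets borel \<subseteq> Pow (UNIV :: 'a set)" by simp
  show "positive (sets (one_body N P)) (\<lambda>A. \<Sum>i<N. emeasure (distr P borel (\<lambda>x. x i)) A)"
    by (simp add: positive_def)
  show "countably_additive (sets (one_body N P)) (\<lambda>A. \<Sum>i<N. emeasure (distr P borel (\<lambda>x. x i)) A)"
    unfolding countably_additive_def
  proof (intro allI impI)
    fix F :: "nat \<Rightarrow> 'a set"
    assume F: "range F \<subseteq> sets (one_body N P)" "disjoint_family F"
    have "(\<Sum>k. \<Sum>i<N. emeasure (distr P borel (\<lambda>x. x i)) (F k))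
        = (\<Sum>i<N. \<Sum>k. emeasure (distr P borel (\<lambda>x. x i)) (F k))"
      by (rule suminf_sum) simp
    also have "\<dots> = (\<Sum>i<N. emeasure (distr P borel (\<lambda>x. x i)) (\<Union> (range F)))"
      using F \<open>sets (one_body N P) = sets borel\<close>
      by (intro sum.cong refl suminf_emeasure) auto
    finally show "(\<Sum>k. \<Sum>i<N. emeasure (distr P borel (\<lambda>x. x i)) (F k))
        = (\<Sum>i<N. emeasure (distr P borel (\<lambda>x. x i)) (\<Union> (range F)))" .
  qed
qed

definition couplings :: "nat \<Rightarrow> ('a::euclidean_space \<Rightarrow> real) \<Rightarrow> (nat \<Rightarrow> 'a) measure set" where
  "couplings N \<rho> = {P. symmetric_prob N P \<and> one_body N P = density lborel (\<lambda>x. ennreal (\<rho> x))}"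

definition W_fun :: "real \<Rightarrow> nat \<Rightarrow> ('a::euclidean_space \<Rightarrow> real) \<Rightarrow> ennreal" where
  "W_fun s N \<rho> = (INF P\<in>couplings N \<rho>.
     \<integral>\<^sup>+x. (\<Sum>(i, j)\<in>{(i, j). i < j \<and> j < N}. riesz s (x i) (x j)) \<partial>P)"

definition D_fun :: "real \<Rightarrow> ('a::euclidean_space \<Rightarrow> real) \<Rightarrow> ennreal" where
  "D_fun s \<rho> = (\<integral>\<^sup>+x. \<integral>\<^sup>+y. ennreal (\<rho> x) * ennreal (\<rho> y) * riesz s x y \<partial>lborel \<partial>lborel)"

text \<open>
  On admissible densities both terms are finite when \<open>0 < s < d\<close> and \<open>N \<ge> 1\<close>: the first by the
  Hardy-Littlewood-Sobolev inequality, the second by testing with the product of \<open>N\<close> copies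
  of \<open>\<rho> / N\<close>.
\<close>

definition G_fun :: "real \<Rightarrow> nat \<Rightarrow> ('a::euclidean_space \<Rightarrow> real) \<Rightarrow> ereal" where
  "G_fun s N \<rho> = enn2ereal (D_fun s \<rho>) / 2 - enn2ereal (W_fun s N \<rho>)"

definition L_fun :: "real \<Rightarrow> ('a::euclidean_space \<Rightarrow> real) \<Rightarrow> real" where
  "L_fun s \<rho> = (\<integral>x. \<rho> x powr p_exp TYPE('a) s \<partial>lborel)"

definition Lambda :: "'a::euclidean_space itself \<Rightarrow> real \<Rightarrow> nat \<Rightarrow> ereal" where
  "Lambda _ s N = (SUP \<rho>\<in>(admissible s N :: ('a \<Rightarrow> real) set). G_fun s N \<rho> / ereal (L_fun s \<rho>))"

end

theory Submission
  imports Defs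
begin

text \<open>
  Write \<open>q = s / d\<close>. Let \<open>\<rho>\<close> be optimal for \<open>N\<close> and add a particle: with small probability \<open>e\<close> it has a
  density \<open>f\<close>, otherwise it is spread over a huge ball and contributes nothing in the limit. If the
  particle is independent of the old configuration, the change of \<open>G_fun\<close> is nonnegative.
  If it is placed at \<open>f\<close> only when the old configuration is favourable, that is, repels
  it less than on average, the gain is of order \<open>e\<close>, while \<open>L_fun\<close> increases by at most
  \<open>2 e \<integral>\<rho> powr q f + O(e powr (1 + q))\<close>. Hence it is enough to find \<open>f\<close> where \<open>\<rho> powr q\<close> is small and where
  the repulsion felt by a new particle is not constant. For a \<open>\<rho>\<close> with unbounded support, \<open>f\<close> is uniform
  on a large ball; for a bounded support, it is concentrated near an extreme point of the support,
  on the outside.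
\<close>

section \<open>Symmetrisation of couplings\<close>

text \<open>The first-order balance behind the cancellation: adding a density \<open>g\<close>
  raises \<open>D_fun / 2\<close> by \<open>mutual s \<rho> g\<close> plus half the self-energy of
  \<open>g\<close>, and an independent insertion raises \<open>W_fun\<close> by at most
  \<open>mutual s \<rho> g\<close>. Every saving by correlation is therefore net gain, and the
  self-energy can be thrown away. The spread-out part serves to bring the total mass to
  \<open>N + 1\<close>, which a fraction \<open>e\<close> of a particle cannot do.

  The obstacle is that \<open>L_fun\<close> itself reacts at order \<open>e\<close> wherever \<rho>
  is positive, so a saving inside the bulk of \<rho> may be eaten up by
  \<open>\<bar>Lam\<bar>\<close> times this reaction; this forces the distinction by the support.
  Attainment is used because the gain depends on \<rho>: along a maximising sequence it could shrink
  together with the defect.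

  \<open>W_fun\<close> is an infimum and no minimiser is constructed; each coupling is modified on
  its own, with event probabilities bounded through the one-body density only. Conditional insertion
  destroys exchangeability, so admissible couplings are recovered by averaging over
  permutations.\<close>

definition cost :: "real \<Rightarrow> nat \<Rightarrow> (nat \<Rightarrow> 'a::euclidean_space) \<Rightarrow> ennreal" where
  "cost s M x = (\<Sum>(i, j)\<in>{(i, j). i < j \<and> j < M}. riesz s (x i) (x j))"

text \<open>Written like the map in \<open>symmetric_prob\<close>; the restriction to
  \<open>{..<M}\<close> keeps the result extensional, as points of \<open>config_space M\<close>
  must be.\<close>

definition permute :: "nat \<Rightarrow> (nat \<Rightarrow> nat) \<Rightarrow> (nat \<Rightarrow> 'a) \<Rightarrow> nat \<Rightarrow> 'a" where
  "permute M \<sigma> x = (\<lambda>i\<in>{..<M}. x (\<sigma> i))"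

lemma riesz_commute: "riesz s x y = riesz s y x"
  by (simp add: riesz_def norm_minus_commute)

lemma borel_measurable_riesz [measurable]:
  assumes [measurable]: "f \<in> borel_measurable M" "g \<in> borel_measurable M"
  shows "(\<lambda>x. riesz s (f x) (g x)) \<in> borel_measurable M"
  unfolding riesz_def by measurable

lemma borel_measurable_riesz' [measurable]: "riesz s x \<in> borel_measurable borel"
  unfolding riesz_def[abs_def] by measurable

lemma finite_pairs: "finite {(i, j). i < j \<and> j < (M::nat)}"
  by (rule finite_subset[of _ "{..<M} \<times> {..<M}"]) auto

lemma measurable_coord: "i < N \<Longrightarrow> (\<lambda>x. x i) \<in> config_space N \<rightarrow>\<^sub>M borel"
  unfolding config_space_def by (rule measurable_component_singleton) simp

lemma borel_measurable_cost [measurable]: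
  "(cost s M :: (nat \<Rightarrow> 'a::euclidean_space) \<Rightarrow> ennreal) \<in> borel_measurable (config_space M)"
proof -
  have "cost s M = (\<lambda>x :: nat \<Rightarrow> 'a. \<Sum>k\<in>{(i, j). i < j \<and> j < M}. riesz s (x (fst k)) (x (snd k)))"
    by (simp add: cost_def split_beta fun_eq_iff)
  moreover have "\<dots> \<in> borel_measurable (config_space M)"
    by (intro borel_measurable_sum borel_measurable_riesz measurable_coord) auto
  ultimately show ?thesis by (simp only:)
qed

lemma measurable_permute [measurable]:
  "\<sigma> permutes {..<M} \<Longrightarrow> permute M \<sigma> \<in> config_space M \<rightarrow>\<^sub>M config_space M"
  unfolding permute_def config_space_def
  by (rule measurable_restrict) (auto intro!: measurable_component_singleton dest: permutes_in_image)

text \<open>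
  The sum over ordered pairs excludes the diagonal, where the kernel is \<open>\<infinity>\<close>, so that the factor 2
  can be cancelled afterwards.
\<close>

lemma two_cost: "2 * cost s M x = (\<Sum>(i, j)\<in>{(i, j). i < M \<and> j < M \<and> i \<noteq> j}. riesz s (x i) (x j))"
proof -
  let ?lt = "{(i, j). i < j \<and> j < M}" and ?gt = "{(i, j). j < i \<and> i < M}"
  have gt: "?gt = prod.swap ` ?lt" by auto
  have sum_gt: "(\<Sum>(i, j)\<in>?gt. riesz s (x i) (x j)) = cost s M x"
    unfolding gt cost_def
    by (subst sum.reindex) (auto simp: riesz_commute inj_on_def split_beta)
  have split: "{(i, j). i < M \<and> j < M \<and> i \<noteq> j} = ?lt \<union> ?gt" by auto
  have "finite ?gt" unfolding gt by (intro finite_imageI finite_pairs)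
  then have "(\<Sum>(i, j)\<in>?lt \<union> ?gt. riesz s (x i) (x j)) = cost s M x + cost s M x"
    unfolding sum_gt[symmetric]
    by (subst sum.union_disjoint) (auto intro: finite_pairs simp: cost_def sum_gt)
  then show ?thesis by (simp only: split mult_2)
qed

text \<open>A permutation may reverse the order of a pair, so the sum over \<open>i < j\<close>
  cannot be reindexed directly. The sum over ordered pairs of distinct indices can, since
  \<open>map_prod \<sigma> \<sigma>\<close> is a bijection of that index set.\<close>

lemma cost_permute:
  assumes "\<sigma> permutes {..<M}"
  shows "cost s M (permute M \<sigma> x) = cost s M x"
proof -
  let ?A = "{(i, j). i < M \<and> j < M \<and> i \<noteq> j}"
  have mem: "\<sigma> i < M \<longleftrightarrow> i < M" for i using permutes_in_image[OF assms, of i] by simp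
  have inj: "\<sigma> i = \<sigma> j \<longleftrightarrow> i = j" for i j using permutes_inj[OF assms] by (auto dest: injD)
  have bij: "bij_betw (map_prod \<sigma> \<sigma>) ?A ?A"
  proof (rule bij_betw_imageI)
    show "inj_on (map_prod \<sigma> \<sigma>) ?A" using inj by (auto simp: inj_on_def)
    show "map_prod \<sigma> \<sigma> ` ?A = ?A"
    proof (intro equalityI subsetI)
      fix z assume "z \<in> ?A"
      then obtain i j where z: "z = (i, j)" "i < M" "j < M" "i \<noteq> j" by auto
      obtain i' j' where "\<sigma> i' = i" "\<sigma> j' = j" using permutes_surj[OF assms] by (metis surjD)
      then show "z \<in> map_prod \<sigma> \<sigma> ` ?A" using z mem by (intro image_eqI[of _ _ "(i', j')"]) auto
    qed (auto simp: mem inj)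
  qed
  have "2 * cost s M (permute M \<sigma> x) = (\<Sum>(i, j)\<in>?A. riesz s (x (\<sigma> i)) (x (\<sigma> j)))"
    unfolding two_cost by (rule sum.cong) (auto simp: permute_def)
  also have "\<dots> = 2 * cost s M x"
    unfolding two_cost using sum.reindex_bij_betw[OF bij, of "\<lambda>(i, j). riesz s (x i) (x j)"]
    by (simp add: split_beta)
  finally show ?thesis by (simp add: ennreal_mult_cancel_left)
qed

lemma cost_Suc:
  "cost s (Suc N) (x(N := y)) = cost s N x + (\<Sum>i<N. riesz s (x i) y)"
proof -
  have eq: "{(i, j). i < j \<and> j < Suc N} = {(i, j). i < j \<and> j < N} \<union> (\<lambda>i. (i, N)) ` {..<N}"
    by auto
  have "cost s (Suc N) (x(N := y)) = (\<Sum>(i, j)\<in>{(i, j). i < j \<and> j < N}. riesz s ((x(N:=y)) i) ((x(N:=y)) j))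
      + (\<Sum>(i,j)\<in>(\<lambda>i. (i, N)) ` {..<N}. riesz s ((x(N:=y)) i) ((x(N:=y)) j))"
    unfolding cost_def eq by (rule sum.union_disjoint) (auto intro: finite_pairs)
  also have "(\<Sum>(i, j)\<in>{(i, j). i < j \<and> j < N}. riesz s ((x(N:=y)) i) ((x(N:=y)) j)) = cost s N x"
    unfolding cost_def by (rule sum.cong) auto
  also have "(\<Sum>(i,j)\<in>(\<lambda>i. (i, N)) ` {..<N}. riesz s ((x(N:=y)) i) ((x(N:=y)) j)) = (\<Sum>i<N. riesz s (x i) y)"
    by (subst sum.reindex) (auto simp: inj_on_def)
  finally show ?thesis .
qed

section \<open>One-body densities as expected sums over the particles\<close>

lemma sets_one_body [simp, measurable_cong]: "sets (one_body N P) = sets borel"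
  unfolding one_body_def by (metis sets.sets_measure_of_eq space_borel)

lemma emeasure_one_body_eq_nn_integral:
  assumes P: "sets P = sets (config_space N)" and A: "A \<in> sets borel"
  shows "emeasure (one_body N P) A = (\<integral>\<^sup>+x. (\<Sum>i<N. indicator A (x i)) \<partial>P)"
proof -
  have m: "(\<lambda>x. x i) \<in> P \<rightarrow>\<^sub>M borel" if "i < N" for i
    using measurable_coord[OF that] by (subst measurable_cong_sets[OF P refl])
  have "emeasure (one_body N P) A = (\<Sum>i<N. \<integral>\<^sup>+x. indicator A (x i) \<partial>P)"
    unfolding emeasure_one_body[OF A]
  proof (rule sum.cong)
    fix i assume "i \<in> {..<N}"
    then have [measurable]: "(\<lambda>x. x i) \<in> P \<rightarrow>\<^sub>M borel" using m by simp
    show "emeasure (distr P borel (\<lambda>x. x i)) A = (\<integral>\<^sup>+x. indicator A (x i) \<partial>P)"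
      using A by (simp add: nn_integral_distr flip: nn_integral_indicator)
  qed simp
  also have "\<dots> = (\<integral>\<^sup>+x. (\<Sum>i<N. indicator A (x i)) \<partial>P)"
    by (rule nn_integral_sum[symmetric]) (use m A in \<open>auto intro!: measurable_compose[OF m] borel_measurable_indicator\<close>)
  finally show ?thesis .
qed

text \<open>Campbell's formula. \<open>one_body\<close> is given by its values on sets, so the
  passage from indicators to functions is the standard induction on nonnegative measurable
  functions.\<close>

lemma nn_integral_one_body:
  assumes P: "sets P = sets (config_space N)" and h: "h \<in> borel_measurable borel"
  shows "(\<integral>\<^sup>+x. h x \<partial>one_body N P) = (\<integral>\<^sup>+x. (\<Sum>i<N. h (x i)) \<partial>P)"
proof -
  have m: "(\<lambda>x. x i) \<in> P \<rightarrow>\<^sub>M borel" if "i < N" for i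
    using measurable_coord[OF that] by (subst measurable_cong_sets[OF P refl])
  have m': "(\<lambda>x. u (x i)) \<in> borel_measurable P" if "u \<in> borel_measurable borel" "i < N" for u :: "'a \<Rightarrow> ennreal" and i
    using measurable_compose[OF m that(1)] that(2) by simp
  show ?thesis
    using h
  proof (induction rule: borel_measurable_induct)
    case (cong f g)
    then have "f = g" by (auto simp: fun_eq_iff)
    with cong show ?case by simp
  next
    case (set A)
    then show ?case using emeasure_one_body_eq_nn_integral[OF P] by simp
  next
    case (mult u c)
    have [measurable]: "u \<in> borel_measurable (one_body N P)"
      using mult by (simp cong: measurable_cong_sets)
    have [measurable]: "(\<lambda>x. \<Sum>i<N. u (x i)) \<in> borel_measurable P"
      using mult by (intro borel_measurable_sum m') auto
    show ?case
      using mult by (simp add: nn_integral_cmult flip: sum_distrib_left)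
  next
    case (add u v)
    have [measurable]: "u \<in> borel_measurable (one_body N P)" "v \<in> borel_measurable (one_body N P)"
      using add by (simp_all cong: measurable_cong_sets)
    have [measurable]: "(\<lambda>x. \<Sum>i<N. u (x i)) \<in> borel_measurable P" "(\<lambda>x. \<Sum>i<N. v (x i)) \<in> borel_measurable P"
      using add by (auto intro!: borel_measurable_sum m')
    show ?case
      using add by (simp add: nn_integral_add sum.distrib)
  next
    case (seq U)
    have U: "U i \<in> borel_measurable borel" for i using seq by auto
    have "U i \<in> borel_measurable (one_body N P)" for i
      using U by (simp cong: measurable_cong_sets)
    then have "(\<integral>\<^sup>+x. (SUP i. U i) x \<partial>one_body N P) = (SUP i. \<integral>\<^sup>+x. U i x \<partial>one_body N P)"
      unfolding SUP_apply using seq(3) by (intro nn_integral_monotone_convergence_SUP)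
    also have "\<dots> = (SUP k. \<integral>\<^sup>+x. (\<Sum>i<N. U k (x i)) \<partial>P)"
      using seq by simp
    also have "\<dots> = (\<integral>\<^sup>+x. (SUP k. \<Sum>i<N. U k (x i)) \<partial>P)"
      by (rule nn_integral_monotone_convergence_SUP[symmetric])
        (use seq in \<open>auto simp: incseq_def le_fun_def intro!: sum_mono borel_measurable_sum m' U\<close>)
    also have "\<dots> = (\<integral>\<^sup>+x. (\<Sum>i<N. (SUP k. U k) (x i)) \<partial>P)"
      unfolding SUP_apply
      by (intro nn_integral_cong ennreal_SUP_sum) (use seq in \<open>auto simp: incseq_def le_fun_def\<close>)
    finally show ?case .
  qed
qed

text \<open>Precomposition reverses the order of composition; invariance of the permutation average
  therefore reduces to right translation in the permutation group.\<close>

lemma permute_compose: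
  assumes "\<tau> permutes {..<M}"
  shows "permute M \<tau> (permute M \<sigma> x) = permute M (\<sigma> \<circ> \<tau>) x"
  using permutes_in_image[OF assms] by (auto simp: permute_def fun_eq_iff)

text \<open>
  Averaging over all permutations of the particles makes any law symmetric, without changing its
  one-body density or its cost.
\<close>

lemma W_fun_le:
  fixes P :: "(nat \<Rightarrow> 'a::euclidean_space) measure"
  assumes prob: "prob_space P" and P: "sets P = sets (config_space M)"
    and ob: "one_body M P = density lborel (\<lambda>x. ennreal (\<rho> x))"
  shows "W_fun s M \<rho> \<le> (\<integral>\<^sup>+x. cost s M x \<partial>P)"
proof -
  let ?S = "{\<sigma>. \<sigma> permutes {..<M}}"
  define U where "U = uniform_count_measure ?S"
  interpret P: prob_space P by fact
  have fin: "finite ?S" by (simp add: finite_permutations)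
  have ne: "?S \<noteq> {}" using permutes_id by blast
  interpret U: prob_space U unfolding U_def by (rule prob_space_uniform_count_measure[OF fin ne])
  interpret UP: pair_prob_space U P ..
  have permute_meas: "(\<lambda>(\<sigma>, x). permute M \<sigma> x) \<in> U \<Otimes>\<^sub>M P \<rightarrow>\<^sub>M config_space M"
  proof -
    have "(\<lambda>(\<sigma>, x). permute M \<sigma> x) \<in> count_space ?S \<Otimes>\<^sub>M config_space M \<rightarrow>\<^sub>M config_space M"
      by (rule measurable_pair_measure_countable1) (auto simp: countable_finite fin)
    moreover have "sets U = sets (count_space ?S)"
      by (simp add: U_def sets_uniform_count_measure)
    ultimately show ?thesis
      by (subst measurable_cong_sets[OF sets_pair_measure_cong refl]) (auto simp: P)
  qed
  \<comment> \<open>The average of the permuted laws, realised as the law of a configuration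
    shuffled by an independent uniform permutation; total mass one is then automatic.\<close>
  define Q where "Q = distr (U \<Otimes>\<^sub>M P) (config_space M) (\<lambda>(\<sigma>, x). permute M \<sigma> x)"
  have Qi: "(\<integral>\<^sup>+x. F x \<partial>Q) = (\<Sum>\<sigma>\<in>?S. ennreal (1 / real (card ?S)) * (\<integral>\<^sup>+x. F (permute M \<sigma> x) \<partial>P))"
    if F: "F \<in> borel_measurable (config_space M)" for F
  proof -
    have "(\<integral>\<^sup>+x. F x \<partial>Q) = (\<integral>\<^sup>+z. F (case z of (\<sigma>, x) \<Rightarrow> permute M \<sigma> x) \<partial>(U \<Otimes>\<^sub>M P))"
      unfolding Q_def by (rule nn_integral_distr[OF permute_meas]) (simp add: F)
    also have "\<dots> = (\<integral>\<^sup>+\<sigma>. \<integral>\<^sup>+x. F (permute M \<sigma> x) \<partial>P \<partial>U)"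
      using measurable_compose[OF permute_meas F] by (subst P.nn_integral_fst[symmetric]) auto
    also have "\<dots> = (\<Sum>\<sigma>\<in>?S. ennreal (1 / real (card ?S)) * (\<integral>\<^sup>+x. F (permute M \<sigma> x) \<partial>P))"
      unfolding U_def uniform_count_measure_def
      by (subst nn_integral_point_measure_finite) (auto simp: fin mult.commute)
    finally show ?thesis .
  qed
  have card_S: "(\<Sum>\<sigma>\<in>?S. ennreal (1 / real (card ?S)) * c) = c" for c
  proof -
    have "ennreal (real (card ?S)) * ennreal (1 / real (card ?S)) = 1"
      using fin ne by (subst ennreal_mult[symmetric]) (auto simp: card_eq_0_iff)
    then show ?thesis by (simp add: ennreal_of_nat_eq_real_of_nat mult.assoc[symmetric])
  qed
  have Qinv: "(\<integral>\<^sup>+x. F x \<partial>Q) = (\<integral>\<^sup>+x. F x \<partial>P)"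
    if F: "F \<in> borel_measurable (config_space M)" and inv: "\<And>\<sigma> x. \<sigma> permutes {..<M} \<Longrightarrow> F (permute M \<sigma> x) = F x" for F
  proof -
    have "(\<integral>\<^sup>+x. F x \<partial>Q) = (\<Sum>\<sigma>\<in>?S. ennreal (1 / real (card ?S)) * (\<integral>\<^sup>+x. F x \<partial>P))"
      unfolding Qi[OF F] by (rule sum.cong) (use inv in auto)
    then show ?thesis unfolding card_S .
  qed
  have setsQ [simp, measurable_cong]: "sets Q = sets (config_space M)" by (simp add: Q_def)
  have spaceQ: "space Q = space (config_space M)" by (rule sets_eq_imp_space_eq) simp
  have sym: "symmetric_prob M Q"
    unfolding symmetric_prob_def
  proof (intro conjI allI impI)
    show "prob_space Q"
      unfolding Q_def by (rule UP.prob_space_distr[OF permute_meas])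
    fix \<tau> assume \<tau>: "\<tau> permutes {..<M}"
    have "distr Q (config_space M) (permute M \<tau>) = Q"
    proof (rule measure_eqI)
      fix A assume "A \<in> sets (distr Q (config_space M) (permute M \<tau>))"
      then have A [measurable]: "A \<in> sets (config_space M)" by simp
      note [measurable] = measurable_permute[OF \<tau>]
      have "emeasure (distr Q (config_space M) (permute M \<tau>)) A = (\<integral>\<^sup>+x. indicator A (permute M \<tau> x) \<partial>Q)"
        by (subst nn_integral_indicator[symmetric], simp, subst nn_integral_distr) auto
      also have "\<dots> = (\<Sum>\<sigma>\<in>?S. ennreal (1 / real (card ?S)) * (\<integral>\<^sup>+x. indicator A (permute M (\<sigma> \<circ> \<tau>) x) \<partial>P))"
        by (subst Qi) (auto simp: permute_compose[OF \<tau>])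
      also have "\<dots> = (\<Sum>\<sigma>\<in>?S. ennreal (1 / real (card ?S)) * (\<integral>\<^sup>+x. indicator A (permute M \<sigma> x) \<partial>P))"
        by (rule sum_permutations_compose_right[OF \<tau>, symmetric])
      also have "\<dots> = emeasure Q A"
        by (subst Qi[symmetric]) auto
      finally show "emeasure (distr Q (config_space M) (permute M \<tau>)) A = emeasure Q A" .
    qed simp
    then show "distr Q (config_space M) (\<lambda>x. \<lambda>i\<in>{..<M}. x (\<tau> i)) = Q"
      by (simp add: permute_def[abs_def])
  qed simp
  have "one_body M Q = density lborel (\<lambda>x. ennreal (\<rho> x))"
    unfolding ob[symmetric]
  proof (rule measure_eqI)
    fix A :: "'a set" assume "A \<in> sets (one_body M Q)"
    then have A [measurable]: "A \<in> sets borel" by simp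
    show "emeasure (one_body M Q) A = emeasure (one_body M P) A"
      unfolding emeasure_one_body_eq_nn_integral[OF setsQ A] emeasure_one_body_eq_nn_integral[OF P A]
    proof (rule Qinv)
      show "(\<lambda>x. \<Sum>i<M. indicator A (x i) :: ennreal) \<in> borel_measurable (config_space M)"
        by (auto intro!: borel_measurable_sum measurable_compose[OF measurable_coord])
      fix \<sigma> and x :: "nat \<Rightarrow> 'a" assume "\<sigma> permutes {..<M}"
      then have "bij_betw \<sigma> {..<M} {..<M}" by (rule permutes_imp_bij)
      from sum.reindex_bij_betw[OF this, of "\<lambda>i. indicator A (x i)"]
      show "(\<Sum>i<M. indicator A (permute M \<sigma> x i)) = (\<Sum>i<M. indicator A (x i) :: ennreal)"
        by (simp add: permute_def)
    qed
  qed simp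
  with sym have "Q \<in> couplings M \<rho>" by (simp add: couplings_def)
  then have "W_fun s M \<rho> \<le> (\<integral>\<^sup>+x. cost s M x \<partial>Q)"
    unfolding W_fun_def cost_def by (rule INF_lower)
  also have "\<dots> = (\<integral>\<^sup>+x. cost s M x \<partial>P)"
    by (rule Qinv) (auto simp: cost_permute)
  finally show ?thesis .
qed

section \<open>Adding a particle\<close>

definition pot :: "real \<Rightarrow> ('a::euclidean_space \<Rightarrow> real) \<Rightarrow> 'a \<Rightarrow> ennreal" where
  "pot s f x = (\<integral>\<^sup>+y. ennreal (f y) * riesz s x y \<partial>lborel)"

text \<open>The bilinear form whose diagonal is \<open>D_fun\<close>. With values in
  \<open>ennreal\<close>, the expansion of \<open>D_fun\<close> of a sum needs no
  integrability.\<close>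

definition mutual :: "real \<Rightarrow> ('a::euclidean_space \<Rightarrow> real) \<Rightarrow> ('a \<Rightarrow> real) \<Rightarrow> ennreal" where
  "mutual s f g = (\<integral>\<^sup>+x. ennreal (f x) * pot s g x \<partial>lborel)"

lemma borel_measurable_pot [measurable]:
  assumes [measurable]: "f \<in> borel_measurable borel"
  shows "pot s f \<in> borel_measurable borel"
  unfolding pot_def by measurable

lemma mutual_commute:
  assumes [measurable]: "f \<in> borel_measurable borel" "g \<in> borel_measurable borel"
  shows "mutual s f g = mutual s g f"
proof -
  have "mutual s f g = (\<integral>\<^sup>+x. \<integral>\<^sup>+y. ennreal (f x) * (ennreal (g y) * riesz s x y) \<partial>lborel \<partial>lborel)"
    unfolding mutual_def pot_def by (simp add: nn_integral_cmult)
  also have "\<dots> = (\<integral>\<^sup>+y. \<integral>\<^sup>+x. ennreal (f x) * (ennreal (g y) * riesz s x y) \<partial>lborel \<partial>lborel)"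
    by (rule lborel_pair.Fubini') simp
  also have "\<dots> = mutual s g f"
    unfolding mutual_def pot_def
    by (simp add: nn_integral_cmult[symmetric] mult.left_commute riesz_commute)
  finally show ?thesis .
qed

lemma D_fun_eq_mutual:
  assumes [measurable]: "f \<in> borel_measurable borel"
  shows "D_fun s f = mutual s f f"
  unfolding D_fun_def mutual_def pot_def by (simp add: nn_integral_cmult[symmetric] mult.assoc)

lemma pot_cmult:
  assumes [measurable]: "f \<in> borel_measurable borel" and "0 \<le> c"
  shows "pot s (\<lambda>x. c * f x) x = ennreal c * pot s f x"
  unfolding pot_def using assms(2) by (simp add: nn_integral_cmult[symmetric] ennreal_mult' mult.assoc)

lemma pot_add:
  assumes [measurable]: "f \<in> borel_measurable borel" "g \<in> borel_measurable borel"
    and "\<And>x. 0 \<le> f x" "\<And>x. 0 \<le> g x"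
  shows "pot s (\<lambda>x. f x + g x) x = pot s f x + pot s g x"
  unfolding pot_def using assms(3,4) by (simp add: nn_integral_add[symmetric] distrib_right)

lemma mutual_cmult:
  assumes [measurable]: "f \<in> borel_measurable borel" "g \<in> borel_measurable borel" and "0 \<le> c"
  shows "mutual s g (\<lambda>x. c * f x) = ennreal c * mutual s g f"
  unfolding mutual_def using assms(3)
  by (simp add: nn_integral_cmult[symmetric] pot_cmult mult.left_commute)

lemma mutual_add:
  assumes [measurable]: "f \<in> borel_measurable borel" "g \<in> borel_measurable borel" "h \<in> borel_measurable borel"
    and "\<And>x. 0 \<le> f x" "\<And>x. 0 \<le> g x"
  shows "mutual s h (\<lambda>x. f x + g x) = mutual s h f + mutual s h g"
  unfolding mutual_def using assms(4,5)
  by (simp add: nn_integral_add[symmetric] pot_add distrib_left)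

section \<open>Inserting a particle into a coupling\<close>

lemma sets_coupling: "P \<in> couplings N \<rho> \<Longrightarrow> sets P = sets (config_space N)"
  by (simp add: couplings_def symmetric_prob_def)

lemma prob_space_coupling: "P \<in> couplings N \<rho> \<Longrightarrow> prob_space P"
  by (simp add: couplings_def symmetric_prob_def)

text \<open>Additive observables do not see the correlations: their mean depends on the coupling
  through \<rho> alone. With \<open>h\<close> a potential this evaluates the cost of independent
  insertion.\<close>

lemma nn_integral_coupling:
  assumes P: "P \<in> couplings N \<rho>" and [measurable]: "h \<in> borel_measurable borel" "\<rho> \<in> borel_measurable borel"
  shows "(\<integral>\<^sup>+x. (\<Sum>i<N. h (x i)) \<partial>P) = (\<integral>\<^sup>+x. ennreal (\<rho> x) * h x \<partial>lborel)"
proof -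
  have "(\<integral>\<^sup>+x. (\<Sum>i<N. h (x i)) \<partial>P) = (\<integral>\<^sup>+x. h x \<partial>density lborel (\<lambda>x. ennreal (\<rho> x)))"
    using P nn_integral_one_body[OF sets_coupling[OF P], of h] by (simp add: couplings_def)
  then show ?thesis by (simp add: nn_integral_density)
qed

text \<open>Here \<open>w x\<close> is the conditional density of the new particle given the old
  configuration \<open>x\<close>, and \<open>wg\<close> says that averaging over \<open>x\<close>
  leaves the density \<open>g\<close>. The new particle takes index \<open>N\<close>. The joint law
  is in general not symmetric, which \<open>W_fun_le\<close> tolerates.\<close>

lemma W_fun_insert_kernel:
  fixes P :: "(nat \<Rightarrow> 'a::euclidean_space) measure"
  assumes P: "P \<in> couplings N \<rho>"
    and \<rho> [measurable]: "\<rho> \<in> borel_measurable borel" and \<rho>0: "\<And>x. 0 \<le> \<rho> x"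
    and g [measurable]: "g \<in> borel_measurable borel" and g0: "\<And>x. 0 \<le> g x"
    and w [measurable]: "(\<lambda>(x, y). w x y) \<in> borel_measurable (config_space N \<Otimes>\<^sub>M borel)"
    and w1: "\<And>x. (\<integral>\<^sup>+y. w x y \<partial>lborel) = 1"
    and wg: "\<And>y. (\<integral>\<^sup>+x. w x y \<partial>P) = ennreal (g y)"
  shows "W_fun s (Suc N) (\<lambda>x. \<rho> x + g x)
    \<le> (\<integral>\<^sup>+x. cost s N x \<partial>P) + (\<integral>\<^sup>+x. \<integral>\<^sup>+y. w x y * (\<Sum>i<N. riesz s (x i) y) \<partial>lborel \<partial>P)"
proof -
  note setsP [measurable_cong] = sets_coupling[OF P]
  interpret P: prob_space P by (rule prob_space_coupling[OF P])
  interpret PL: pair_sigma_finite P lborel ..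
  define Q where "Q = density (P \<Otimes>\<^sub>M lborel) (\<lambda>(x, y). w x y)"
  let ?ins = "\<lambda>(x, y). x(N := y)"
  have ins: "?ins \<in> config_space N \<Otimes>\<^sub>M borel \<rightarrow>\<^sub>M config_space (Suc N)"
    unfolding config_space_def lessThan_Suc by (rule measurable_add_dim)
  have setsPL: "sets (P \<Otimes>\<^sub>M lborel) = sets (config_space N \<Otimes>\<^sub>M borel)"
    by (rule sets_pair_measure_cong) (simp_all add: setsP)
  have w_PL [measurable]: "(\<lambda>(x, y). w x y) \<in> borel_measurable (P \<Otimes>\<^sub>M lborel)"
    using w by (simp cong: measurable_cong_sets add: setsPL)
  have ins_PL: "?ins \<in> P \<Otimes>\<^sub>M lborel \<rightarrow>\<^sub>M config_space (Suc N)"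
    using ins by (subst measurable_cong_sets[OF setsPL refl])
  have ins_Q: "?ins \<in> Q \<rightarrow>\<^sub>M config_space (Suc N)"
    unfolding Q_def using ins_PL by simp
  define P' where "P' = distr Q (config_space (Suc N)) ?ins"
  have int_Q: "(\<integral>\<^sup>+z. F z \<partial>Q) = (\<integral>\<^sup>+x. \<integral>\<^sup>+y. w x y * F (x, y) \<partial>lborel \<partial>P)"
    if [measurable]: "F \<in> borel_measurable (P \<Otimes>\<^sub>M lborel)" for F :: "_ \<Rightarrow> ennreal"
  proof -
    have "(\<integral>\<^sup>+z. F z \<partial>Q) = (\<integral>\<^sup>+z. (case z of (x, y) \<Rightarrow> w x y) * F z \<partial>(P \<Otimes>\<^sub>M lborel))"
      unfolding Q_def by (rule nn_integral_density) auto
    also have "\<dots> = (\<integral>\<^sup>+x. \<integral>\<^sup>+y. w x y * F (x, y) \<partial>lborel \<partial>P)"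
      by (subst lborel.nn_integral_fst[symmetric]) auto
    finally show ?thesis .
  qed
  have int_P': "(\<integral>\<^sup>+z. F z \<partial>P') = (\<integral>\<^sup>+x. \<integral>\<^sup>+y. w x y * F (x(N := y)) \<partial>lborel \<partial>P)"
    if F: "F \<in> borel_measurable (config_space (Suc N))" for F :: "_ \<Rightarrow> ennreal"
  proof -
    have "(\<integral>\<^sup>+z. F z \<partial>P') = (\<integral>\<^sup>+z. F (case z of (x, y) \<Rightarrow> x(N := y)) \<partial>Q)"
      unfolding P'_def by (rule nn_integral_distr[OF ins_Q]) (simp add: F)
    also have "\<dots> = (\<integral>\<^sup>+x. \<integral>\<^sup>+y. w x y * F (x(N := y)) \<partial>lborel \<partial>P)"
      using measurable_compose[OF ins_PL F] by (subst int_Q) auto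
    finally show ?thesis .
  qed
  have wy [measurable]: "w x \<in> borel_measurable borel" if "x \<in> space P" for x
    using measurable_compose[OF measurable_Pair1'[of x "config_space N" borel] w] that sets_eq_imp_space_eq[OF setsP]
    by simp
  have prob: "prob_space P'"
  proof (rule prob_spaceI)
    have "emeasure P' (space P') = (\<integral>\<^sup>+z. 1 \<partial>P')" by simp
    also have "\<dots> = 1" by (subst int_P') (auto simp: w1 P.emeasure_space_1)
    finally show "emeasure P' (space P') = 1" .
  qed
  have setsP' [measurable_cong]: "sets P' = sets (config_space (Suc N))" by (simp add: P'_def)
  have coord: "(\<lambda>x. x i) \<in> P \<rightarrow>\<^sub>M borel" if "i < N" for i
    using measurable_coord[OF that] by (subst measurable_cong_sets[OF setsP refl])
  have ob: "one_body (Suc N) P' = density lborel (\<lambda>x. ennreal (\<rho> x + g x))"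
  proof (rule measure_eqI)
    fix A :: "'a set" assume "A \<in> sets (one_body (Suc N) P')"
    then have A [measurable]: "A \<in> sets borel" by simp
    have m1 [measurable]: "(\<lambda>x. \<Sum>i<N. indicator A (x i) :: ennreal) \<in> borel_measurable P"
      by (auto intro!: borel_measurable_sum measurable_compose[OF coord])
    have m2: "(\<lambda>x. \<Sum>i<Suc N. indicator A (x i) :: ennreal) \<in> borel_measurable (config_space (Suc N))"
      by (intro borel_measurable_sum measurable_compose[OF measurable_coord]) auto
    have "emeasure (one_body (Suc N) P') A = (\<integral>\<^sup>+x. (\<Sum>i<Suc N. indicator A (x i)) \<partial>P')"
      by (rule emeasure_one_body_eq_nn_integral[OF setsP' A])
    also have "\<dots> = (\<integral>\<^sup>+x. \<integral>\<^sup>+y. w x y * ((\<Sum>i<N. indicator A (x i)) + indicator A y) \<partial>lborel \<partial>P)"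
      by (subst int_P'[OF m2]) simp
    also have "\<dots> = (\<integral>\<^sup>+x. ((\<Sum>i<N. indicator A (x i)) + (\<integral>\<^sup>+y. w x y * indicator A y \<partial>lborel)) \<partial>P)"
      by (rule nn_integral_cong) (simp add: distrib_left nn_integral_add nn_integral_multc w1)
    also have "\<dots> = (\<integral>\<^sup>+x. (\<Sum>i<N. indicator A (x i)) \<partial>P) + (\<integral>\<^sup>+x. \<integral>\<^sup>+y. w x y * indicator A y \<partial>lborel \<partial>P)"
      by (rule nn_integral_add) measurable
    also have "(\<integral>\<^sup>+x. \<integral>\<^sup>+y. w x y * indicator A y \<partial>lborel \<partial>P) = (\<integral>\<^sup>+y. \<integral>\<^sup>+x. w x y * indicator A y \<partial>P \<partial>lborel)"
      by (rule PL.Fubini'[symmetric]) measurable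
    also have "\<dots> = (\<integral>\<^sup>+y. ennreal (g y) * indicator A y \<partial>lborel)"
      by (rule nn_integral_cong) (simp add: nn_integral_multc wg)
    also have "(\<integral>\<^sup>+x. (\<Sum>i<N. indicator A (x i)) \<partial>P) = (\<integral>\<^sup>+y. ennreal (\<rho> y) * indicator A y \<partial>lborel)"
      by (rule nn_integral_coupling[OF P]) auto
    also have "\<dots> + (\<integral>\<^sup>+y. ennreal (g y) * indicator A y \<partial>lborel)
        = (\<integral>\<^sup>+y. ennreal (\<rho> y + g y) * indicator A y \<partial>lborel)"
      using \<rho>0 g0 by (simp add: nn_integral_add[symmetric] distrib_right)
    also have "\<dots> = emeasure (density lborel (\<lambda>x. ennreal (\<rho> x + g x))) A"
      by (simp add: emeasure_density)
    finally show "emeasure (one_body (Suc N) P') A = emeasure (density lborel (\<lambda>x. ennreal (\<rho> x + g x))) A" .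
  qed simp
  have m3: "(\<lambda>(x, y). \<Sum>i<N. riesz s (x i) y) \<in> borel_measurable (P \<Otimes>\<^sub>M lborel)"
    unfolding split_beta
    by (auto intro!: borel_measurable_sum borel_measurable_riesz measurable_compose[OF measurable_fst coord])
  have [measurable]: "cost s N \<in> borel_measurable P"
    using borel_measurable_cost by (simp cong: measurable_cong_sets add: setsP)
  have "W_fun s (Suc N) (\<lambda>x. \<rho> x + g x) \<le> (\<integral>\<^sup>+x. cost s (Suc N) x \<partial>P')"
    by (rule W_fun_le[OF prob setsP' ob])
  also have "\<dots> = (\<integral>\<^sup>+x. \<integral>\<^sup>+y. w x y * (cost s N x + (\<Sum>i<N. riesz s (x i) y)) \<partial>lborel \<partial>P)"
    by (subst int_P') (auto simp: cost_Suc)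
  also have "\<dots> = (\<integral>\<^sup>+x. (cost s N x + (\<integral>\<^sup>+y. w x y * (\<Sum>i<N. riesz s (x i) y) \<partial>lborel)) \<partial>P)"
    by (rule nn_integral_cong) (simp add: distrib_left nn_integral_add nn_integral_multc w1)
  also have "\<dots> = (\<integral>\<^sup>+x. cost s N x \<partial>P) + (\<integral>\<^sup>+x. \<integral>\<^sup>+y. w x y * (\<Sum>i<N. riesz s (x i) y) \<partial>lborel \<partial>P)"
  proof (rule nn_integral_add)
    have "(\<lambda>z. (case z of (x, y) \<Rightarrow> w x y) * (case z of (x, y) \<Rightarrow> \<Sum>i<N. riesz s (x i) y)) \<in> borel_measurable (P \<Otimes>\<^sub>M lborel)"
      by (rule borel_measurable_times_ennreal[OF w_PL m3])
    then show "(\<lambda>x. \<integral>\<^sup>+y. w x y * (\<Sum>i<N. riesz s (x i) y) \<partial>lborel) \<in> borel_measurable P"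
      by (intro lborel.borel_measurable_nn_integral) (simp add: split_beta')
  qed measurable
  finally show ?thesis .
qed

text \<open>
  The new particle has conditional law \<open>b f + (1 - b) h\<close> given the old configuration. Bounding
  \<open>1 - b\<close> by \<open>1\<close> in the part coming from \<open>h\<close> is harmless, as \<open>h\<close> will have negligible interaction.
\<close>

lemma W_fun_insert:
  fixes P :: "(nat \<Rightarrow> 'a::euclidean_space) measure"
  assumes P: "P \<in> couplings N \<rho>"
    and \<rho> [measurable]: "\<rho> \<in> borel_measurable borel" and \<rho>0: "\<And>x. 0 \<le> \<rho> x"
    and f [measurable]: "f \<in> borel_measurable borel" and f0: "\<And>x. 0 \<le> f x" and f1: "(\<integral>\<^sup>+x. ennreal (f x) \<partial>lborel) = 1"
    and h [measurable]: "h \<in> borel_measurable borel" and h0: "\<And>x. 0 \<le> h x" and h1: "(\<integral>\<^sup>+x. ennreal (h x) \<partial>lborel) = 1"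
    and b [measurable]: "b \<in> borel_measurable (config_space N)" and b01: "\<And>x. 0 \<le> b x" "\<And>x. b x \<le> 1"
    and e0: "0 \<le> e" and b_int: "(\<integral>\<^sup>+x. ennreal (b x) \<partial>P) = ennreal e"
  shows "W_fun s (Suc N) (\<lambda>x. \<rho> x + (e * f x + (1 - e) * h x))
    \<le> (\<integral>\<^sup>+x. cost s N x \<partial>P) + ((\<integral>\<^sup>+x. ennreal (b x) * (\<Sum>i<N. pot s f (x i)) \<partial>P) + mutual s \<rho> h)"
proof -
  note setsP [measurable_cong] = sets_coupling[OF P]
  interpret P: prob_space P by (rule prob_space_coupling[OF P])
  have b_P [measurable]: "b \<in> borel_measurable P" by measurable
  have coord: "(\<lambda>x. x i) \<in> P \<rightarrow>\<^sub>M borel" if "i < N" for i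
    using measurable_coord[OF that] by (subst measurable_cong_sets[OF setsP refl])
  have pot_sum [measurable]: "(\<lambda>x. \<Sum>i<N. pot s u (x i)) \<in> borel_measurable P"
    if [measurable]: "u \<in> borel_measurable borel" for u
    by (auto intro!: borel_measurable_sum measurable_compose[OF coord])
  define w where "w x y = ennreal (b x) * ennreal (f y) + ennreal (1 - b x) * ennreal (h y)" for x y
  \<comment> \<open>Both facts come from integrating \<open>b + (1 - b) = 1\<close>. The finite
    summand \<open>ennreal e\<close> is cancelled rather than subtracted, as subtraction in
    \<open>ennreal\<close> truncates.\<close>
  have one_minus: "(\<integral>\<^sup>+x. ennreal (1 - b x) \<partial>P) = ennreal (1 - e)" and e1: "e \<le> 1"
  proof -
    have "(\<integral>\<^sup>+x. ennreal (1 - b x) \<partial>P) + ennreal e = (\<integral>\<^sup>+x. ennreal (1 - b x) + ennreal (b x) \<partial>P)"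
      unfolding b_int[symmetric] by (rule nn_integral_add[symmetric]) measurable
    also have "\<dots> = (\<integral>\<^sup>+x. 1 \<partial>P)"
      using b01 by (intro nn_integral_cong) (simp flip: ennreal_plus)
    finally have *: "(\<integral>\<^sup>+x. ennreal (1 - b x) \<partial>P) + ennreal e = ennreal 1"
      by (simp add: P.emeasure_space_1)
    have "ennreal e \<le> ennreal 1" unfolding *[symmetric] by simp
    then show "e \<le> 1" by simp
    then have "ennreal (1 - e) + ennreal e = ennreal 1"
      using e0 by (subst ennreal_plus[symmetric]) auto
    with * have "(\<integral>\<^sup>+x. ennreal (1 - b x) \<partial>P) + ennreal e = ennreal (1 - e) + ennreal e"
      by (rule trans[OF _ sym])
    then show "(\<integral>\<^sup>+x. ennreal (1 - b x) \<partial>P) = ennreal (1 - e)"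
      by (simp add: add.commute[of _ "ennreal e"] ennreal_add_left_cancel)
  qed
  have wm: "(\<lambda>(x, y). w x y) \<in> borel_measurable (config_space N \<Otimes>\<^sub>M borel)"
    unfolding w_def by measurable
  have w1: "(\<integral>\<^sup>+y. w x y \<partial>lborel) = 1" for x
  proof -
    have "(\<integral>\<^sup>+y. w x y \<partial>lborel) = ennreal (b x) + ennreal (1 - b x)"
      unfolding w_def by (simp add: nn_integral_add nn_integral_cmult f1 h1)
    then show ?thesis using b01[of x] by (simp flip: ennreal_plus)
  qed
  have g0: "0 \<le> e * f x + (1 - e) * h x" for x using f0[of x] h0[of x] e0 e1 by simp
  have wg: "(\<integral>\<^sup>+x. w x y \<partial>P) = ennreal (e * f y + (1 - e) * h y)" for y
  proof -
    have "(\<integral>\<^sup>+x. w x y \<partial>P) = ennreal e * ennreal (f y) + ennreal (1 - e) * ennreal (h y)"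
      unfolding w_def by (simp add: nn_integral_add nn_integral_multc b_int one_minus)
    then show ?thesis using e0 e1 f0[of y] h0[of y] by (simp add: ennreal_mult ennreal_plus)
  qed
  have "W_fun s (Suc N) (\<lambda>x. \<rho> x + (e * f x + (1 - e) * h x))
    \<le> (\<integral>\<^sup>+x. cost s N x \<partial>P) + (\<integral>\<^sup>+x. \<integral>\<^sup>+y. w x y * (\<Sum>i<N. riesz s (x i) y) \<partial>lborel \<partial>P)"
    by (rule W_fun_insert_kernel[where g = "\<lambda>x. e * f x + (1 - e) * h x" and w = w, OF P \<rho> \<rho>0 _ g0 wm w1 wg]) measurable
  also have "(\<integral>\<^sup>+x. \<integral>\<^sup>+y. w x y * (\<Sum>i<N. riesz s (x i) y) \<partial>lborel \<partial>P)
      \<le> (\<integral>\<^sup>+x. ennreal (b x) * (\<Sum>i<N. pot s f (x i)) + (\<Sum>i<N. pot s h (x i)) \<partial>P)"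
  proof (rule nn_integral_mono)
    fix x :: "nat \<Rightarrow> 'a"
    have pot_eq: "(\<integral>\<^sup>+y. ennreal (u y) * (\<Sum>i<N. riesz s (x i) y) \<partial>lborel) = (\<Sum>i<N. pot s u (x i))"
      if [measurable]: "u \<in> borel_measurable borel" for u
      unfolding pot_def sum_distrib_left
    proof (rule nn_integral_sum)
      show "(\<lambda>y. ennreal (u y) * riesz s (x i) y) \<in> borel_measurable lborel" for i
        by (intro borel_measurable_times_ennreal measurable_compose[OF _ measurable_ennreal])
          (simp_all add: borel_measurable_riesz')
    qed
    have "(\<integral>\<^sup>+y. w x y * (\<Sum>i<N. riesz s (x i) y) \<partial>lborel)
        = ennreal (b x) * (\<Sum>i<N. pot s f (x i)) + ennreal (1 - b x) * (\<Sum>i<N. pot s h (x i))"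
      unfolding w_def
      by (simp add: distrib_right mult.assoc nn_integral_add nn_integral_cmult pot_eq)
    also have "ennreal (1 - b x) * (\<Sum>i<N. pot s h (x i)) \<le> 1 * (\<Sum>i<N. pot s h (x i))"
      using b01[of x] by (intro mult_right_mono) auto
    finally show "(\<integral>\<^sup>+y. w x y * (\<Sum>i<N. riesz s (x i) y) \<partial>lborel)
        \<le> ennreal (b x) * (\<Sum>i<N. pot s f (x i)) + (\<Sum>i<N. pot s h (x i))"
      by (simp add: add_left_mono)
  qed
  also have "\<dots> = (\<integral>\<^sup>+x. ennreal (b x) * (\<Sum>i<N. pot s f (x i)) \<partial>P) + (\<integral>\<^sup>+x. (\<Sum>i<N. pot s h (x i)) \<partial>P)"
    by (rule nn_integral_add) measurable
  also have "(\<integral>\<^sup>+x. (\<Sum>i<N. pot s h (x i)) \<partial>P) = mutual s \<rho> h"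
    unfolding mutual_def by (rule nn_integral_coupling[OF P]) auto
  finally show ?thesis by (simp add: add_left_mono)
qed

text \<open>Base of the induction that proves \<open>W_fun\<close> finite. With no particles the
  configuration space has one point, the function that is \<open>undefined\<close>
  everywhere.\<close>

lemma W_fun_0: "W_fun s 0 (\<lambda>x::'a::euclidean_space. 0) = 0"
proof -
  let ?P = "return (config_space 0) (\<lambda>x. undefined) :: (nat \<Rightarrow> 'a) measure"
  have ob: "one_body 0 ?P = density lborel (\<lambda>x. ennreal 0)"
    by (rule measure_eqI) (auto simp: emeasure_one_body emeasure_density)
  have "prob_space ?P"
    by (rule prob_space_return) (simp add: config_space_def space_PiM)
  then have "W_fun s 0 (\<lambda>x::'a. 0) \<le> (\<integral>\<^sup>+x. cost s 0 x \<partial>?P)"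
    by (rule W_fun_le[OF _ _ ob]) simp
  then show ?thesis by (simp add: cost_def)
qed

section \<open>Estimates for the Riesz potential\<close>

text \<open>False on the diagonal, where \<open>0 powr - s = 0\<close> while the kernel is
  \<infinity>; hence the separate treatment of \<open>x = y\<close> in the bounds that
  follow.\<close>

lemma riesz_eq: "x \<noteq> y \<Longrightarrow> riesz s x y = ennreal (norm (x - y) powr - s)"
  using divide_ennreal[of 1 "norm (x - y) powr s"] by (simp add: riesz_def powr_minus_divide)

lemma sets_ball [measurable]: "ball (c::'a::euclidean_space) r \<in> sets borel"
  by simp

lemma riesz_refl: "riesz s x x = \<infinity>"
  by (simp add: riesz_def)

lemma riesz_le:
  assumes "0 < s" "0 < t" "t \<le> norm (x - y)"
  shows "riesz s x y \<le> ennreal (t powr - s)"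
  using assms by (subst riesz_eq) (auto intro!: ennreal_leI powr_mono2')

lemma riesz_ge:
  assumes "0 < s" "0 < t" "norm (x - y) \<le> t"
  shows "ennreal (t powr - s) \<le> riesz s x y"
proof (cases "x = y")
  case False
  then show ?thesis using assms by (subst riesz_eq) (auto intro!: ennreal_leI powr_mono2')
qed (simp add: riesz_refl)

lemma riesz_scaleR:
  assumes "0 < r"
  shows "riesz s (r *\<^sub>R x) (r *\<^sub>R y) = ennreal (r powr - s) * riesz s x y"
proof (cases "x = y")
  case True
  then show ?thesis using assms by (simp add: riesz_refl ennreal_mult_top)
next
  case False
  then show ?thesis using assms
    by (simp add: riesz_eq powr_mult ennreal_mult flip: scaleR_diff_right)
qed

section \<open>Translation, scaling and the potential of a ball\<close>

lemma nn_integral_lborel_translate: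
  fixes F :: "'a::euclidean_space \<Rightarrow> ennreal"
  assumes [measurable]: "F \<in> borel_measurable borel"
  shows "(\<integral>\<^sup>+x. F (c + x) \<partial>lborel) = (\<integral>\<^sup>+x. F x \<partial>lborel)"
  by (subst (2) lborel_distr_plus[of c, symmetric], subst nn_integral_distr) auto

lemma nn_integral_lborel_scaleR:
  fixes F :: "'a::euclidean_space \<Rightarrow> ennreal"
  assumes [measurable]: "F \<in> borel_measurable borel" and "0 < c"
  shows "(\<integral>\<^sup>+x. F x \<partial>lborel) = ennreal (c ^ DIM('a)) * (\<integral>\<^sup>+x. F (c *\<^sub>R x) \<partial>lborel)"
proof -
  have "(lborel :: 'a measure) = density (distr lborel borel (\<lambda>x. 0 + c *\<^sub>R x)) (\<lambda>_. ennreal (\<bar>c\<bar> ^ DIM('a)))"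
    using assms by (intro lborel_affine) auto
  then have "(\<integral>\<^sup>+x. F x \<partial>lborel)
      = (\<integral>\<^sup>+x. F x \<partial>density (distr lborel borel (\<lambda>x. 0 + c *\<^sub>R x)) (\<lambda>_. ennreal (\<bar>c\<bar> ^ DIM('a))))"
    by (rule arg_cong)
  also have "\<dots> = ennreal (c ^ DIM('a)) * (\<integral>\<^sup>+x. F (c *\<^sub>R x) \<partial>lborel)"
    using assms(2) by (simp add: nn_integral_density nn_integral_distr nn_integral_cmult)
  finally show ?thesis .
qed

text \<open>The unit of all energy estimates: by scaling it reduces to radius 1, and it bounds the
  potential of the ball at every other point. The type argument carries the dimension.\<close>

definition ball_pot :: "'a::euclidean_space itself \<Rightarrow> real \<Rightarrow> real \<Rightarrow> ennreal" where
  "ball_pot _ s r = pot s (indicator (ball (0::'a) r)) 0"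

lemma pot_indicator: "pot s (indicator A) x = (\<integral>\<^sup>+y. indicator A y * riesz s x y \<partial>lborel)"
  unfolding pot_def by (intro nn_integral_cong) (auto simp: indicator_def)

lemma pot_indicator_ball_translate:
  fixes c :: "'a::euclidean_space"
  shows "pot s (indicator (ball c r)) (c + x) = pot s (indicator (ball 0 r)) x"
proof -
  have "pot s (indicator (ball c r)) (c + x) = (\<integral>\<^sup>+y. indicator (ball c r) (c + y) * riesz s (c + x) (c + y) \<partial>lborel)"
    unfolding pot_indicator by (rule nn_integral_lborel_translate[symmetric]) measurable
  also have "\<dots> = pot s (indicator (ball 0 r)) x"
    unfolding pot_indicator by (rule nn_integral_cong) (auto simp: riesz_def indicator_def dist_norm)
  finally show ?thesis .
qed

lemma pot_indicator_mono: "A \<subseteq> B \<Longrightarrow> pot s (indicator A) x \<le> pot s (indicator B) x"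
  unfolding pot_indicator by (intro nn_integral_mono mult_right_mono) (auto simp: indicator_def)

lemma pot_indicator_ball_center: "pot s (indicator (ball x r)) (x::'a::euclidean_space) = ball_pot TYPE('a) s r"
  using pot_indicator_ball_translate[of s x r 0] by (simp add: ball_pot_def)

lemma pot_indicator_le:
  assumes "0 < s" "0 < t" "\<And>y. y \<in> E \<Longrightarrow> t \<le> norm (x - y)" and [measurable]: "E \<in> sets borel"
  shows "pot s (indicator E) x \<le> ennreal (t powr - s) * emeasure lborel E"
proof -
  have "pot s (indicator E) x \<le> (\<integral>\<^sup>+y. ennreal (t powr - s) * indicator E y \<partial>lborel)"
    unfolding pot_indicator using assms(3)
    by (intro nn_integral_mono) (auto simp: indicator_def intro!: riesz_le assms)
  then show ?thesis by (simp add: nn_integral_cmult)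
qed

lemma pot_indicator_ge:
  assumes "0 < s" "0 < t" "\<And>y. y \<in> E \<Longrightarrow> norm (x - y) \<le> t" and [measurable]: "E \<in> sets borel"
  shows "ennreal (t powr - s) * emeasure lborel E \<le> pot s (indicator E) x"
proof -
  have "(\<integral>\<^sup>+y. ennreal (t powr - s) * indicator E y \<partial>lborel) \<le> pot s (indicator E) x"
    unfolding pot_indicator using assms(3)
    by (intro nn_integral_mono) (auto simp: indicator_def intro!: riesz_ge assms)
  then show ?thesis by (simp add: nn_integral_cmult)
qed

text \<open>Homogeneity: the change of variables contributes \<open>r powr d\<close>, the kernel
  \<open>r powr - s\<close>.\<close>

lemma ball_pot_scale:
  assumes "0 < r"
  shows "ball_pot TYPE('a::euclidean_space) s r = ennreal (r powr (real DIM('a) - s)) * ball_pot TYPE('a) s 1"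
proof -
  have "ball_pot TYPE('a) s r = ennreal (r ^ DIM('a)) *
      (\<integral>\<^sup>+y. indicator (ball (0::'a) r) (r *\<^sub>R y) * riesz s 0 (r *\<^sub>R y) \<partial>lborel)"
    unfolding ball_pot_def pot_indicator by (rule nn_integral_lborel_scaleR) (use assms in auto)
  also have "(\<integral>\<^sup>+y. indicator (ball (0::'a) r) (r *\<^sub>R y) * riesz s 0 (r *\<^sub>R y) \<partial>lborel)
      = (\<integral>\<^sup>+y. ennreal (r powr - s) * (indicator (ball (0::'a) 1) y * riesz s 0 y) \<partial>lborel)"
    using assms riesz_scaleR[OF assms, of s 0] by (intro nn_integral_cong) (auto simp: indicator_def)
  also have "\<dots> = ennreal (r powr - s) * ball_pot TYPE('a) s 1"
    unfolding ball_pot_def pot_indicator by (rule nn_integral_cmult) measurable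
  also have "ennreal (r ^ DIM('a)) * (ennreal (r powr - s) * ball_pot TYPE('a) s 1)
      = ennreal (r powr (real DIM('a) - s)) * ball_pot TYPE('a) s 1"
    using assms
    by (simp add: mult.assoc[symmetric] ennreal_mult[symmetric] powr_realpow[symmetric] powr_add[symmetric] del: DIM_positive)
  finally show ?thesis .
qed

text \<open>Dyadic shells around the origin. The kernel is at most \<open>c k\<close> on the shell
  between radii \<open>(1/2) ^ Suc k\<close> and \<open>(1/2) ^ k\<close>; enlarging each shell to a
  ball leaves a geometric series of ratio \<open>2 powr (s - d)\<close>, which converges as
  \<open>s < d\<close>.\<close>

lemma ball_pot_finite:
  assumes s: "0 < s" "s < real DIM('a::euclidean_space)"
  shows "ball_pot TYPE('a) s r < \<infinity>"
proof -
  let ?d = "DIM('a)"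
  define c where "c k = ((1/2) ^ Suc k :: real) powr - s" for k
  define v where "v = unit_ball_vol (real ?d)"
  have v0: "0 \<le> v" by (simp add: v_def)
  have "ball_pot TYPE('a) s 1 \<le> (\<integral>\<^sup>+z. (\<Sum>k. ennreal (c k) * indicator (ball (0::'a) ((1/2) ^ k)) z) \<partial>lborel)"
    unfolding ball_pot_def pot_indicator
  proof (rule nn_integral_mono_AE, rule AE_mp[OF AE_lborel_singleton[of "0::'a"]], rule AE_I2, intro impI)
    fix z :: 'a assume z: "z \<noteq> 0"
    show "indicator (ball 0 1) z * riesz s 0 z \<le> (\<Sum>k. ennreal (c k) * indicator (ball 0 ((1/2) ^ k)) z)"
    proof (cases "norm z < 1")
      case True
      \<comment> \<open>The least \<open>n\<close> locates the shell: it is not \<open>0\<close>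
        because \<open>norm z < 1\<close>, so its predecessor is the index \<open>k\<close> of the
        shell containing \<open>z\<close>.\<close>
      define n where "n = (LEAST n. (1/2::real) ^ n \<le> norm z)"
      have "\<exists>n. (1/2::real) ^ n < norm z" using z by (intro real_arch_pow_inv) auto
      then have "\<exists>n. (1/2::real) ^ n \<le> norm z" by (auto intro: less_imp_le)
      then have n: "(1/2::real) ^ n \<le> norm z" unfolding n_def by (rule LeastI_ex)
      have "n \<noteq> 0" using n True by (intro notI) simp
      then obtain k where k: "n = Suc k" by (cases n) auto
      have k': "norm z < (1/2) ^ k" using not_less_Least[of k "\<lambda>n. (1/2::real) ^ n \<le> norm z"] k by (simp add: n_def[symmetric])
      have "riesz s 0 z \<le> ennreal (c k)"
        unfolding c_def using n k by (intro riesz_le s) auto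
      then have "indicator (ball 0 1) z * riesz s 0 z \<le> ennreal (c k) * indicator (ball 0 ((1/2) ^ k)) z"
        using True k' by (simp add: indicator_def)
      also have "\<dots> \<le> (\<Sum>k. ennreal (c k) * indicator (ball 0 ((1/2) ^ k)) z)"
        using sum_le_suminf[of "\<lambda>k. ennreal (c k) * indicator (ball 0 ((1/2) ^ k)) z" "{k}"]
        by (simp only: summableI finite.intros zero_le simp_thms sum.insert sum.empty empty_iff not_False_eq_True add_0_right)
      finally show ?thesis .
    qed simp
  qed
  also have "\<dots> = (\<Sum>k. ennreal (c k) * emeasure lborel (ball (0::'a) ((1/2) ^ k)))"
    by (subst nn_integral_suminf) (auto simp: nn_integral_cmult)
  also have "\<dots> = (\<Sum>k. ennreal (2 powr s * v * (2 powr (s - ?d)) ^ k))"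
  proof (rule suminf_cong)
    fix k
    have "ennreal (c k) * emeasure lborel (ball (0::'a) ((1/2) ^ k)) = ennreal (c k * (v * ((1/2) ^ k) ^ ?d))"
    proof -
      have "emeasure lborel (ball (0::'a) ((1/2) ^ k)) = ennreal (v * ((1/2) ^ k) ^ ?d)"
        unfolding v_def by (rule emeasure_ball) simp
      moreover have "0 \<le> c k" by (simp only: c_def powr_ge_zero)
      ultimately show ?thesis by (simp only: ennreal_mult')
    qed
    also have "c k * (v * ((1/2) ^ k) ^ ?d) = 2 powr s * v * (2 powr (s - ?d)) ^ k"
    proof -
      have h: "(1/2::real) ^ m = 2 powr (- real m)" for m
        by (simp only: powr_minus powr_realpow[OF zero_less_numeral] power_one_over inverse_eq_divide)
      have "c k = 2 powr (real (Suc k) * s)" unfolding c_def h powr_powr by (simp add: algebra_simps)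
      moreover have "((1/2::real) ^ k) ^ ?d = 2 powr (- (real k * real ?d))"
        unfolding h by (simp add: powr_power mult.commute)
      moreover have "(2 powr (s - real ?d)) ^ k = 2 powr (real k * (s - real ?d))"
        by (simp add: powr_power mult.commute)
      moreover have "2 powr (real (Suc k) * s) * 2 powr (- (real k * real ?d)) = 2 powr s * 2 powr (real k * (s - real ?d))"
        by (simp add: powr_add[symmetric] algebra_simps)
      ultimately show ?thesis by (simp add: mult_ac)
    qed
    finally show "ennreal (c k) * emeasure lborel (ball (0::'a) ((1/2) ^ k)) = ennreal (2 powr s * v * (2 powr (s - ?d)) ^ k)" .
  qed
  also have "\<dots> = ennreal (\<Sum>k. 2 powr s * v * (2 powr (s - ?d)) ^ k)"
  proof (rule suminf_ennreal2)
    have "norm (2 powr (s - real ?d)) < 1" using s by (simp add: powr_less_one)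
    then show "summable (\<lambda>k. 2 powr s * v * (2 powr (s - ?d)) ^ k)"
      by (intro summable_mult summable_geometric)
  qed (use v0 in auto)
  also have "\<dots> < \<infinity>" by simp
  finally have 1: "ball_pot TYPE('a) s 1 < \<infinity>" .
  show ?thesis
  proof (cases "0 < r")
    case True
    then show ?thesis using 1 by (simp add: ball_pot_scale[OF True] ennreal_mult_less_top)
  next
    case False
    then have "ball (0::'a) r = {}" by simp
    then have "ball_pot TYPE('a) s r = pot s (indicator {}) (0::'a)" by (simp only: ball_pot_def)
    then show ?thesis by (simp add: pot_def)
  qed
qed

lemma ball_pot_pos:
  assumes "0 < s" "0 < r"
  shows "0 < ball_pot TYPE('a::euclidean_space) s r"
proof -
  have "0 < ennreal (r powr - s) * emeasure lborel (ball (0::'a) r)"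
    using assms by (simp add: emeasure_ball ennreal_zero_less_mult_iff)
  also have "\<dots> \<le> ball_pot TYPE('a) s r"
    unfolding ball_pot_def using assms by (intro pot_indicator_ge) auto
  finally show ?thesis .
qed

text \<open>
  The ball around \<open>-x\<close> and the centred ball differ by sets of equal volume, and the kernel is at
  most \<open>r powr - s\<close> on the part outside the centred ball and at least that inside.
\<close>

lemma pot_indicator_ball_le:
  fixes x :: "'a::euclidean_space"
  assumes s: "0 < s" and r: "0 < r"
  shows "pot s (indicator (ball 0 r)) x \<le> ball_pot TYPE('a) s r"
proof -
  let ?B = "ball (0::'a) r" and ?B' = "ball (-x) r"
  let ?k = "\<lambda>A. pot s (indicator A) (0::'a)"
  have add: "?k A = ?k (A \<inter> B) + ?k (A - B)" if [measurable]: "A \<in> sets borel" "B \<in> sets borel" for A B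
    unfolding pot_indicator
    by (subst nn_integral_add[symmetric]) (auto intro!: nn_integral_cong simp: indicator_def)
  have fin: "emeasure lborel ?B < \<infinity>" "emeasure lborel ?B' < \<infinity>"
    using r by (simp_all add: emeasure_ball)
  have eq: "emeasure lborel ?B = emeasure lborel ?B'"
    using r by (simp add: emeasure_ball)
  have "emeasure lborel (?B \<inter> ?B') + emeasure lborel (?B' - ?B) = emeasure lborel ?B'"
    by (subst plus_emeasure) (auto intro!: arg_cong[where f = "emeasure lborel"])
  moreover have "emeasure lborel (?B \<inter> ?B') + emeasure lborel (?B - ?B') = emeasure lborel ?B"
    by (subst plus_emeasure) (auto intro!: arg_cong[where f = "emeasure lborel"])
  moreover have "emeasure lborel (?B \<inter> ?B') \<noteq> \<infinity>"
    using fin(1) emeasure_mono[of "?B \<inter> ?B'" ?B lborel] by (auto simp: top_unique)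
  ultimately have diff: "emeasure lborel (?B' - ?B) = emeasure lborel (?B - ?B')"
    using eq by (metis ennreal_add_left_cancel)
  \<comment> \<open>A shift by \<open>-x\<close> moves the evaluation point to the origin, so that
    the two balls are compared through the same kernel.\<close>
  have "pot s (indicator ?B) x = ?k ?B'"
    using pot_indicator_ball_translate[of s "-x" r x] by simp
  also have "\<dots> = ?k (?B' \<inter> ?B) + ?k (?B' - ?B)" by (rule add) auto
  also have "?k (?B' - ?B) \<le> ennreal (r powr - s) * emeasure lborel (?B' - ?B)"
    by (rule pot_indicator_le) (use s r in auto)
  also have "\<dots> \<le> ?k (?B - ?B')"
    unfolding diff by (rule pot_indicator_ge) (use s r in auto)
  also have "?k (?B' \<inter> ?B) + ?k (?B - ?B') = ?k ?B"
    by (subst add[of ?B ?B']) (auto simp: Int_commute)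
  finally show ?thesis by (simp add: ball_pot_def add_left_mono)
qed

text \<open>A point at distance at most \<open>r0\<close> from the centre is the centre of a ball of
  radius \<open>r - r0\<close> inside the large one; for \<open>r\<close> much larger than
  \<open>r0\<close> almost nothing is lost.\<close>

lemma pot_indicator_ball_ge:
  fixes x :: "'a::euclidean_space"
  assumes "norm x \<le> r0"
  shows "ball_pot TYPE('a) s (r - r0) \<le> pot s (indicator (ball 0 r)) x"
proof -
  have "ball x (r - r0) \<subseteq> ball 0 r"
  proof
    fix y assume "y \<in> ball x (r - r0)"
    then show "y \<in> ball 0 r" using assms norm_triangle_ineq2[of y x] by (auto simp: dist_norm norm_minus_commute)
  qed
  then show ?thesis
    by (subst pot_indicator_ball_center[symmetric]) (rule pot_indicator_mono)
qed

text \<open>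
  It suffices to integrate over \<open>f y \<le> f x\<close>. There, if \<open>\<bar>x - y\<bar> \<ge> f x powr (- 1 / d)\<close>, the kernel is at
  most \<open>f x powr (s / d)\<close>; otherwise bound \<open>f y\<close> by \<open>f x\<close> and integrate the kernel over the ball of
  radius \<open>f x powr (- 1 / d)\<close>. Both contributions are controlled by \<open>\<integral>f powr (1 + s / d)\<close>.
\<close>

lemma mutual_self_finite:
  fixes f :: "'a::euclidean_space \<Rightarrow> real"
  assumes s: "0 < s" "s < real DIM('a)"
    and [measurable]: "f \<in> borel_measurable borel" and f0: "\<And>x. 0 \<le> f x"
    and f1: "(\<integral>\<^sup>+x. ennreal (f x) \<partial>lborel) < \<infinity>"
    and fp: "(\<integral>\<^sup>+x. ennreal (f x powr (1 + s / real DIM('a))) \<partial>lborel) < \<infinity>"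
  shows "mutual s f f < \<infinity>"
proof -
  let ?d = "real DIM('a)" and ?p = "1 + s / real DIM('a)"
  define h where "h x y = ennreal (f x powr ?p) * ennreal (f y)
     + ennreal (f x) * ennreal (f x) * (indicator (ball x (f x powr (- 1 / ?d))) y * riesz s x y)" for x y
  have ball_meas [measurable]: "(\<lambda>(x, y). indicator (ball x (f x powr (- 1 / ?d))) y :: ennreal) \<in> borel_measurable (borel \<Otimes>\<^sub>M borel)"
  proof -
    have "(\<lambda>(x, y). indicator (ball x (f x powr (- 1 / ?d))) y :: ennreal)
        = indicator {z. dist (fst z) (snd z) < f (fst z) powr (- 1 / ?d)}"
      by (auto simp: fun_eq_iff indicator_def)
    then show ?thesis by simp
  qed
  have h_meas [measurable]: "(\<lambda>(x, y). h x y) \<in> borel_measurable (borel \<Otimes>\<^sub>M borel)"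
    unfolding h_def by measurable
  have key: "ennreal (f x) * ennreal (f y) * riesz s x y \<le> h x y" if le: "f y \<le> f x" for x y
  proof (cases "f x = 0")
    case True
    then show ?thesis using le f0[of y] by simp
  next
    case False
    then have fx: "0 < f x" using f0[of x] by simp
    show ?thesis
    proof (cases "norm (x - y) < f x powr (- 1 / ?d)")
      case True
      then have "h x y \<ge> ennreal (f x) * ennreal (f x) * riesz s x y"
        by (simp add: h_def dist_norm)
      moreover have "ennreal (f x) * ennreal (f y) * riesz s x y \<le> ennreal (f x) * ennreal (f x) * riesz s x y"
        using le by (intro mult_right_mono mult_left_mono ennreal_leI) auto
      ultimately show ?thesis by (rule order_trans[rotated])
    next
      case False
      then have "riesz s x y \<le> ennreal ((f x powr (- 1 / ?d)) powr - s)"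
        using fx by (intro riesz_le s) auto
      also have "(f x powr (- 1 / ?d)) powr - s = f x powr (s / ?d)" by (simp add: powr_powr)
      finally have "ennreal (f x) * ennreal (f y) * riesz s x y \<le> ennreal (f x) * ennreal (f y) * ennreal (f x powr (s / ?d))"
        by (rule mult_left_mono) simp
      also have "\<dots> = ennreal (f x powr ?p) * ennreal (f y)"
        using fx by (simp add: powr_add ennreal_mult mult_ac)
      also have "\<dots> \<le> h x y" by (simp add: h_def)
      finally show ?thesis .
    qed
  qed
  have h_int: "(\<integral>\<^sup>+x. \<integral>\<^sup>+y. h x y \<partial>lborel \<partial>lborel) < \<infinity>"
  proof -
    have "(\<integral>\<^sup>+y. h x y \<partial>lborel) \<le> ennreal (f x powr ?p) * ((\<integral>\<^sup>+x. ennreal (f x) \<partial>lborel) + ball_pot TYPE('a) s 1)" for x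
    proof -
      have "(\<integral>\<^sup>+y. h x y \<partial>lborel) = ennreal (f x powr ?p) * (\<integral>\<^sup>+x. ennreal (f x) \<partial>lborel)
          + ennreal (f x) * ennreal (f x) * pot s (indicator (ball x (f x powr (- 1 / ?d)))) x"
        unfolding h_def pot_indicator by (simp add: nn_integral_add nn_integral_cmult)
      also have "ennreal (f x) * ennreal (f x) * pot s (indicator (ball x (f x powr (- 1 / ?d)))) x
          \<le> ennreal (f x powr ?p) * ball_pot TYPE('a) s 1"
      proof (cases "f x = 0")
        case False
        then have fx: "0 < f x" using f0[of x] by simp
        \<comment> \<open>The near radius is chosen to make the exponents match:
          \<open>2 - (d - s) / d = 1 + s / d\<close>.\<close>
        have "f x * f x * (f x powr (- 1 / ?d)) powr (?d - s) = f x powr (1 + 1 + (- 1 / ?d) * (?d - s))"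
          using fx unfolding powr_powr powr_add by simp
        also have "1 + 1 + (- 1 / ?d) * (?d - s) = ?p" by (simp add: field_simps)
        finally have eq: "ennreal (f x) * ennreal (f x) * ennreal ((f x powr (- 1 / ?d)) powr (?d - s)) = ennreal (f x powr ?p)"
          using fx by (simp flip: ennreal_mult)
        have "0 < f x powr (- 1 / ?d)" using fx by simp
        from ball_pot_scale[OF this, where 'a = 'a, of s] show ?thesis
          by (simp only: pot_indicator_ball_center mult.assoc[symmetric] eq order_refl)
      qed simp
      finally show ?thesis by (simp add: distrib_left add_left_mono)
    qed
    then have "(\<integral>\<^sup>+x. \<integral>\<^sup>+y. h x y \<partial>lborel \<partial>lborel)
        \<le> (\<integral>\<^sup>+x. ennreal (f x powr ?p) * ((\<integral>\<^sup>+x. ennreal (f x) \<partial>lborel) + ball_pot TYPE('a) s 1) \<partial>lborel)"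
      by (intro nn_integral_mono)
    also have "\<dots> = (\<integral>\<^sup>+x. ennreal (f x powr ?p) \<partial>lborel) * ((\<integral>\<^sup>+x. ennreal (f x) \<partial>lborel) + ball_pot TYPE('a) s 1)"
      by (rule nn_integral_multc) measurable
    also have "\<dots> < \<infinity>"
      using f1 fp ball_pot_finite[OF s, of 1] by (simp add: ennreal_mult_less_top)
    finally show ?thesis .
  qed
  have "mutual s f f = (\<integral>\<^sup>+x. \<integral>\<^sup>+y. ennreal (f x) * ennreal (f y) * riesz s x y \<partial>lborel \<partial>lborel)"
    unfolding mutual_def pot_def by (simp add: nn_integral_cmult[symmetric] mult.assoc)
  also have "\<dots> \<le> (\<integral>\<^sup>+x. \<integral>\<^sup>+y. h x y + h y x \<partial>lborel \<partial>lborel)"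
  proof (intro nn_integral_mono)
    fix x y
    show "ennreal (f x) * ennreal (f y) * riesz s x y \<le> h x y + h y x"
    proof (cases "f y \<le> f x")
      case True
      then show ?thesis using key[of y x] by (auto intro: order_trans)
    next
      case False
      then have "ennreal (f y) * ennreal (f x) * riesz s y x \<le> h y x" by (intro key) simp
      then show ?thesis by (auto simp: riesz_commute mult_ac intro: order_trans)
    qed
  qed
  also have "\<dots> = (\<integral>\<^sup>+x. \<integral>\<^sup>+y. h x y \<partial>lborel \<partial>lborel) + (\<integral>\<^sup>+x. \<integral>\<^sup>+y. h y x \<partial>lborel \<partial>lborel)"
    by (simp add: nn_integral_add)
  also have "(\<integral>\<^sup>+x. \<integral>\<^sup>+y. h y x \<partial>lborel \<partial>lborel) = (\<integral>\<^sup>+y. \<integral>\<^sup>+x. h y x \<partial>lborel \<partial>lborel)"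
    by (rule lborel_pair.Fubini') simp
  also have "(\<integral>\<^sup>+x. \<integral>\<^sup>+y. h x y \<partial>lborel \<partial>lborel) + \<dots> < \<infinity>" using h_int by simp
  finally show ?thesis .
qed

section \<open>The perturbed density\<close>

text \<open>Split \<open>(a + b) powr (1 + q)\<close> into \<open>(a + b) powr q\<close> times
  \<open>a\<close> and times \<open>b\<close>. The first is bounded by
  \<open>(1 + u) powr q \<le> 1 + u\<close> with \<open>u = b / a\<close>, the second by
  subadditivity of \<open>powr q\<close>. Each leaves one copy of \<open>a powr q * b\<close>, hence
  the factor 2. This mixed term, linear in \<open>b\<close>, vanishes where \<open>a\<close>
  does.\<close>

lemma powr_add_le:
  fixes a b q :: real
  assumes "0 \<le> a" "0 \<le> b" "0 < q" "q \<le> 1"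
  shows "(a + b) powr (1 + q) \<le> a powr (1 + q) + 2 * (a powr q * b) + b powr (1 + q)"
proof (cases "a = 0 \<or> b = 0")
  case True
  then show ?thesis using assms by auto
next
  case False
  then have a: "0 < a" and b: "0 < b" using assms by auto
  have eq: "x powr (1 + q) = x powr q * x" if "0 < x" for x :: real
    using that by (simp add: powr_add)
  have "(1 + b / a) powr q \<le> (1 + b / a) powr 1"
    using a b assms by (intro powr_mono) auto
  then have "a powr q * (1 + b / a) powr q \<le> a powr q * (1 + b / a)"
    using a b by (intro mult_left_mono) auto
  moreover have "a powr q * (1 + b / a) powr q = (a + b) powr q"
    using a by (simp add: powr_mult[symmetric] distrib_left)
  ultimately have 1: "(a + b) powr q * a \<le> a powr q * a + a powr q * b"
    using a by (simp add: field_simps)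
  have "a / (a + b) \<le> (a / (a + b)) powr q" "b / (a + b) \<le> (b / (a + b)) powr q"
    using powr_mono'[of q 1 "a / (a + b)"] powr_mono'[of q 1 "b / (a + b)"] a b assms by auto
  then have "a / (a + b) + b / (a + b) \<le> (a / (a + b)) powr q + (b / (a + b)) powr q" by (rule add_mono)
  moreover have "a / (a + b) + b / (a + b) = 1" using a b by (simp flip: add_divide_distrib)
  ultimately have "(a + b) powr q \<le> a powr q + b powr q"
    using a b by (simp add: powr_divide field_simps)
  then have "(a + b) powr q * b \<le> (a powr q + b powr q) * b"
    using b by (intro mult_right_mono) auto
  with 1 have "(a + b) powr q * (a + b) \<le> a powr q * a + 2 * (a powr q * b) + b powr q * b"
    by (simp add: algebra_simps)
  then show ?thesis using a b by (simp add: eq)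
qed

lemma powr_add_le_power2:
  fixes a b r :: real
  assumes "0 \<le> a" "0 \<le> b" "0 < r"
  shows "(a + b) powr r \<le> 2 powr r * (a powr r + b powr r)"
proof -
  have "(a + b) powr r \<le> (2 * max a b) powr r"
    using assms by (intro powr_mono2) auto
  also have "\<dots> = 2 powr r * max a b powr r" using assms by (simp add: powr_mult)
  also have "max a b powr r \<le> a powr r + b powr r" by (simp add: max_def)
  finally show ?thesis by simp
qed

text \<open>The exponent \<open>q - 1\<close> is not positive, so above the threshold
  \<open>a\<close> the factor \<open>t powr (q - 1)\<close> is at most
  \<open>a powr (q - 1)\<close>. Integrated, this bounds \<integral>\<rho> powr q over a set by its
  volume and the mass of \<rho>, with a threshold free to be tuned to the volume.\<close>

lemma powr_le_split:
  fixes a t q :: real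
  assumes "0 < a" "0 \<le> t" "0 < q" "q \<le> 1"
  shows "t powr q \<le> a powr q + a powr (q - 1) * t"
proof (cases "t \<le> a")
  case True
  then have "t powr q \<le> a powr q" using assms by (intro powr_mono2) auto
  then show ?thesis using assms by (simp add: add_increasing2)
next
  case False
  then have "t powr (q - 1) \<le> a powr (q - 1)" using assms by (intro powr_mono2') auto
  then have "t powr (q - 1) * t \<le> a powr (q - 1) * t" using assms by (intro mult_right_mono) auto
  moreover have "t powr q = t powr (q - 1) * t" using False assms by (simp add: powr_diff)
  ultimately show ?thesis using assms by (simp add: add_increasing)
qed

text \<open>Used in contraposition: positive mass forces \<open>L_fun\<close> to be positive, which
  makes the quotients meaningful.\<close>

lemma nn_integral_powr_eq_0:
  assumes [measurable]: "f \<in> borel_measurable borel"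
    and "(\<integral>\<^sup>+x. ennreal (f x powr r) \<partial>lborel) = 0"
  shows "(\<integral>\<^sup>+x. ennreal (f x) \<partial>lborel) = 0"
proof -
  have "AE x in lborel. ennreal (f x powr r) = 0"
    using assms(2) by (subst (asm) nn_integral_0_iff_AE) auto
  then have "AE x in lborel. ennreal (f x) = 0"
    by (rule AE_mp) (auto simp: ennreal_eq_0_iff)
  then show ?thesis
    by (subst nn_integral_0_iff_AE) auto
qed

text \<open>A representative that is nonnegative at every point. Optimality is kept out: below,
  \<open>Lam\<close> is just the quotient of \<rho> itself, and the theorem identifies it with
  \<open>Lambda\<close>.\<close>

locale riesz_density =
  fixes s q :: real and N :: nat and \<rho> :: "'a::euclidean_space \<Rightarrow> real"
  assumes s_pos: "0 < s" and s_less: "s < real DIM('a)" and N_pos: "1 \<le> N"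
    and q_eq: "q = s / real DIM('a)"
    and \<rho>_meas [measurable]: "\<rho> \<in> borel_measurable borel" and \<rho>_nonneg: "0 \<le> \<rho> x"
    and \<rho>_mass: "(\<integral>\<^sup>+x. ennreal (\<rho> x) \<partial>lborel) = ennreal (real N)"
    and \<rho>_powr: "(\<integral>\<^sup>+x. ennreal (\<rho> x powr (1 + q)) \<partial>lborel) < \<infinity>"
begin

section \<open>Finite energies and densities of negligible cost\<close>

lemma q_bounds: "0 < q" "q \<le> 1" "q < 1"
  using s_pos s_less by (auto simp: q_eq)

lemma mutual_\<rho>: "mutual s \<rho> \<rho> < \<infinity>"
  by (rule mutual_self_finite) (use s_pos s_less \<rho>_nonneg \<rho>_mass \<rho>_powr in \<open>auto simp: q_eq\<close>)

text \<open>The particles are inserted independently one after the other, each with density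
  \<open>\<rho> / N\<close>; every insertion costs a multiple of
  \<open>mutual s \<rho> \<rho>\<close>, which is finite.\<close>

lemma W_fun_finite: "W_fun s N \<rho> < \<infinity>"
proof -
  have "W_fun s k (\<lambda>x. real k / real N * \<rho> x) < \<infinity>" if "k \<le> N" for k
    using that
  proof (induction k)
    case 0
    then show ?case by (simp add: W_fun_0)
  next
    case (Suc k)
    define \<rho>' where "\<rho>' x = real k / real N * \<rho> x" for x
    define f where "f x = 1 / real N * \<rho> x" for x
    have [measurable]: "\<rho>' \<in> borel_measurable borel" "f \<in> borel_measurable borel"
      unfolding \<rho>'_def f_def by measurable
    have "W_fun s k \<rho>' < \<infinity>" using Suc unfolding \<rho>'_def by simp
    then obtain P where P: "P \<in> couplings k \<rho>'" and cost: "(\<integral>\<^sup>+x. cost s k x \<partial>P) < \<infinity>"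
      unfolding W_fun_def cost_def INF_less_iff by blast
    interpret P: prob_space P by (rule prob_space_coupling[OF P])
    have f1: "(\<integral>\<^sup>+x. ennreal (f x) \<partial>lborel) = 1"
      unfolding f_def using N_pos
      by (simp add: ennreal_mult' nn_integral_cmult \<rho>_mass del: times_divide_eq_left) (simp flip: ennreal_mult')
    have "mutual s \<rho>' f = ennreal (1 / real N) * mutual s \<rho>' \<rho>"
      unfolding f_def by (rule mutual_cmult) auto
    also have "mutual s \<rho>' \<rho> = mutual s \<rho> \<rho>'" by (rule mutual_commute) auto
    also have "\<dots> = ennreal (real k / real N) * mutual s \<rho> \<rho>"
      unfolding \<rho>'_def by (rule mutual_cmult) auto
    finally have fin: "mutual s \<rho>' f < \<infinity>"
      using mutual_\<rho> by (simp add: ennreal_mult_less_top)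
    have "W_fun s (Suc k) (\<lambda>x. \<rho>' x + (1 * f x + (1 - 1) * f x))
        \<le> (\<integral>\<^sup>+x. cost s k x \<partial>P) + ((\<integral>\<^sup>+x. ennreal 1 * (\<Sum>i<k. pot s f (x i)) \<partial>P) + mutual s \<rho>' f)"
      by (rule W_fun_insert[OF P _ _ _ _ f1 _ _ f1]) (auto simp: P.emeasure_space_1 f_def \<rho>'_def \<rho>_nonneg)
    also have "(\<integral>\<^sup>+x. ennreal 1 * (\<Sum>i<k. pot s f (x i)) \<partial>P) = mutual s \<rho>' f"
      unfolding mutual_def by (subst nn_integral_coupling[OF P, symmetric]) auto
    also have "(\<integral>\<^sup>+x. cost s k x \<partial>P) + (mutual s \<rho>' f + mutual s \<rho>' f) < \<infinity>"
      using cost fin by simp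
    also have "(\<lambda>x. \<rho>' x + (1 * f x + (1 - 1) * f x)) = (\<lambda>x. real (Suc k) / real N * \<rho> x)"
      by (auto simp: fun_eq_iff \<rho>'_def f_def add_divide_distrib distrib_right)
    finally show ?case .
  qed
  from this[of N] show ?thesis using N_pos by simp
qed

lemma mutual_indicator_ball_le:
  "mutual s \<rho> (indicator (ball 0 r)) \<le> ennreal (real N) * ball_pot TYPE('a) s r"
proof (cases "0 < r")
  case True
  have "mutual s \<rho> (indicator (ball 0 r)) \<le> (\<integral>\<^sup>+x. ennreal (\<rho> x) * ball_pot TYPE('a) s r \<partial>lborel)"
    unfolding mutual_def by (intro nn_integral_mono mult_left_mono pot_indicator_ball_le s_pos True) auto
  then show ?thesis by (simp add: nn_integral_multc \<rho>_mass)
next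
  case False
  then have "indicator (ball (0::'a) r) = (\<lambda>x. 0 :: real)"
    by (auto simp: indicator_def fun_eq_iff not_less intro: order_trans)
  then show ?thesis by (simp only: mutual_def pot_def) simp
qed

lemma powr_indicator_ball_le:
  assumes "0 < a" "0 \<le> r"
  shows "(\<integral>\<^sup>+x. ennreal (\<rho> x powr q * indicator (ball 0 r) x) \<partial>lborel)
    \<le> ennreal (a powr q * (unit_ball_vol (real DIM('a)) * r ^ DIM('a)) + a powr (q - 1) * real N)"
proof -
  have "(\<integral>\<^sup>+x. ennreal (\<rho> x powr q * indicator (ball 0 r) x) \<partial>lborel)
      \<le> (\<integral>\<^sup>+x. ennreal (a powr q) * indicator (ball 0 r) x + ennreal (a powr (q - 1)) * ennreal (\<rho> x) \<partial>lborel)"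
  proof (rule nn_integral_mono)
    fix x
    have "ennreal (\<rho> x powr q) \<le> ennreal (a powr q + a powr (q - 1) * \<rho> x)"
      using powr_le_split[OF assms(1) \<rho>_nonneg q_bounds(1,2)] by (rule ennreal_leI)
    also have "\<dots> = ennreal (a powr q) + ennreal (a powr (q - 1)) * ennreal (\<rho> x)"
      using \<rho>_nonneg[of x] by (simp add: ennreal_plus ennreal_mult)
    finally show "ennreal (\<rho> x powr q * indicator (ball 0 r) x)
      \<le> ennreal (a powr q) * indicator (ball 0 r) x + ennreal (a powr (q - 1)) * ennreal (\<rho> x)"
      by (simp add: indicator_def)
  qed
  also have "\<dots> = ennreal (a powr q) * emeasure lborel (ball (0::'a) r) + ennreal (a powr (q - 1)) * ennreal (real N)"
    by (simp add: nn_integral_add nn_integral_cmult \<rho>_mass)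
  also have "\<dots> = ennreal (a powr q * (unit_ball_vol (real DIM('a)) * r ^ DIM('a)) + a powr (q - 1) * real N)"
    using assms by (simp add: emeasure_ball ennreal_plus ennreal_mult)
  finally show ?thesis .
qed

text \<open>The uniform density on a ball of large radius \<open>r\<close>. All three quantities are
  of order \<open>r powr - s\<close>: the first because the potential grows like
  \<open>r powr (d - s)\<close> against a volume of order \<open>r powr d\<close>, the others
  because \<open>u powr - q\<close> has this order for the volume \<open>u\<close>.\<close>

lemma spread_out_density:
  assumes "0 < \<delta>"
  obtains h where "h \<in> borel_measurable borel" "\<And>x. 0 \<le> h x" "(\<integral>\<^sup>+x. ennreal (h x) \<partial>lborel) = 1"
    "mutual s \<rho> h \<le> ennreal \<delta>"
    "(\<integral>\<^sup>+x. ennreal (\<rho> x powr q * h x) \<partial>lborel) \<le> ennreal \<delta>"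
    "(\<integral>\<^sup>+x. ennreal (h x powr (1 + q)) \<partial>lborel) \<le> ennreal \<delta>"
proof -
  let ?d = "DIM('a)"
  define v where "v = unit_ball_vol (real ?d)"
  have v: "0 < v" by (simp add: v_def)
  define K where "K = enn2real (ball_pot TYPE('a) s 1)"
  have K: "ball_pot TYPE('a) s 1 = ennreal K" "0 \<le> K"
    using ball_pot_finite[OF s_pos s_less, of 1] by (auto simp: K_def)
  \<comment> \<open>The first summand serves the interaction with \<rho>, the second both integrals
    of powers.\<close>
  define C where "C = real N * K / v + v powr - q * (1 + real N)"
  have "((\<lambda>r. C * r powr - s) \<longlongrightarrow> C * 0) at_top"
    by (intro tendsto_mult tendsto_const tendsto_neg_powr filterlim_ident) (use s_pos in auto)
  then have "eventually (\<lambda>r. C * r powr - s < \<delta>) at_top"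
    using assms by (auto dest: order_tendstoD(2))
  then obtain r where r: "0 < r" "C * r powr - s < \<delta>"
    using eventually_happens'[OF trivial_limit_at_top_linorder eventually_conj[OF eventually_gt_at_top[of 0]]] by blast
  define u where "u = v * r ^ ?d"
  have u: "0 < u" using v r by (simp add: u_def)
  have u_powr: "u powr - q = v powr - q * r powr - s"
    using v r by (simp add: u_def powr_mult powr_realpow[symmetric] powr_powr q_eq)
  have bound1: "real N * K / v * r powr - s \<le> \<delta>" and bound2: "v powr - q * (1 + real N) * r powr - s \<le> \<delta>"
    using r(2) K(2) v unfolding C_def by (auto simp: distrib_right intro: order_trans[rotated, OF less_imp_le])
  define h where "h x = 1 / u * indicator (ball (0::'a) r) x" for x
  have h_meas: "h \<in> borel_measurable borel" unfolding h_def by measurable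
  have em: "emeasure lborel (ball (0::'a) r) = ennreal u"
    using r by (simp add: emeasure_ball u_def v_def)
  show thesis
  proof
    show "h \<in> borel_measurable borel" by fact
    show "0 \<le> h x" for x using u by (simp add: h_def)
    have int_ind: "(\<integral>\<^sup>+x. ennreal (c * indicator (ball (0::'a) r) x) \<partial>lborel) = ennreal (c * u)" if "0 \<le> c" for c
      using that u by (simp add: ennreal_mult' ennreal_indicator nn_integral_cmult em)
    show "(\<integral>\<^sup>+x. ennreal (h x) \<partial>lborel) = 1"
      using u unfolding h_def by (subst int_ind) auto
    have "mutual s \<rho> h = ennreal (1 / u) * mutual s \<rho> (indicator (ball 0 r))"
      unfolding h_def using u by (intro mutual_cmult) auto
    also have "\<dots> \<le> ennreal (1 / u) * (ennreal (real N) * ball_pot TYPE('a) s r)"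
      by (intro mult_left_mono mutual_indicator_ball_le) auto
    also have "\<dots> = ennreal (1 / u * (real N * (r powr (real ?d - s) * K)))"
      using u by (simp only: ball_pot_scale[OF r(1)] K(1) ennreal_mult' powr_ge_zero of_nat_0_le_iff
          divide_nonneg_pos zero_le_one)
    also have "1 / u * (real N * (r powr (real ?d - s) * K)) = real N * K / v * r powr - s"
      using r v by (simp add: u_def powr_diff powr_minus powr_realpow field_simps)
    also have "ennreal \<dots> \<le> ennreal \<delta>" using bound1 by (rule ennreal_leI)
    finally show "mutual s \<rho> h \<le> ennreal \<delta>" .
    have "(\<integral>\<^sup>+x. ennreal (\<rho> x powr q * h x) \<partial>lborel)
        = (\<integral>\<^sup>+x. ennreal (1 / u) * ennreal (\<rho> x powr q * indicator (ball 0 r) x) \<partial>lborel)"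
      unfolding h_def using u by (intro nn_integral_cong) (simp flip: ennreal_mult')
    also have "\<dots> = ennreal (1 / u) * (\<integral>\<^sup>+x. ennreal (\<rho> x powr q * indicator (ball 0 r) x) \<partial>lborel)"
      by (rule nn_integral_cmult) measurable
    \<comment> \<open>The threshold is \<open>1 / u\<close>, the height of \<open>h\<close>: volume
      term and mass term are then both multiples of \<open>u powr - q\<close>.\<close>
    also have "\<dots> \<le> ennreal (1 / u) * ennreal ((1 / u) powr q * (unit_ball_vol (real ?d) * r ^ ?d) + (1 / u) powr (q - 1) * real N)"
      using u r by (intro mult_left_mono powr_indicator_ball_le) auto
    also have "\<dots> = ennreal (1 / u * ((1 / u) powr q * u + (1 / u) powr (q - 1) * real N))"
      unfolding v_def[symmetric] u_def[symmetric] using u by (intro ennreal_mult'[symmetric]) simp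
    also have "1 / u * ((1 / u) powr q * u + (1 / u) powr (q - 1) * real N) = u powr - q * (1 + real N)"
      using u by (simp add: powr_divide powr_diff powr_minus field_simps)
    also have "\<dots> = v powr - q * (1 + real N) * r powr - s" by (simp add: u_powr)
    also have "ennreal \<dots> \<le> ennreal \<delta>" using bound2 by (rule ennreal_leI)
    finally show "(\<integral>\<^sup>+x. ennreal (\<rho> x powr q * h x) \<partial>lborel) \<le> ennreal \<delta>" .
    have "(\<integral>\<^sup>+x. ennreal (h x powr (1 + q)) \<partial>lborel)
        = (\<integral>\<^sup>+x. ennreal ((1 / u) powr (1 + q) * indicator (ball (0::'a) r) x) \<partial>lborel)"
      unfolding h_def by (intro nn_integral_cong) (auto simp: indicator_def)
    also have "\<dots> = ennreal ((1 / u) powr (1 + q) * u)" by (rule int_ind) simp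
    also have "(1 / u) powr (1 + q) * u = u powr - q"
      using u by (simp add: powr_divide powr_add powr_minus field_simps)
    also have "\<dots> \<le> v powr - q * (1 + real N) * r powr - s" by (simp add: u_powr mult_right_mono distrib_left)
    also have "\<dots> \<le> \<delta>" by fact
    finally show "(\<integral>\<^sup>+x. ennreal (h x powr (1 + q)) \<partial>lborel) \<le> ennreal \<delta>"
      by (simp add: ennreal_leI)
  qed
qed

text \<open>\<open>powr_add_le\<close> detaches \<rho> from the inserted density, and
  \<open>powr_add_le_power2\<close> then detaches \<open>f\<close> from \<open>h\<close>. Apart from
  the errors with \<delta>, only \<open>2 * e * \<kappa>\<close> is linear in
  \<open>e\<close>.\<close>

lemma nn_integral_powr_insert:
  assumes [measurable]: "f \<in> borel_measurable borel" "h \<in> borel_measurable borel"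
    and f0: "\<And>x. 0 \<le> f x" and h0: "\<And>x. 0 \<le> h x" and e: "0 \<le> e" "e \<le> 1"
    and F: "(\<integral>\<^sup>+x. ennreal (f x powr (1 + q)) \<partial>lborel) = ennreal F" "0 \<le> F"
    and \<kappa>: "(\<integral>\<^sup>+x. ennreal (\<rho> x powr q * f x) \<partial>lborel) = ennreal \<kappa>" "0 \<le> \<kappa>"
    and L: "(\<integral>\<^sup>+x. ennreal (\<rho> x powr (1 + q)) \<partial>lborel) = ennreal L" "0 \<le> L"
    and h1: "(\<integral>\<^sup>+x. ennreal (\<rho> x powr q * h x) \<partial>lborel) \<le> ennreal \<delta>"
    and h2: "(\<integral>\<^sup>+x. ennreal (h x powr (1 + q)) \<partial>lborel) \<le> ennreal \<delta>" and \<delta>: "0 \<le> \<delta>"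
  shows "(\<integral>\<^sup>+x. ennreal ((\<rho> x + (e * f x + (1 - e) * h x)) powr (1 + q)) \<partial>lborel)
    \<le> ennreal (L + 2 * e * \<kappa> + 2 * \<delta> + 2 powr (1 + q) * e powr (1 + q) * F + 2 powr (1 + q) * \<delta>)"
proof -
  let ?p = "1 + q"
  have "(\<integral>\<^sup>+x. ennreal ((\<rho> x + (e * f x + (1 - e) * h x)) powr ?p) \<partial>lborel)
    \<le> (\<integral>\<^sup>+x. ennreal (\<rho> x powr ?p) + (ennreal (2 * e) * ennreal (\<rho> x powr q * f x)
        + (ennreal 2 * ennreal (\<rho> x powr q * h x) + (ennreal (2 powr ?p * e powr ?p) * ennreal (f x powr ?p)
        + ennreal (2 powr ?p) * ennreal (h x powr ?p)))) \<partial>lborel)"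
  proof (rule nn_integral_mono)
    fix x
    let ?g = "e * f x + (1 - e) * h x"
    have g0: "0 \<le> ?g" using e f0[of x] h0[of x] by simp
    have g_le: "?g \<le> e * f x + h x" using e h0[of x] by (simp add: mult_left_le_one_le)
    have "(\<rho> x + ?g) powr ?p \<le> \<rho> x powr ?p + 2 * (\<rho> x powr q * ?g) + ?g powr ?p"
      by (rule powr_add_le[OF \<rho>_nonneg g0 q_bounds(1,2)])
    also have "\<rho> x powr q * ?g \<le> \<rho> x powr q * (e * f x + h x)"
      using g_le by (intro mult_left_mono) auto
    also have "?g powr ?p \<le> (e * f x + h x) powr ?p"
      using g_le g0 q_bounds by (intro powr_mono2) auto
    also have "\<dots> \<le> 2 powr ?p * ((e * f x) powr ?p + h x powr ?p)"
      using e f0[of x] h0[of x] q_bounds by (intro powr_add_le_power2) auto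
    finally have "(\<rho> x + ?g) powr ?p \<le> \<rho> x powr ?p + (2 * e * (\<rho> x powr q * f x)
        + (2 * (\<rho> x powr q * h x) + (2 powr ?p * e powr ?p * f x powr ?p + 2 powr ?p * h x powr ?p)))"
      using e f0[of x] by (simp add: powr_mult algebra_simps)
    then have "ennreal ((\<rho> x + ?g) powr ?p) \<le> ennreal (\<rho> x powr ?p + (2 * e * (\<rho> x powr q * f x)
        + (2 * (\<rho> x powr q * h x) + (2 powr ?p * e powr ?p * f x powr ?p + 2 powr ?p * h x powr ?p))))"
      by (rule ennreal_leI)
    also have "\<dots> = ennreal (\<rho> x powr ?p) + (ennreal (2 * e) * ennreal (\<rho> x powr q * f x)
        + (ennreal 2 * ennreal (\<rho> x powr q * h x) + (ennreal (2 powr ?p * e powr ?p) * ennreal (f x powr ?p)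
        + ennreal (2 powr ?p) * ennreal (h x powr ?p))))"
      using e f0[of x] h0[of x] by ((subst ennreal_mult'[symmetric], simp)+, (subst ennreal_plus[symmetric], simp, simp)+, simp)
    finally show "ennreal ((\<rho> x + ?g) powr ?p) \<le> \<dots>" .
  qed
  also have "\<dots> = ennreal L + (ennreal (2 * e) * ennreal \<kappa>
        + (ennreal 2 * (\<integral>\<^sup>+x. ennreal (\<rho> x powr q * h x) \<partial>lborel) + (ennreal (2 powr ?p * e powr ?p) * ennreal F
        + ennreal (2 powr ?p) * (\<integral>\<^sup>+x. ennreal (h x powr ?p) \<partial>lborel))))"
    by (simp add: nn_integral_add nn_integral_cmult F \<kappa> L del: ennreal_numeral)
  also have "\<dots> \<le> ennreal L + (ennreal (2 * e) * ennreal \<kappa>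
        + (ennreal 2 * ennreal \<delta> + (ennreal (2 powr ?p * e powr ?p) * ennreal F
        + ennreal (2 powr ?p) * ennreal \<delta>)))"
    by (intro add_mono mult_left_mono h1 h2) auto
  also have "\<dots> = ennreal (L + (2 * e * \<kappa> + (2 * \<delta> + (2 powr ?p * e powr ?p * F + 2 powr ?p * \<delta>))))"
    using e F \<kappa> L \<delta> by ((subst ennreal_mult'[symmetric], simp)+, (subst ennreal_plus[symmetric], simp, simp)+, simp)
  finally show ?thesis by (simp add: add.assoc)
qed

text \<open>
  In units of \<open>e\<close>, placing the new particle with density \<open>f\<close> after the change of measure \<open>a\<close> gains
  \<open>Df - t\<close>, whereas the first-order cost in \<open>L_fun\<close> is \<open>2 \<bar>Lam\<bar> \<kappa>\<close>; all remaining costs are of order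
  \<open>e powr (1 + q)\<close> or come from the spread-out density \<open>h\<close>. The bounds \<open>C\<close> and \<open>t\<close> must not depend
  on \<open>P\<close>, as no optimal coupling is available.
\<close>

lemma strict_gain:
  assumes f [measurable]: "f \<in> borel_measurable borel" and f0: "\<And>x. 0 \<le> f x" and f1: "(\<integral>\<^sup>+x. ennreal (f x) \<partial>lborel) = 1"
    and F: "(\<integral>\<^sup>+x. ennreal (f x powr (1 + q)) \<partial>lborel) = ennreal F" "0 \<le> F"
    and \<kappa>: "(\<integral>\<^sup>+x. ennreal (\<rho> x powr q * f x) \<partial>lborel) = ennreal \<kappa>" "0 \<le> \<kappa>"
    and Df: "mutual s \<rho> f = ennreal Df" "0 \<le> Df"
    and C: "1 \<le> C" and t: "0 \<le> t"
    and transport: "\<And>P. P \<in> couplings N \<rho> \<Longrightarrow> \<exists>a. a \<in> borel_measurable (config_space N) \<and>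
        (\<forall>x. 0 \<le> a x \<and> a x \<le> C) \<and> (\<integral>\<^sup>+x. ennreal (a x) \<partial>P) = 1 \<and>
        (\<integral>\<^sup>+x. ennreal (a x) * (\<Sum>i<N. pot s f (x i)) \<partial>P) \<le> ennreal t"
    and gap: "t + 2 * \<bar>Lam\<bar> * \<kappa> < Df"
    and G: "G_fun s N \<rho> = ereal (Lam * L_fun s \<rho>)"
  shows "\<exists>\<rho>'\<in>(admissible s (Suc N) :: ('a \<Rightarrow> real) set). 0 < L_fun s \<rho>' \<and> ereal (Lam * L_fun s \<rho>') < G_fun s (Suc N) \<rho>'"
proof -
  let ?p = "1 + q"
  define A where "A = \<bar>Lam\<bar> * 2 powr ?p * F"
  define \<gamma> where "\<gamma> = Df - t - 2 * \<bar>Lam\<bar> * \<kappa>"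
  have A: "0 \<le> A" using F by (simp add: A_def)
  have \<gamma>: "0 < \<gamma>" using gap by (simp add: \<gamma>_def)
  \<comment> \<open>The first entry makes \<open>e * a\<close> at most 1, hence usable as the
    probability of placing the particle at \<open>f\<close>. The second makes
    \<open>A * e powr q\<close> smaller than the net first-order gain \<gamma>; the
    \<open>1 +\<close> covers \<open>A = 0\<close>.\<close>
  define e where "e = min (1 / C) ((\<gamma> / (1 + A)) powr (1 / q))"
  have "e \<le> 1 / C" by (simp add: e_def)
  moreover have "1 / C \<le> 1" using C by simp
  moreover have "0 < e" using C A \<gamma> by (simp add: e_def)
  ultimately have e: "0 < e" "e \<le> 1" "e * C \<le> 1"
    using C by (linarith, linarith, simp add: pos_le_divide_eq)
  have "e powr q \<le> ((\<gamma> / (1 + A)) powr (1 / q)) powr q"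
    using e q_bounds by (intro powr_mono2) (auto simp: e_def)
  also have "\<dots> = \<gamma> / (1 + A)" using q_bounds \<gamma> A by (simp add: powr_powr)
  finally have "A * e powr q \<le> A * (\<gamma> / (1 + A))" using A by (rule mult_left_mono)
  also have "\<dots> < \<gamma>" using A \<gamma> by (simp add: field_simps)
  finally have "e * (A * e powr q) < e * \<gamma>" using e by simp
  then have m: "0 < e * (Df - t) - \<bar>Lam\<bar> * (2 * e * \<kappa> + 2 powr ?p * e powr ?p * F)"
    using e by (simp add: A_def \<gamma>_def powr_add algebra_simps)
  define m where "m = e * (Df - t) - \<bar>Lam\<bar> * (2 * e * \<kappa> + 2 powr ?p * e powr ?p * F)"
  \<comment> \<open>Total weight of \<delta> in the final balance: 1 from the interaction of \<rho>
    with \<open>h\<close> and the rest from \<open>L_fun\<close>. The choice of \<delta> lets these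
    errors consume half of the gain \<open>m\<close>.\<close>
  define c where "c = 1 + \<bar>Lam\<bar> * (2 + 2 powr ?p)"
  have c: "1 \<le> c" by (simp add: c_def)
  define \<delta> where "\<delta> = m / (2 * c)"
  have \<delta>: "0 < \<delta>" "\<delta> * c < m" using m c by (auto simp: \<delta>_def m_def)
  obtain h where h [measurable]: "h \<in> borel_measurable borel" and h0: "\<And>x. 0 \<le> h x"
    and h1: "(\<integral>\<^sup>+x. ennreal (h x) \<partial>lborel) = 1" and hD: "mutual s \<rho> h \<le> ennreal \<delta>"
    and h\<kappa>: "(\<integral>\<^sup>+x. ennreal (\<rho> x powr q * h x) \<partial>lborel) \<le> ennreal \<delta>"
    and hp: "(\<integral>\<^sup>+x. ennreal (h x powr ?p) \<partial>lborel) \<le> ennreal \<delta>"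
    using spread_out_density[OF \<delta>(1)] by blast
  define g where "g x = e * f x + (1 - e) * h x" for x
  have g [measurable]: "g \<in> borel_measurable borel" unfolding g_def by measurable
  have g0: "0 \<le> g x" for x using e f0[of x] h0[of x] by (simp add: g_def)
  define \<rho>' where "\<rho>' x = \<rho> x + g x" for x
  have \<rho>' [measurable]: "\<rho>' \<in> borel_measurable borel" unfolding \<rho>'_def by measurable
  have \<rho>'0: "0 \<le> \<rho>' x" for x using \<rho>_nonneg[of x] g0[of x] by (simp add: \<rho>'_def)
  have p_exp: "p_exp TYPE('a) s = ?p" by (simp add: p_exp_def q_eq)
  define L where "L = enn2real (\<integral>\<^sup>+x. ennreal (\<rho> x powr ?p) \<partial>lborel)"
  have L: "(\<integral>\<^sup>+x. ennreal (\<rho> x powr ?p) \<partial>lborel) = ennreal L" "0 \<le> L"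
    using \<rho>_powr by (simp_all add: L_def)
  have L_fun: "L_fun s \<rho> = L"
    unfolding L_fun_def p_exp L_def by (rule integral_eq_nn_integral) auto
  define U where "U = L + 2 * e * \<kappa> + 2 * \<delta> + 2 powr ?p * e powr ?p * F + 2 powr ?p * \<delta>"
  have L'_le: "(\<integral>\<^sup>+x. ennreal (\<rho>' x powr ?p) \<partial>lborel) \<le> ennreal U"
    unfolding \<rho>'_def g_def U_def using f h f0 h0 e(1,2) F \<kappa> L h\<kappa> hp \<delta>(1)
    by (intro nn_integral_powr_insert) auto
  have U0: "0 \<le> U" using e F \<kappa> L \<delta> by (simp add: U_def)
  define L' where "L' = enn2real (\<integral>\<^sup>+x. ennreal (\<rho>' x powr ?p) \<partial>lborel)"
  have L'_fin: "(\<integral>\<^sup>+x. ennreal (\<rho>' x powr ?p) \<partial>lborel) < \<infinity>"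
    using L'_le by (rule le_less_trans) simp
  then have L': "(\<integral>\<^sup>+x. ennreal (\<rho>' x powr ?p) \<partial>lborel) = ennreal L'" "0 \<le> L'"
    by (simp_all add: L'_def)
  have L'_fun: "L_fun s \<rho>' = L'"
    unfolding L_fun_def p_exp L'_def by (rule integral_eq_nn_integral) auto
  have "L' \<le> U" using L'_le L' U0 by simp
  \<comment> \<open>Monotonicity of \<open>L_fun\<close> permits bounding
    \<open>Lam * (L' - L)\<close> by absolute values, so either sign of \<open>Lam\<close> is
    allowed.\<close>
  have "ennreal L \<le> ennreal L'"
    unfolding L(1)[symmetric] L'(1)[symmetric] using \<rho>_nonneg g0 q_bounds
    by (intro nn_integral_mono ennreal_leI powr_mono2) (auto simp: \<rho>'_def)
  then have "L \<le> L'" using L'(2) by simp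
  have mass': "(\<integral>\<^sup>+x. ennreal (\<rho>' x) \<partial>lborel) = ennreal (real (Suc N))"
  proof -
    have "ennreal (\<rho>' x) = ennreal (\<rho> x) + (ennreal e * ennreal (f x) + ennreal (1 - e) * ennreal (h x))" for x
      using \<rho>_nonneg[of x] f0[of x] h0[of x] e by (simp add: \<rho>'_def g_def ennreal_plus ennreal_mult)
    then have "(\<integral>\<^sup>+x. ennreal (\<rho>' x) \<partial>lborel) = ennreal (real N) + (ennreal e + ennreal (1 - e))"
      by (simp add: nn_integral_add nn_integral_cmult f1 h1 \<rho>_mass)
    also have "\<dots> = ennreal (real N + (e + (1 - e)))"
      using e by (subst ennreal_plus[symmetric], simp, simp)+ simp
    finally show ?thesis by (simp add: add.commute)
  qed
  have adm: "\<rho>' \<in> admissible s (Suc N)"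
    unfolding admissible_def p_exp
  proof (intro CollectI conjI)
    show "integrable lborel \<rho>'"
      by (rule integrableI_nonneg) (auto simp: mass' \<rho>'0)
    show "(\<integral>x. \<rho>' x \<partial>lborel) = real (Suc N)"
      by (subst integral_eq_nn_integral) (auto simp only: mass' \<rho>'0 enn2real_ennreal of_nat_0_le_iff intro!: AE_I2, auto)
    show "integrable lborel (\<lambda>x. \<bar>\<rho>' x\<bar> powr ?p)"
      using L'_fin \<rho>'0 by (intro integrableI_nonneg) auto
  qed (auto simp: \<rho>'0)
  have L'_pos: "0 < L'"
  proof (rule ccontr)
    assume "\<not> 0 < L'"
    then have "(\<integral>\<^sup>+x. ennreal (\<rho>' x powr ?p) \<partial>lborel) = 0" using L' by simp
    then have "(\<integral>\<^sup>+x. ennreal (\<rho>' x) \<partial>lborel) = 0" by (rule nn_integral_powr_eq_0[OF \<rho>'])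
    then show False unfolding mass' by simp
  qed
  define d0 where "d0 = enn2real (mutual s \<rho> \<rho>)"
  have d0: "mutual s \<rho> \<rho> = ennreal d0" "0 \<le> d0" using mutual_\<rho> by (simp_all add: d0_def)
  define w0 where "w0 = enn2real (W_fun s N \<rho>)"
  have w0: "W_fun s N \<rho> = ennreal w0" "0 \<le> w0" using W_fun_finite by (simp_all add: w0_def)
  have G': "d0 / 2 - w0 = Lam * L"
    using G unfolding G_fun_def D_fun_eq_mutual[OF \<rho>_meas] d0(1) w0(1) L_fun using d0(2) w0(2) by simp
  \<comment> \<open>Only a lower bound: the self-energy of \<open>g\<close> and the interaction of
    \<rho> with \<open>h\<close> are dropped.\<close>
  have D'_ge: "ennreal (d0 + 2 * (e * Df)) \<le> D_fun s \<rho>'"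
  proof -
    have "mutual s \<rho> g = mutual s \<rho> (\<lambda>x. e * f x) + mutual s \<rho> (\<lambda>x. (1 - e) * h x)"
      unfolding g_def using e f0 h0 by (intro mutual_add) auto
    also have "mutual s \<rho> (\<lambda>x. e * f x) = ennreal (e * Df)"
      using e Df by (subst mutual_cmult) (auto simp: ennreal_mult)
    finally have \<rho>g: "ennreal (e * Df) \<le> mutual s \<rho> g" by simp
    have \<rho>'_eq: "mutual s u \<rho>' = mutual s u \<rho> + mutual s u g" if [measurable]: "u \<in> borel_measurable borel" for u
      unfolding \<rho>'_def using \<rho>_nonneg g0 by (intro mutual_add) auto
    have "D_fun s \<rho>' = mutual s \<rho>' \<rho> + mutual s \<rho>' g"
      by (simp add: D_fun_eq_mutual \<rho>'_eq)
    also have "\<dots> = mutual s \<rho> \<rho>' + mutual s g \<rho>'" by (simp add: mutual_commute)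
    also have "\<dots> = mutual s \<rho> \<rho> + mutual s \<rho> g + (mutual s \<rho> g + mutual s g g)"
      by (simp add: \<rho>'_eq mutual_commute[of g \<rho>])
    finally have "D_fun s \<rho>' = mutual s \<rho> \<rho> + mutual s \<rho> g + (mutual s \<rho> g + mutual s g g)" .
    moreover have "ennreal d0 + ennreal (e * Df) + (ennreal (e * Df) + 0) \<le> mutual s \<rho> \<rho> + mutual s \<rho> g + (mutual s \<rho> g + mutual s g g)"
      by (intro add_mono \<rho>g) (auto simp: d0)
    moreover have "ennreal d0 + ennreal (e * Df) + (ennreal (e * Df) + 0) = ennreal (d0 + 2 * (e * Df))"
      using d0 e Df by (simp flip: ennreal_plus)
    ultimately show ?thesis by simp
  qed
  have W'_le: "W_fun s (Suc N) \<rho>' \<le> ennreal (w0 + (e * t + \<delta>))"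
  proof -
    \<comment> \<open>Moving the part that does not depend on the coupling to the left leaves an
      inequality to be checked for each \<open>P\<close> separately.\<close>
    have "W_fun s (Suc N) \<rho>' - ennreal (e * t + \<delta>) \<le> W_fun s N \<rho>"
      unfolding W_fun_def[of s N]
    proof (rule INF_greatest)
      fix P assume P: "P \<in> couplings N \<rho>"
      note setsP [measurable_cong] = sets_coupling[OF P]
      obtain a where a [measurable]: "a \<in> borel_measurable (config_space N)" and a0: "\<And>x. 0 \<le> a x" "\<And>x. a x \<le> C"
        and a1: "(\<integral>\<^sup>+x. ennreal (a x) \<partial>P) = 1"
        and at: "(\<integral>\<^sup>+x. ennreal (a x) * (\<Sum>i<N. pot s f (x i)) \<partial>P) \<le> ennreal t"
        using transport[OF P] by blast
      have coord: "(\<lambda>x. x i) \<in> P \<rightarrow>\<^sub>M borel" if "i < N" for i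
        using measurable_coord[OF that] by (subst measurable_cong_sets[OF setsP refl])
      have [measurable]: "(\<lambda>x. \<Sum>i<N. pot s f (x i)) \<in> borel_measurable P"
        by (auto intro!: borel_measurable_sum measurable_compose[OF coord])
      have a_P [measurable]: "a \<in> borel_measurable P" using a by (subst measurable_cong_sets[OF setsP refl])
      have "W_fun s (Suc N) \<rho>' \<le> (\<integral>\<^sup>+x. cost s N x \<partial>P)
          + ((\<integral>\<^sup>+x. ennreal (e * a x) * (\<Sum>i<N. pot s f (x i)) \<partial>P) + mutual s \<rho> h)"
        unfolding \<rho>'_def g_def
      proof (rule W_fun_insert[OF P \<rho>_meas \<rho>_nonneg f f0 f1 h h0 h1])
        show "(\<lambda>x. e * a x) \<in> borel_measurable (config_space N)" by measurable
        show "0 \<le> e * a x" for x using e a0 by simp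
        show "e * a x \<le> 1" for x using e a0(2)[of x] by (intro order_trans[OF _ e(3)] mult_left_mono) auto
        show "(\<integral>\<^sup>+x. ennreal (e * a x) \<partial>P) = ennreal e"
          using e by (simp add: ennreal_mult' nn_integral_cmult a1)
      qed (use e in auto)
      also have "(\<integral>\<^sup>+x. ennreal (e * a x) * (\<Sum>i<N. pot s f (x i)) \<partial>P)
          = ennreal e * (\<integral>\<^sup>+x. ennreal (a x) * (\<Sum>i<N. pot s f (x i)) \<partial>P)"
        using e by (simp add: ennreal_mult' mult.assoc nn_integral_cmult)
      also have "(\<integral>\<^sup>+x. cost s N x \<partial>P) + (\<dots> + mutual s \<rho> h) \<le> (\<integral>\<^sup>+x. cost s N x \<partial>P) + (ennreal e * ennreal t + ennreal \<delta>)"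
        by (intro add_mono mult_left_mono at hD) auto
      also have "ennreal e * ennreal t + ennreal \<delta> = ennreal (e * t + \<delta>)"
        using e t \<delta> by (simp add: ennreal_plus ennreal_mult)
      finally have "W_fun s (Suc N) \<rho>' \<le> ennreal (e * t + \<delta>) + (\<integral>\<^sup>+x. cost s N x \<partial>P)" by (simp only: add.commute)
      then show "W_fun s (Suc N) \<rho>' - ennreal (e * t + \<delta>)
          \<le> (\<integral>\<^sup>+x. (\<Sum>(i, j)\<in>{(i, j). i < j \<and> j < N}. riesz s (x i) (x j)) \<partial>P)"
        unfolding cost_def ennreal_minus_le_iff by simp
    qed
    then have "W_fun s (Suc N) \<rho>' \<le> ennreal (e * t + \<delta>) + ennreal w0"
      unfolding w0(1) by (simp add: ennreal_minus_le_iff)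
    then show ?thesis using e t \<delta> w0 by (simp add: add.commute flip: ennreal_plus)
  qed
  have "ereal ((d0 + 2 * (e * Df)) / 2 - (w0 + (e * t + \<delta>))) \<le> G_fun s (Suc N) \<rho>'"
  proof -
    have "ereal (d0 + 2 * (e * Df)) \<le> enn2ereal (D_fun s \<rho>')"
      using D'_ge[unfolded less_eq_ennreal.rep_eq] d0 e Df by (subst (asm) enn2ereal_ennreal) auto
    then have "ereal (d0 + 2 * (e * Df)) / 2 \<le> enn2ereal (D_fun s \<rho>') / 2"
      by (rule ereal_divide_right_mono) simp
    moreover have "enn2ereal (W_fun s (Suc N) \<rho>') \<le> ereal (w0 + (e * t + \<delta>))"
      using W'_le[unfolded less_eq_ennreal.rep_eq] w0 e t \<delta> by (subst (asm) enn2ereal_ennreal) auto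
    ultimately have "ereal (d0 + 2 * (e * Df)) / 2 - ereal (w0 + (e * t + \<delta>)) \<le> G_fun s (Suc N) \<rho>'"
      unfolding G_fun_def by (rule ereal_minus_mono)
    then show ?thesis by simp
  qed
  moreover have "Lam * L' < (d0 + 2 * (e * Df)) / 2 - (w0 + (e * t + \<delta>))"
  proof -
    have "Lam * (L' - L) \<le> \<bar>Lam\<bar> * (U - L)"
      using \<open>L \<le> L'\<close> \<open>L' \<le> U\<close> by (intro mult_mono) auto
    also have "\<dots> = \<bar>Lam\<bar> * (2 * e * \<kappa> + 2 powr ?p * e powr ?p * F) + \<delta> * (c - 1)"
      by (simp add: U_def c_def algebra_simps)
    also have "\<dots> < e * (Df - t) - \<delta>" using \<delta>(2) by (simp add: m_def algebra_simps)
    finally have "Lam * L' < Lam * L + e * (Df - t) - \<delta>" by (simp add: algebra_simps)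
    then show ?thesis unfolding G'[symmetric] by (simp add: algebra_simps)
  qed
  ultimately have "ereal (Lam * L_fun s \<rho>') < G_fun s (Suc N) \<rho>'"
    unfolding L'_fun by (meson ereal_less(2) less_le_trans less_ereal.simps(1))
  then show ?thesis
    using L'_pos by (intro bexI[OF _ adm]) (simp_all add: L'_fun)
qed

subsection \<open>Configurations hitting a set\<close>

definition \<mu> :: "'a measure" where
  "\<mu> = density lborel (\<lambda>x. ennreal (\<rho> x))"

definition hit :: "'a set \<Rightarrow> (nat \<Rightarrow> 'a) set" where
  "hit A = {x \<in> space (config_space N). \<exists>i<N. x i \<in> A}"

lemma sets_\<mu> [simp, measurable_cong]: "sets \<mu> = sets borel"
  by (simp add: \<mu>_def)

lemma emeasure_\<mu>: "A \<in> sets borel \<Longrightarrow> emeasure \<mu> A = (\<integral>\<^sup>+x. ennreal (\<rho> x) * indicator A x \<partial>lborel)"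
  by (simp add: \<mu>_def emeasure_density)

lemma emeasure_\<mu>_UNIV: "emeasure \<mu> UNIV = ennreal (real N)"
  by (simp add: emeasure_\<mu> \<rho>_mass)

lemma emeasure_\<mu>_le: "emeasure \<mu> A \<le> ennreal (real N)"
  using emeasure_space[of \<mu> A] emeasure_\<mu>_UNIV by (simp add: \<mu>_def)

lemma emeasure_\<mu>_finite: "emeasure \<mu> A < \<infinity>"
  using emeasure_\<mu>_le[of A] by (rule le_less_trans) simp

lemma sets_hit [measurable]: "A \<in> sets borel \<Longrightarrow> hit A \<in> sets (config_space N)"
proof -
  assume A: "A \<in> sets borel"
  have "hit A = (\<Union>i<N. (\<lambda>x. x i) -` A \<inter> space (config_space N))" by (auto simp: hit_def)
  also have "\<dots> \<in> sets (config_space N)"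
    by (intro sets.finite_UN finite_lessThan measurable_sets[OF measurable_coord A]) simp
  finally show ?thesis .
qed

text \<open>The number of particles in \<open>A\<close> is between \<open>1\<close> and
  \<open>N\<close> on \<open>hit A\<close> and \<open>0\<close> elsewhere. Probabilities of hitting
  are thereby controlled by \<rho>, uniformly over all couplings.\<close>

lemma coupling_hit:
  assumes P: "P \<in> couplings N \<rho>" and A: "A \<in> sets borel"
  shows "emeasure P (hit A) \<le> emeasure \<mu> A" "emeasure \<mu> A \<le> ennreal (real N) * emeasure P (hit A)"
proof -
  note setsP = sets_coupling[OF P]
  have [measurable]: "hit A \<in> sets P" using sets_hit[OF A] by (simp add: setsP)
  have eq: "emeasure \<mu> A = (\<integral>\<^sup>+x. (\<Sum>i<N. indicator A (x i)) \<partial>P)"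
    using emeasure_one_body_eq_nn_integral[OF setsP A] P by (simp add: couplings_def \<mu>_def)
  have "emeasure P (hit A) = (\<integral>\<^sup>+x. indicator (hit A) x \<partial>P)" by simp
  also have "\<dots> \<le> (\<integral>\<^sup>+x. (\<Sum>i<N. indicator A (x i)) \<partial>P)"
  proof (rule nn_integral_mono)
    fix x
    show "indicator (hit A) x \<le> (\<Sum>i<N. indicator A (x i) :: ennreal)"
    proof (cases "x \<in> hit A")
      case True
      then obtain i where i: "i < N" "x i \<in> A" by (auto simp: hit_def)
      then have "(1::ennreal) = indicator A (x i)" by simp
      also have "\<dots> \<le> (\<Sum>i<N. indicator A (x i))"
        using i by (intro member_le_sum) auto
      finally show ?thesis using True by simp
    qed simp
  qed
  finally show "emeasure P (hit A) \<le> emeasure \<mu> A" unfolding eq .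
  have "(\<integral>\<^sup>+x. (\<Sum>i<N. indicator A (x i)) \<partial>P) \<le> (\<integral>\<^sup>+x. ennreal (real N) * indicator (hit A) x \<partial>P)"
  proof (rule nn_integral_mono)
    fix x assume "x \<in> space P"
    then have x: "x \<in> space (config_space N)" using sets_eq_imp_space_eq[OF setsP] by simp
    have "(\<Sum>i<N. indicator A (x i) :: ennreal) \<le> (\<Sum>i<N. indicator (hit A) x)"
      using x by (intro sum_mono) (auto simp: indicator_def hit_def)
    then show "(\<Sum>i<N. indicator A (x i)) \<le> ennreal (real N) * indicator (hit A) x"
      by (simp add: ennreal_of_nat_eq_real_of_nat)
  qed
  also have "\<dots> = ennreal (real N) * emeasure P (hit A)" by (simp add: nn_integral_cmult)
  finally show "emeasure \<mu> A \<le> ennreal (real N) * emeasure P (hit A)" unfolding eq .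
qed

lemma measurable_pot_sum:
  assumes P: "P \<in> couplings N \<rho>" and [measurable]: "u \<in> borel_measurable borel"
  shows "(\<lambda>x. \<Sum>i<N. pot s u (x i)) \<in> borel_measurable P"
proof -
  have "(\<lambda>x. x i) \<in> P \<rightarrow>\<^sub>M borel" if "i < N" for i
    using measurable_coord[OF that] by (subst measurable_cong_sets[OF sets_coupling[OF P] refl])
  then show ?thesis by (auto intro!: borel_measurable_sum measurable_compose[where g = "pot s u" and N = borel])
qed

text \<open>\<open>strict_gain\<close> for the uniform density on \<open>E\<close>. All terms of the
  gap inequality scale with \<open>1 / v\<close> for the volume \<open>v\<close>, so it can be
  stated without normalisation.\<close>

lemma strict_gain_indicator:
  assumes E [measurable]: "E \<in> sets borel" and E_ball: "E \<subseteq> ball 0 R" and E_pos: "0 < emeasure lborel E"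
    and \<kappa>: "(\<integral>\<^sup>+x. ennreal (\<rho> x powr q * indicator E x) \<partial>lborel) \<le> ennreal \<kappa>" "0 \<le> \<kappa>"
    and C: "1 \<le> C" and t: "0 \<le> t"
    and transport: "\<And>P. P \<in> couplings N \<rho> \<Longrightarrow> \<exists>a. a \<in> borel_measurable (config_space N) \<and>
        (\<forall>x. 0 \<le> a x \<and> a x \<le> C) \<and> (\<integral>\<^sup>+x. ennreal (a x) \<partial>P) = 1 \<and>
        (\<integral>\<^sup>+x. ennreal (a x) * (\<Sum>i<N. pot s (indicator E) (x i)) \<partial>P) \<le> ennreal t"
    and gap: "ennreal (t + 2 * \<bar>Lam\<bar> * \<kappa>) < mutual s \<rho> (indicator E)"
    and G: "G_fun s N \<rho> = ereal (Lam * L_fun s \<rho>)"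
  shows "\<exists>\<rho>'\<in>(admissible s (Suc N) :: ('a \<Rightarrow> real) set). 0 < L_fun s \<rho>' \<and> ereal (Lam * L_fun s \<rho>') < G_fun s (Suc N) \<rho>'"
proof -
  have "emeasure lborel E \<le> emeasure lborel (ball (0::'a) R)" by (rule emeasure_mono[OF E_ball]) simp
  also have "\<dots> < \<infinity>" by (rule emeasure_bounded_finite) simp
  finally obtain v where v: "emeasure lborel E = ennreal v" "0 < v"
    using E_pos by (cases "emeasure lborel E") auto
  have "mutual s \<rho> (indicator E) \<le> mutual s \<rho> (indicator (ball 0 R))"
    unfolding mutual_def by (intro nn_integral_mono mult_left_mono pot_indicator_mono E_ball) simp
  also have "\<dots> \<le> ennreal (real N) * ball_pot TYPE('a) s R" by (rule mutual_indicator_ball_le)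
  also have "\<dots> < \<infinity>" using ball_pot_finite[OF s_pos s_less, of R] by (simp add: ennreal_mult_less_top)
  finally obtain D where D: "mutual s \<rho> (indicator E) = ennreal D" "0 \<le> D"
    by (cases "mutual s \<rho> (indicator E)") auto
  obtain \<kappa>' where \<kappa>': "(\<integral>\<^sup>+x. ennreal (\<rho> x powr q * indicator E x) \<partial>lborel) = ennreal \<kappa>'" "0 \<le> \<kappa>'" "\<kappa>' \<le> \<kappa>"
    using \<kappa> by (cases "\<integral>\<^sup>+x. ennreal (\<rho> x powr q * indicator E x) \<partial>lborel") (auto simp: top_unique)
  define f where "f x = 1 / v * indicator E x" for x
  have f [measurable]: "f \<in> borel_measurable borel" unfolding f_def by measurable
  have int_ind: "(\<integral>\<^sup>+x. ennreal (c * indicator E x) \<partial>lborel) = ennreal (c * v)" if "0 \<le> c" for c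
    using that v by (simp add: ennreal_mult' ennreal_indicator nn_integral_cmult)
  have pot_f: "pot s f x = ennreal (1 / v) * pot s (indicator E) x" for x
    unfolding f_def using v by (intro pot_cmult) auto
  show ?thesis
  proof (rule strict_gain[OF f _ _ _ _ _ _ _ _ C])
    show "0 \<le> f x" for x using v by (simp add: f_def)
    show "(\<integral>\<^sup>+x. ennreal (f x) \<partial>lborel) = 1"
      unfolding f_def using v by (subst int_ind) auto
    have "(\<integral>\<^sup>+x. ennreal (f x powr (1 + q)) \<partial>lborel) = (\<integral>\<^sup>+x. ennreal ((1 / v) powr (1 + q) * indicator E x) \<partial>lborel)"
      unfolding f_def by (intro nn_integral_cong) (auto simp: indicator_def)
    also have "\<dots> = ennreal ((1 / v) powr (1 + q) * v)" by (rule int_ind) simp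
    finally show "(\<integral>\<^sup>+x. ennreal (f x powr (1 + q)) \<partial>lborel) = ennreal ((1 / v) powr (1 + q) * v)" .
    show "0 \<le> (1 / v) powr (1 + q) * v" using v by simp
    have "(\<integral>\<^sup>+x. ennreal (\<rho> x powr q * f x) \<partial>lborel)
        = (\<integral>\<^sup>+x. ennreal (1 / v) * ennreal (\<rho> x powr q * indicator E x) \<partial>lborel)"
      unfolding f_def using v by (intro nn_integral_cong) (simp flip: ennreal_mult')
    also have "\<dots> = ennreal (1 / v) * ennreal \<kappa>'" by (subst nn_integral_cmult) (auto simp: \<kappa>')
    also have "\<dots> = ennreal (1 / v * \<kappa>')" using v by (intro ennreal_mult'[symmetric]) simp
    finally show "(\<integral>\<^sup>+x. ennreal (\<rho> x powr q * f x) \<partial>lborel) = ennreal (1 / v * \<kappa>')" .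
    show "0 \<le> 1 / v * \<kappa>'" using v \<kappa>' by simp
    have "mutual s \<rho> f = ennreal (1 / v) * ennreal D"
      unfolding f_def D(1)[symmetric] using v by (intro mutual_cmult) auto
    also have "\<dots> = ennreal (1 / v * D)" using v by (intro ennreal_mult'[symmetric]) simp
    finally show "mutual s \<rho> f = ennreal (1 / v * D)" .
    show "0 \<le> 1 / v * D" using v D by simp
    show "0 \<le> 1 / v * t" using v t by simp
    have "t + 2 * \<bar>Lam\<bar> * \<kappa>' \<le> t + 2 * \<bar>Lam\<bar> * \<kappa>" using \<kappa>' by (simp add: mult_left_mono)
    also have "\<dots> < D" using gap t \<kappa> unfolding D(1) by (subst (asm) ennreal_less_iff) auto
    finally have "1 / v * (t + 2 * \<bar>Lam\<bar> * \<kappa>') < 1 / v * D" using v by (intro mult_strict_left_mono) auto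
    then show "1 / v * t + 2 * \<bar>Lam\<bar> * (1 / v * \<kappa>') < 1 / v * D" by (simp add: algebra_simps add_divide_distrib)
    fix P assume P: "P \<in> couplings N \<rho>"
    obtain a where a: "a \<in> borel_measurable (config_space N)" "\<forall>x. 0 \<le> a x \<and> a x \<le> C" "(\<integral>\<^sup>+x. ennreal (a x) \<partial>P) = 1"
      and at: "(\<integral>\<^sup>+x. ennreal (a x) * (\<Sum>i<N. pot s (indicator E) (x i)) \<partial>P) \<le> ennreal t"
      using transport[OF P] by blast
    have [measurable]: "a \<in> borel_measurable P" using a(1) by (subst measurable_cong_sets[OF sets_coupling[OF P] refl])
    have [measurable]: "(\<lambda>x. \<Sum>i<N. pot s (indicator E) (x i)) \<in> borel_measurable P"
      by (rule measurable_pot_sum[OF P]) measurable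
    have "(\<integral>\<^sup>+x. ennreal (a x) * (\<Sum>i<N. pot s f (x i)) \<partial>P)
        = (\<integral>\<^sup>+x. ennreal (1 / v) * (ennreal (a x) * (\<Sum>i<N. pot s (indicator E) (x i))) \<partial>P)"
      unfolding pot_f by (intro nn_integral_cong) (simp add: mult_ac flip: sum_distrib_left)
    also have "\<dots> = ennreal (1 / v) * (\<integral>\<^sup>+x. (ennreal (a x) * (\<Sum>i<N. pot s (indicator E) (x i))) \<partial>P)"
      by (rule nn_integral_cmult) measurable
    also have "\<dots> \<le> ennreal (1 / v) * ennreal t" by (intro mult_left_mono at) simp
    also have "\<dots> = ennreal (1 / v * t)" using v by (intro ennreal_mult'[symmetric]) simp
    finally show "\<exists>a. a \<in> borel_measurable (config_space N) \<and> (\<forall>x. 0 \<le> a x \<and> a x \<le> C) \<and>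
        (\<integral>\<^sup>+x. ennreal (a x) \<partial>P) = 1 \<and> (\<integral>\<^sup>+x. ennreal (a x) * (\<Sum>i<N. pot s f (x i)) \<partial>P) \<le> ennreal (1 / v * t)"
      using a by blast
  qed (rule G)
qed

lemma small_tail:
  assumes "0 < \<delta>"
  obtains r where "0 < r" "emeasure \<mu> (- ball 0 r) \<le> ennreal \<delta>"
proof -
  have "(\<lambda>n. emeasure \<mu> (- ball 0 (real n))) \<longlonglongrightarrow> emeasure \<mu> (\<Inter>n. - ball 0 (real n))"
    by (intro Lim_emeasure_decseq) (auto simp: decseq_def emeasure_\<mu>_finite[THEN less_imp_neq, simplified])
  moreover have "(\<Inter>n. - ball (0::'a) (real n)) = {}"
  proof (rule equals0I)
    fix x :: 'a assume x: "x \<in> (\<Inter>n. - ball 0 (real n))"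
    obtain n where "norm x < real n" using reals_Archimedean2 by blast
    moreover have "x \<in> - ball 0 (real n)" using x by (rule INT_D) simp
    ultimately show False by simp
  qed
  ultimately have "(\<lambda>n. emeasure \<mu> (- ball 0 (real n))) \<longlonglongrightarrow> 0" by simp
  then have "eventually (\<lambda>n. emeasure \<mu> (- ball 0 (real n)) < ennreal \<delta>) sequentially"
    by (rule order_tendstoD(2)) (use assms in simp)
  then obtain n where "n > 0" "emeasure \<mu> (- ball 0 (real n)) < ennreal \<delta>"
    using eventually_happens'[OF sequentially_bot eventually_conj[OF eventually_gt_at_top[of 0]]] by blast
  then show thesis by (intro that[of "real n"]) auto
qed

text \<open>Continuity from above along balls shrinking to a point, which \<mu> does not charge as
  it has a density.\<close>

lemma small_ball:
  assumes "0 < \<delta>"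
  obtains r where "0 < r" "emeasure \<mu> (ball x r) \<le> ennreal \<delta>"
proof -
  have "(\<lambda>n. emeasure \<mu> (ball x (inverse (real (Suc n))))) \<longlonglongrightarrow> emeasure \<mu> (\<Inter>n. ball x (inverse (real (Suc n))))"
    by (intro Lim_emeasure_decseq decseq_SucI subset_ball)
      (auto simp: emeasure_\<mu>_finite[THEN less_imp_neq, simplified])
  moreover have "(\<Inter>n. ball x (inverse (real (Suc n)))) = {x}"
  proof -
    have "y = x" if "\<And>n. dist x y < inverse (real (Suc n))" for y
      using reals_Archimedean[of "dist x y"] that by (metis not_less_iff_gr_or_eq zero_less_dist_iff)
    then show ?thesis by auto
  qed
  moreover have "emeasure \<mu> {x} = 0"
  proof -
    have "AE y in lborel. ennreal (\<rho> y) * indicator {x} y = 0"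
      by (rule AE_mp[OF AE_lborel_singleton[of x]]) auto
    then show ?thesis by (subst emeasure_\<mu>) (auto simp: nn_integral_0_iff_AE)
  qed
  ultimately have "(\<lambda>n. emeasure \<mu> (ball x (inverse (real (Suc n))))) \<longlonglongrightarrow> 0" by simp
  then have "eventually (\<lambda>n. emeasure \<mu> (ball x (inverse (real (Suc n)))) < ennreal \<delta>) sequentially"
    by (rule order_tendstoD(2)) (use assms in simp)
  then obtain n where "emeasure \<mu> (ball x (inverse (real (Suc n)))) < ennreal \<delta>"
    using eventually_happens'[OF sequentially_bot] by blast
  then show thesis by (intro that[of "inverse (real (Suc n))"]) auto
qed

subsection \<open>Densities with unbounded support\<close>

text \<open>With the threshold \<open>\<theta> * R powr - d\<close>, volume and mass terms both
  scale like \<open>R powr (d - s)\<close>, but only the mass \<tau> outside \<open>r0\<close>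
  enters at this order; the inner ball, treated with threshold 1, gives a constant. Choosing
  \<theta>, then \<tau>, then \<open>R\<close> makes the integral
  \<open>o(R powr (d - s))\<close>.\<close>

lemma powr_indicator_ball_split:
  assumes r0: "0 \<le> r0" and R: "0 < R" and \<theta>: "0 < \<theta>" and \<tau>: "emeasure \<mu> (- ball 0 r0) \<le> ennreal \<tau>" "0 \<le> \<tau>"
  shows "(\<integral>\<^sup>+x. ennreal (\<rho> x powr q * indicator (ball 0 R) x) \<partial>lborel)
    \<le> ennreal (unit_ball_vol (real DIM('a)) * r0 ^ DIM('a) + real N
      + R powr (real DIM('a) - s) * (\<theta> powr q * unit_ball_vol (real DIM('a)) + \<theta> powr (q - 1) * \<tau>))"
proof -
  let ?d = "DIM('a)"
  define v where "v = unit_ball_vol (real ?d)"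
  have v: "0 < v" by (simp add: v_def)
  define a where "a = \<theta> * R powr - real ?d"
  have a: "0 < a" using \<theta> R by (simp add: a_def)
  have "(\<integral>\<^sup>+x. ennreal (\<rho> x powr q * indicator (ball 0 R) x) \<partial>lborel)
     \<le> (\<integral>\<^sup>+x. ennreal (\<rho> x powr q * indicator (ball 0 r0) x) + (ennreal (a powr q) * indicator (ball 0 R) x
        + ennreal (a powr (q - 1)) * (ennreal (\<rho> x) * indicator (- ball 0 r0) x)) \<partial>lborel)"
  proof (rule nn_integral_mono)
    fix x
    have "ennreal (\<rho> x powr q) \<le> ennreal (a powr q + a powr (q - 1) * \<rho> x)"
      using powr_le_split[OF a \<rho>_nonneg q_bounds(1,2)] by (rule ennreal_leI)
    also have "\<dots> = ennreal (a powr q) + ennreal (a powr (q - 1)) * ennreal (\<rho> x)"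
      using \<rho>_nonneg[of x] by (simp add: ennreal_plus ennreal_mult)
    finally show "ennreal (\<rho> x powr q * indicator (ball 0 R) x)
      \<le> ennreal (\<rho> x powr q * indicator (ball 0 r0) x) + (ennreal (a powr q) * indicator (ball 0 R) x
        + ennreal (a powr (q - 1)) * (ennreal (\<rho> x) * indicator (- ball 0 r0) x))"
      by (cases "x \<in> ball 0 R"; cases "x \<in> ball 0 r0") (auto simp del: mem_ball)
  qed
  also have "\<dots> = (\<integral>\<^sup>+x. ennreal (\<rho> x powr q * indicator (ball 0 r0) x) \<partial>lborel)
     + (ennreal (a powr q) * emeasure lborel (ball (0::'a) R) + ennreal (a powr (q - 1)) * emeasure \<mu> (- ball 0 r0))"
    by (subst nn_integral_add, measurable, subst nn_integral_add, measurable)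
      (simp add: nn_integral_cmult emeasure_\<mu>)
  also have "\<dots> \<le> ennreal (1 powr q * (v * r0 ^ ?d) + 1 powr (q - 1) * real N)
     + (ennreal (a powr q) * ennreal (v * R ^ ?d) + ennreal (a powr (q - 1)) * ennreal \<tau>)"
    unfolding v_def using r0 R
    by (intro add_mono mult_left_mono powr_indicator_ball_le \<tau>) (auto simp: emeasure_ball)
  also have "\<dots> = ennreal (v * r0 ^ ?d + real N + (a powr q * (v * R ^ ?d) + a powr (q - 1) * \<tau>))"
    using v r0 R \<tau> by ((subst ennreal_mult'[symmetric], simp)+, (subst ennreal_plus[symmetric], simp, simp)+, simp)
  also have "a powr q * (v * R ^ ?d) + a powr (q - 1) * \<tau>
      = R powr (real ?d - s) * (\<theta> powr q * v + \<theta> powr (q - 1) * \<tau>)"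
  proof -
    have dq: "real ?d * q = s" by (simp add: q_eq)
    have "a powr q = \<theta> powr q * R powr - s"
      using \<theta> R dq by (simp add: a_def powr_mult powr_powr)
    moreover have "a powr (q - 1) = \<theta> powr (q - 1) * R powr (real ?d - s)"
      using \<theta> R dq by (simp add: a_def powr_mult powr_powr algebra_simps)
    moreover have "R powr - s * R ^ ?d = R powr (real ?d - s)"
      using R by (simp add: powr_realpow[symmetric] powr_add[symmetric])
    ultimately show ?thesis by (simp add: algebra_simps)
  qed
  finally show ?thesis by (simp add: v_def)
qed

text \<open>
  The change of measure conditions on some particle being far away: such a particle does not
  repel a new one in the ball of radius \<open>R\<close>, and the others repel it at most as if they sat at the
  centre, so that the repulsion drops by almost one full particle, an amount of order
  \<open>R powr (d - s)\<close> in the unnormalised potential. As \<open>\<rho>\<close> is integrable, the competing term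
  \<open>\<integral>\<rho> powr q\<close> over the ball is \<open>o(R powr (d - s))\<close>.
\<close>

lemma strict_gain_unbounded:
  assumes unb: "\<And>r. 0 < emeasure \<mu> (- ball 0 r)"
    and G: "G_fun s N \<rho> = ereal (Lam * L_fun s \<rho>)"
  shows "\<exists>\<rho>'\<in>(admissible s (Suc N) :: ('a \<Rightarrow> real) set). 0 < L_fun s \<rho>' \<and> ereal (Lam * L_fun s \<rho>') < G_fun s (Suc N) \<rho>'"
proof -
  let ?d = "DIM('a)"
  define b where "b = real ?d - s"
  have b: "0 < b" using s_less by (simp add: b_def)
  define v where "v = unit_ball_vol (real ?d)"
  have v: "0 < v" by (simp add: v_def)
  define I where "I = enn2real (ball_pot TYPE('a) s 1)"
  have I: "ball_pot TYPE('a) s 1 = ennreal I" "0 < I"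
    using ball_pot_finite[OF s_pos s_less, of 1] ball_pot_pos[OF s_pos, of 1, where 'a = 'a]
    by (auto simp: I_def enn2real_positive_iff)
  define l where "l = 2 * \<bar>Lam\<bar>"
  have l: "0 \<le> l" by (simp add: l_def)
  have N: "1 \<le> real N" using N_pos by simp
  \<comment> \<open>In units of \<open>R powr b\<close> the gain is one full particle,
    \<open>I\<close>. Three errors stay below \<open>I / 4\<close> each: the residual repulsion of
    the far particle (by \<open>M\<close>), the volume part of the penalty (by \<theta>), and the
    mass outside \<open>r0\<close> (by \<tau>).\<close>
  have "((\<lambda>M. v * M powr - s) \<longlongrightarrow> v * 0) at_top"
    by (intro tendsto_mult tendsto_const tendsto_neg_powr filterlim_ident) (use s_pos in auto)
  then have "eventually (\<lambda>M. v * M powr - s < I / 4) at_top"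
    by (rule order_tendstoD(2)) (use I in simp)
  then obtain M where M: "0 < M" "v * M powr - s < I / 4"
    using eventually_happens'[OF trivial_limit_at_top_linorder eventually_conj[OF eventually_gt_at_top[of 0]]] by blast
  define \<theta> where "\<theta> = (I / (4 * (1 + l * v))) powr (1 / q)"
  have lv: "0 < 1 + l * v" using l v by (simp add: add_pos_nonneg)
  have \<theta>: "0 < \<theta>" using I lv by (simp add: \<theta>_def)
  have "\<theta> powr q = I / (4 * (1 + l * v))"
    using I lv q_bounds by (simp add: \<theta>_def powr_powr)
  then have "\<theta> powr q * (4 * (1 + l * v)) = I" using lv by simp
  then have "4 * (l * (\<theta> powr q * v)) = I - 4 * \<theta> powr q" by (simp add: algebra_simps)
  moreover have "0 < \<theta> powr q" using \<theta> by simp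
  ultimately have l\<theta>: "l * (\<theta> powr q * v) < I / 4" by linarith
  define c where "c = l * \<theta> powr (q - 1)"
  have c: "0 \<le> c" using l by (simp add: c_def)
  \<comment> \<open>The tail mass hurts twice: with factor \<open>I\<close> in the lower bound on
    the mean repulsion, and with factor \<open>c\<close>, which depends on \<theta>, in the
    penalty.\<close>
  define \<tau> where "\<tau> = I / (8 * (c + I))"
  have cI: "0 < c + I" using I c by simp
  have "z * (I / (8 * z)) = I / 8" if "z \<noteq> 0" for z using that by simp
  from this[of "c + I"] have "(c + I) * \<tau> = I / 8" using cI unfolding \<tau>_def by linarith
  then have \<tau>: "0 < \<tau>" "\<tau> \<le> 1" "(c + I) * \<tau> < I / 4"
    using I c cI by (simp add: \<tau>_def, simp add: \<tau>_def pos_divide_le_eq, linarith)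
  obtain r0 where r0: "0 < r0" "emeasure \<mu> (- ball 0 r0) \<le> ennreal \<tau>"
    using small_tail[OF \<tau>(1)] by blast
  \<comment> \<open>The gap inequality divided by \<open>R powr b\<close>; only its limit as
    \<open>R\<close> grows has to be positive.\<close>
  define gap where "gap R = (real N - \<tau>) * I * (1 - r0 * R powr - 1) powr b
     - ((real N - 1) * I + v * M powr - s + l * ((v * r0 ^ ?d + real N) * R powr - b + \<theta> powr q * v + \<theta> powr (q - 1) * \<tau>))" for R
  have "(gap \<longlongrightarrow> (real N - \<tau>) * I * (1 - r0 * 0) powr b
     - ((real N - 1) * I + v * M powr - s + l * ((v * r0 ^ ?d + real N) * 0 + \<theta> powr q * v + \<theta> powr (q - 1) * \<tau>))) at_top"
    unfolding gap_def
    by (intro tendsto_intros tendsto_neg_powr filterlim_ident) (use b in auto)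
  moreover have "0 < (real N - \<tau>) * I * (1 - r0 * 0) powr b
     - ((real N - 1) * I + v * M powr - s + l * ((v * r0 ^ ?d + real N) * 0 + \<theta> powr q * v + \<theta> powr (q - 1) * \<tau>))"
  proof -
    have "(real N - \<tau>) * I * (1 - r0 * 0) powr b
     - ((real N - 1) * I + v * M powr - s + l * ((v * r0 ^ ?d + real N) * 0 + \<theta> powr q * v + \<theta> powr (q - 1) * \<tau>))
     = I - (c + I) * \<tau> - v * M powr - s - l * (\<theta> powr q * v)"
      by (simp add: c_def algebra_simps)
    then show ?thesis using l\<theta> M(2) I(2) \<tau>(3) by linarith
  qed
  ultimately have "eventually (\<lambda>R. 0 < gap R) at_top" by (rule order_tendstoD(1))
  then obtain R where R: "r0 < R" "0 < gap R"
    using eventually_happens'[OF trivial_limit_at_top_linorder eventually_conj[OF eventually_gt_at_top[of r0]]] by blast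
  have R0: "0 < R" using R r0 by simp
  define \<kappa> where "\<kappa> = v * r0 ^ ?d + real N + R powr b * (\<theta> powr q * v + \<theta> powr (q - 1) * \<tau>)"
  define t where "t = R powr b * ((real N - 1) * I + v * M powr - s)"
  have t0: "0 \<le> t" using N I v by (simp add: t_def)
  have "0 < R powr b * gap R" using R R0 by simp
  also have "R powr b * gap R = (real N - \<tau>) * ((R - r0) powr b * I) - (t + 2 * \<bar>Lam\<bar> * \<kappa>)"
  proof -
    have "R powr b * (1 - r0 * R powr - 1) powr b = (R * (1 - r0 * R powr - 1)) powr b"
      using R R0 by (subst powr_mult) (auto simp: powr_minus field_simps)
    also have "R * (1 - r0 * R powr - 1) = R - r0" using R0 by (simp add: powr_minus field_simps)
    finally have 1: "R powr b * (1 - r0 * R powr - 1) powr b = (R - r0) powr b" .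
    have 2: "R powr b * R powr - b = 1" using R0 by (simp add: powr_minus)
    have "R powr b * gap R = (real N - \<tau>) * I * (R powr b * (1 - r0 * R powr - 1) powr b)
       - (t + l * ((v * r0 ^ ?d + real N) * (R powr b * R powr - b) + R powr b * (\<theta> powr q * v + \<theta> powr (q - 1) * \<tau>)))"
      unfolding gap_def t_def by (simp add: algebra_simps)
    then show ?thesis unfolding 1 2 \<kappa>_def l_def by (simp add: mult_ac)
  qed
  finally have gap: "t + 2 * \<bar>Lam\<bar> * \<kappa> < (real N - \<tau>) * ((R - r0) powr b * I)" by simp
  \<comment> \<open>A particle beyond \<open>(M + 1) * R\<close> keeps distance at least
    \<open>M * R\<close> from the ball of radius \<open>R\<close>.\<close>
  define A where "A = - ball (0::'a) ((M + 1) * R)"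
  have A [measurable]: "A \<in> sets borel" by (simp add: A_def)
  \<comment> \<open>This mass may be tiny, but it enters only the bound on the change of measure and
    so only the size of \<open>e\<close>, not the gap.\<close>
  define \<sigma> where "\<sigma> = enn2real (emeasure \<mu> A)"
  have \<sigma>: "emeasure \<mu> A = ennreal \<sigma>" "0 < \<sigma>" "\<sigma> \<le> real N"
    using emeasure_\<mu>_finite[of A] unb[of "(M + 1) * R"] emeasure_\<mu>_le[of A]
    by (auto simp: \<sigma>_def A_def enn2real_positive_iff intro: enn2real_leI)
  show ?thesis
  proof (rule strict_gain_indicator[OF _ order_refl[of "ball 0 R"] _ _ _ _ t0 _ _ G])
    show "ball (0::'a) R \<in> sets borel" by simp
    show "0 < emeasure lborel (ball (0::'a) R)" using R0 by (simp add: emeasure_ball)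
    show "(\<integral>\<^sup>+x. ennreal (\<rho> x powr q * indicator (ball 0 R) x) \<partial>lborel) \<le> ennreal \<kappa>"
      unfolding \<kappa>_def b_def v_def using r0 R0 \<theta> \<tau> by (intro powr_indicator_ball_split) auto
    show "0 \<le> \<kappa>" unfolding \<kappa>_def using v r0 \<tau> by simp
    show "1 \<le> real N / \<sigma>" using \<sigma> by (simp add: field_simps)
    have "ennreal (t + 2 * \<bar>Lam\<bar> * \<kappa>) < ennreal ((real N - \<tau>) * ((R - r0) powr b * I))"
      using gap t0 \<open>0 \<le> \<kappa>\<close> by (subst ennreal_less_iff) auto
    also have "\<dots> = ennreal (real N - \<tau>) * ball_pot TYPE('a) s (R - r0)"
      using ball_pot_scale[of "R - r0", where 'a = 'a, of s] R N \<tau> I by (simp add: b_def ennreal_mult)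
    also have "\<dots> \<le> emeasure \<mu> (ball 0 r0) * ball_pot TYPE('a) s (R - r0)"
    proof (rule mult_right_mono)
      have "ennreal (real N) = emeasure \<mu> (ball 0 r0) + emeasure \<mu> (- ball 0 r0)"
        unfolding emeasure_\<mu>_UNIV[symmetric] by (subst plus_emeasure) (auto intro!: arg_cong[where f = "emeasure \<mu>"])
      also have "\<dots> \<le> emeasure \<mu> (ball 0 r0) + ennreal \<tau>" by (intro add_left_mono r0)
      finally show "ennreal (real N - \<tau>) \<le> emeasure \<mu> (ball 0 r0)"
        using \<tau> by (simp add: ennreal_minus[symmetric] ennreal_minus_le_iff add.commute)
    qed simp
    also have "\<dots> = (\<integral>\<^sup>+x. ennreal (\<rho> x) * indicator (ball 0 r0) x * ball_pot TYPE('a) s (R - r0) \<partial>lborel)"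
      by (subst nn_integral_multc) (auto simp: emeasure_\<mu>)
    also have "\<dots> \<le> mutual s \<rho> (indicator (ball 0 R))"
      unfolding mutual_def
    proof (rule nn_integral_mono)
      fix x :: 'a
      show "ennreal (\<rho> x) * indicator (ball 0 r0) x * ball_pot TYPE('a) s (R - r0) \<le> ennreal (\<rho> x) * pot s (indicator (ball 0 R)) x"
        using pot_indicator_ball_ge[of x r0 s R] by (auto simp: indicator_def intro!: mult_left_mono)
    qed
    finally show "ennreal (t + 2 * \<bar>Lam\<bar> * \<kappa>) < mutual s \<rho> (indicator (ball 0 R))" .
    fix P assume P: "P \<in> couplings N \<rho>"
    note setsP = sets_coupling[OF P]
    interpret P: prob_space P by (rule prob_space_coupling[OF P])
    define m where "m = P.prob (hit A)"
    have [measurable]: "hit A \<in> sets (config_space N)" "hit A \<in> sets P" using sets_hit[OF A] by (simp_all add: setsP)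
    have m: "emeasure P (hit A) = ennreal m" by (simp add: m_def P.emeasure_eq_measure)
    have "ennreal \<sigma> \<le> ennreal (real N) * ennreal m"
      using coupling_hit(2)[OF P A] by (simp add: m \<sigma>)
    also have "\<dots> = ennreal (real N * m)" by (simp add: ennreal_mult m_def)
    finally have "\<sigma> \<le> real N * m" using \<sigma> by (subst (asm) ennreal_le_iff) (auto simp: m_def)
    moreover from this have m0: "0 < m" using \<sigma> N by (auto simp: zero_less_mult_iff dest: order.strict_trans2)
    ultimately have mC: "1 / m \<le> real N / \<sigma>" using \<sigma> by (simp add: field_simps)
    \<comment> \<open>Conditioning on \<open>hit A\<close>; \<open>m\<close> depends on the
      coupling, its lower bound \<open>\<sigma> / N\<close> does not.\<close>
    let ?a = "\<lambda>x. 1 / m * indicator (hit A) x :: real"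
    have a_int: "(\<integral>\<^sup>+x. ennreal (?a x) \<partial>P) = 1"
      using m0 by (simp add: ennreal_mult' ennreal_indicator nn_integral_cmult m del: times_divide_eq_left) (simp flip: ennreal_mult')
    have le_t: "(\<Sum>i<N. pot s (indicator (ball 0 R)) (x i)) \<le> ennreal t" if x: "x \<in> hit A" for x
    proof -
      obtain i where i: "i < N" "x i \<in> A" using x by (auto simp: hit_def)
      have "pot s (indicator (ball 0 R)) (x i) \<le> ennreal ((M * R) powr - s) * emeasure lborel (ball (0::'a) R)"
      proof (rule pot_indicator_le[OF s_pos])
        fix y :: 'a assume "y \<in> ball 0 R"
        then show "M * R \<le> norm (x i - y)"
          using i norm_triangle_ineq2[of "x i" y] by (auto simp: A_def algebra_simps)
      qed (use M R0 in auto)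
      also have "\<dots> = ennreal (R powr b * (v * M powr - s))"
      proof -
        have "(M * R) powr - s * (v * R ^ ?d) = R powr b * (v * M powr - s)"
          using M R0 by (simp add: powr_mult b_def powr_diff powr_minus powr_realpow field_simps)
        then show ?thesis using R0 v by (simp add: emeasure_ball v_def flip: ennreal_mult)
      qed
      finally have far: "pot s (indicator (ball 0 R)) (x i) \<le> ennreal (R powr b * (v * M powr - s))" .
      have near: "pot s (indicator (ball 0 R)) (x j) \<le> ennreal (R powr b * I)" for j
        using pot_indicator_ball_le[OF s_pos R0, of "x j"] ball_pot_scale[OF R0, where 'a = 'a, of s] I
        by (simp add: b_def ennreal_mult)
      have "(\<Sum>j<N. pot s (indicator (ball 0 R)) (x j))
          = pot s (indicator (ball 0 R)) (x i) + (\<Sum>j\<in>{..<N} - {i}. pot s (indicator (ball 0 R)) (x j))"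
        using i by (intro sum.remove) auto
      also have "\<dots> \<le> ennreal (R powr b * (v * M powr - s)) + (\<Sum>j\<in>{..<N} - {i}. ennreal (R powr b * I))"
        by (intro add_mono far sum_mono near)
      also have "(\<Sum>j\<in>{..<N} - {i}. ennreal (R powr b * I)) = ennreal ((real N - 1) * (R powr b * I))"
        using i N I by (subst sum_ennreal) (auto simp: of_nat_diff)
      also have "ennreal (R powr b * (v * M powr - s)) + ennreal ((real N - 1) * (R powr b * I)) = ennreal t"
      proof (subst ennreal_plus[symmetric])
        show "0 \<le> R powr b * (v * M powr - s)" "0 \<le> (real N - 1) * (R powr b * I)" using v N I by auto
      qed (simp add: t_def algebra_simps)
      finally show ?thesis .
    qed
    have "(\<integral>\<^sup>+x. ennreal (?a x) * (\<Sum>i<N. pot s (indicator (ball 0 R)) (x i)) \<partial>P) \<le> (\<integral>\<^sup>+x. ennreal (?a x) * ennreal t \<partial>P)"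
      using le_t by (intro nn_integral_mono) (auto simp: indicator_def intro!: mult_left_mono)
    also have "\<dots> = ennreal t" by (subst nn_integral_multc) (auto simp only: a_int mult_1, measurable)
    finally have a_t: "(\<integral>\<^sup>+x. ennreal (?a x) * (\<Sum>i<N. pot s (indicator (ball 0 R)) (x i)) \<partial>P) \<le> ennreal t" .
    show "\<exists>a. a \<in> borel_measurable (config_space N) \<and> (\<forall>x. 0 \<le> a x \<and> a x \<le> real N / \<sigma>) \<and>
        (\<integral>\<^sup>+x. ennreal (a x) \<partial>P) = 1 \<and>
        (\<integral>\<^sup>+x. ennreal (a x) * (\<Sum>i<N. pot s (indicator (ball 0 R)) (x i)) \<partial>P) \<le> ennreal t"
    proof (intro exI[of _ ?a] conjI allI)
      show "?a \<in> borel_measurable (config_space N)" by measurable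
      show "0 \<le> ?a x" for x using m0 by simp
      show "?a x \<le> real N / \<sigma>" for x using mC \<sigma> by (simp add: indicator_def)
    qed (rule a_int a_t)+
  qed
qed

subsection \<open>Densities with bounded support\<close>

text \<open>The complement is a union of null balls; by Lindelof countably many of them suffice, so
  it is itself null.\<close>

lemma topological_support:
  defines "S \<equiv> {x. \<forall>r>0. 0 < emeasure \<mu> (ball x r)}"
  shows "closed S" "emeasure \<mu> (- S) = 0"
proof -
  let ?F = "{ball x r | x r. emeasure \<mu> (ball x r) = 0}"
  have eq: "- S = \<Union>?F"
  proof (intro equalityI subsetI)
    fix x assume "x \<in> - S"
    then obtain r where "0 < r" "emeasure \<mu> (ball x r) = 0" by (auto simp: S_def)
    then show "x \<in> \<Union>?F" by (auto intro!: exI[of _ "ball x r"])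
  next
    fix x assume "x \<in> \<Union>?F"
    then obtain y r where y: "x \<in> ball y r" "emeasure \<mu> (ball y r) = 0" by auto
    then obtain e where e: "0 < e" "ball x e \<subseteq> ball y r" using open_ball open_contains_ball by blast
    then have "emeasure \<mu> (ball x e) \<le> emeasure \<mu> (ball y r)" by (intro emeasure_mono) auto
    then have "emeasure \<mu> (ball x e) = 0" using y by simp
    then show "x \<in> - S" using e(1) by (auto simp: S_def intro!: exI[of _ e])
  qed
  have "open (- S)" unfolding eq by auto
  then show "closed S" by (simp add: closed_def)
  obtain F' where F': "F' \<subseteq> ?F" "countable F'" "\<Union>F' = \<Union>?F"
  proof (rule Lindelof)
    show "open A" if "A \<in> ?F" for A using that by auto
  qed
  have "(\<Union>A\<in>F'. A) \<in> null_sets \<mu>"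
  proof (rule null_sets_UN'[OF F'(2)])
    fix A assume "A \<in> F'"
    then obtain y r where "A = ball y r" "emeasure \<mu> (ball y r) = 0" using F'(1) by blast
    then show "A \<in> null_sets \<mu>" by (auto simp: null_sets_def)
  qed
  then show "emeasure \<mu> (- S) = 0" unfolding eq F'(3)[symmetric] by (simp add: null_sets_def)
qed

text \<open>
  The new particle sits just outside the support, next to a support point \<open>x0\<close> of maximal norm,
  where the penalty \<open>\<integral>\<rho> powr q f\<close> vanishes. The change of measure moves a mass \<open>\<theta>\<close> from the
  configurations with a particle very close to \<open>x0\<close> to those with no particle near \<open>x0\<close>.
\<close>

lemma strict_gain_bounded:
  assumes bdd: "emeasure \<mu> (- ball 0 r) = 0"
    and G: "G_fun s N \<rho> = ereal (Lam * L_fun s \<rho>)"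
  shows "\<exists>\<rho>'\<in>(admissible s (Suc N) :: ('a \<Rightarrow> real) set). 0 < L_fun s \<rho>' \<and> ereal (Lam * L_fun s \<rho>') < G_fun s (Suc N) \<rho>'"
proof -
  define S where "S = {x. \<forall>r>0. 0 < emeasure \<mu> (ball x r)}"
  have S: "closed S" "emeasure \<mu> (- S) = 0"
    unfolding S_def by (rule topological_support)+
  have "S \<subseteq> cball 0 r"
  proof
    fix x assume x: "x \<in> S"
    show "x \<in> cball 0 r"
    proof (rule ccontr)
      assume "x \<notin> cball 0 r"
      then have pos: "0 < norm x - r" by simp
      have "ball x (norm x - r) \<subseteq> - ball 0 r"
      proof
        fix y assume "y \<in> ball x (norm x - r)"
        then show "y \<in> - ball 0 r" using norm_triangle_ineq2[of x y] by (auto simp: dist_norm)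
      qed
      then have "emeasure \<mu> (ball x (norm x - r)) \<le> emeasure \<mu> (- ball 0 r)" by (intro emeasure_mono) auto
      moreover have "0 < emeasure \<mu> (ball x (norm x - r))" using x pos unfolding S_def by blast
      ultimately show False using bdd by simp
    qed
  qed
  then have "bounded S" by (rule bounded_subset[OF bounded_cball])
  with S(1) have "compact S" by (simp add: compact_eq_bounded_closed)
  moreover have "S \<noteq> {}" using S(2) emeasure_\<mu>_UNIV N_pos by auto
  ultimately obtain x0 where x0: "x0 \<in> S" "\<And>y. y \<in> S \<Longrightarrow> norm y \<le> norm x0"
    using continuous_attains_sup[of S norm] continuous_on_norm_id by blast
  \<comment> \<open>Mass at most \<open>1/2\<close> leaves probability at least \<open>1/2\<close>
    that no particle is in this ball.\<close>
  obtain \<delta> where \<delta>: "0 < \<delta>" "emeasure \<mu> (ball x0 \<delta>) \<le> ennreal (1/2)"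
    using small_ball[of "1/2"] by auto
  \<comment> \<open>Per unit volume of \<open>E\<close>, a bound for the repulsion from
    \<open>N\<close> particles that all stay outside the ball of radius \<delta>, hence at distance
    at least \<open>\<delta> / 2\<close> from \<open>E\<close>. The radius \<delta>' below is so
    small that a single particle within it repels with at least \<open>k + 1\<close>.\<close>
  define k where "k = real N * (\<delta> / 2) powr - s"
  have k: "0 \<le> k" by (simp add: k_def)
  define \<delta>' where "\<delta>' = min (\<delta> / 2) ((k + 1) powr (- 1 / s) / 2)"
  have \<delta>': "0 < \<delta>'" "\<delta>' \<le> \<delta> / 2" using \<delta> k by (auto simp: \<delta>'_def)
  define K where "K = (2 * \<delta>') powr - s"
  have K: "k + 1 \<le> K"
  proof -
    have "k + 1 = ((k + 1) powr (- 1 / s)) powr - s" using k s_pos by (simp add: powr_powr)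
    also have "\<dots> \<le> K" unfolding K_def using \<delta>' s_pos by (intro powr_mono2') (auto simp: \<delta>'_def)
    finally show ?thesis .
  qed
  let ?B = "ball x0 \<delta>" and ?B' = "ball x0 \<delta>'"
  define \<tau> where "\<tau> = enn2real (emeasure \<mu> ?B')"
  have \<tau>: "emeasure \<mu> ?B' = ennreal \<tau>" "0 < \<tau>"
    using emeasure_\<mu>_finite[of ?B'] x0(1) \<delta>'(1) by (auto simp: \<tau>_def S_def enn2real_positive_iff)
  have "emeasure \<mu> ?B' \<le> emeasure \<mu> ?B" using \<delta>' \<delta> by (intro emeasure_mono subset_ball) auto
  then have "ennreal \<tau> \<le> ennreal (1 / 2)" unfolding \<tau>(1) using \<delta>(2) by (rule order_trans)
  then have \<tau>_le: "\<tau> \<le> 1 / 2" by (subst (asm) ennreal_le_iff) auto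
  \<comment> \<open>Points beyond the maximal norm lie off the support, so \<open>E\<close> is
    \<mu>-null although it touches every neighbourhood relevant to \<open>x0\<close>.\<close>
  define E where "E = ?B' - cball 0 (norm x0)"
  have E [measurable]: "E \<in> sets borel" and "open E" by (auto simp: E_def intro!: borel_open)
  have "E \<noteq> {}"
  proof -
    \<comment> \<open>An outward direction at \<open>x0\<close>; if \<open>x0 = 0\<close>, any unit
      vector is one.\<close>
    obtain u :: 'a where u: "norm u = 1" "norm (x0 + (\<delta>' / 2) *\<^sub>R u) = norm x0 + \<delta>' / 2"
    proof (cases "x0 = 0")
      case True
      obtain b :: 'a where "b \<in> Basis" using nonempty_Basis by blast
      then show thesis using True \<delta>'(1) by (intro that[of b]) auto
    next
      case False
      have "x0 + (\<delta>' / 2) *\<^sub>R sgn x0 = (1 + \<delta>' / 2 / norm x0) *\<^sub>R x0"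
        by (simp add: sgn_div_norm scaleR_add_left) (simp add: field_simps)
      then have "norm (x0 + (\<delta>' / 2) *\<^sub>R sgn x0) = (1 + \<delta>' / 2 / norm x0) * norm x0"
        using \<delta>'(1) by simp
      also have "\<dots> = norm x0 + \<delta>' / 2" using False by (simp add: field_simps)
      finally show thesis using False by (intro that[of "sgn x0"]) (auto simp: norm_sgn)
    qed
    have "dist x0 (x0 + (\<delta>' / 2) *\<^sub>R u) < \<delta>'" using \<delta>'(1) u(1) by (simp add: dist_norm)
    then have "x0 + (\<delta>' / 2) *\<^sub>R u \<in> E" using \<delta>'(1) u(2) by (simp add: E_def)
    then show ?thesis by auto
  qed
  then obtain z e where z: "0 < e" "ball z e \<subseteq> E" using \<open>open E\<close> open_contains_ball by blast
  have "0 < emeasure lborel (ball z e)" using z by (simp add: emeasure_ball)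
  also have "\<dots> \<le> emeasure lborel E" using z by (intro emeasure_mono) auto
  finally have E_pos: "0 < emeasure lborel E" .
  have E_ball: "E \<subseteq> ball 0 (norm x0 + \<delta>')"
  proof
    fix y assume "y \<in> E"
    then show "y \<in> ball 0 (norm x0 + \<delta>')"
      using norm_triangle_ineq2[of y x0] by (auto simp: E_def dist_norm norm_minus_commute)
  qed
  have "emeasure lborel E \<le> emeasure lborel (ball (0::'a) (norm x0 + \<delta>'))" by (rule emeasure_mono[OF E_ball]) simp
  also have "\<dots> < \<infinity>" by (rule emeasure_bounded_finite) simp
  finally obtain v where v: "emeasure lborel E = ennreal v" "0 < v"
    using E_pos by (cases "emeasure lborel E") auto
  have E_null: "emeasure \<mu> E = 0"
  proof -
    have "E \<subseteq> - S" using x0(2) by (force simp: E_def)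
    then have "emeasure \<mu> E \<le> emeasure \<mu> (- S)" using S(1) by (intro emeasure_mono) auto
    then show ?thesis using S(2) by simp
  qed
  have pot_near: "ennreal (K * v) \<le> pot s (indicator E) x" if "x \<in> ?B'" for x
  proof -
    have "ennreal ((2 * \<delta>') powr - s) * emeasure lborel E \<le> pot s (indicator E) x"
    proof (rule pot_indicator_ge[OF s_pos])
      fix y assume "y \<in> E"
      then have "dist x0 x < \<delta>'" "dist x0 y < \<delta>'" using that by (auto simp: E_def)
      then show "norm (x - y) \<le> 2 * \<delta>'"
        using dist_triangle3[of x y x0] by (simp add: dist_norm[symmetric])
    qed (use \<delta>' in auto)
    then show ?thesis by (simp add: K_def v ennreal_mult')
  qed
  have pot_far: "pot s (indicator E) x \<le> ennreal ((\<delta> / 2) powr - s * v)" if "x \<notin> ?B" for x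
  proof -
    have "pot s (indicator E) x \<le> ennreal ((\<delta> / 2) powr - s) * emeasure lborel E"
    proof (rule pot_indicator_le[OF s_pos])
      fix y assume "y \<in> E"
      then have "\<delta> \<le> dist x0 x" "dist x0 y < \<delta>'" using that by (auto simp: E_def)
      then show "\<delta> / 2 \<le> norm (x - y)"
        using dist_triangle[of x0 x y] \<delta>'(2) by (simp add: dist_norm[symmetric] dist_commute)
    qed (use \<delta> in auto)
    then show ?thesis by (simp add: v ennreal_mult')
  qed
  have "mutual s \<rho> (indicator E) \<le> mutual s \<rho> (indicator (ball 0 (norm x0 + \<delta>')))"
    unfolding mutual_def by (intro nn_integral_mono mult_left_mono pot_indicator_mono E_ball) simp
  also have "\<dots> \<le> ennreal (real N) * ball_pot TYPE('a) s (norm x0 + \<delta>')" by (rule mutual_indicator_ball_le)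
  also have "\<dots> < \<infinity>" using ball_pot_finite[OF s_pos s_less] by (simp add: ennreal_mult_less_top)
  finally obtain D where D: "mutual s \<rho> (indicator E) = ennreal D" "0 \<le> D"
    by (cases "mutual s \<rho> (indicator E)") auto
  have "ennreal (\<tau> * (K * v)) = (\<integral>\<^sup>+x. ennreal (\<rho> x) * indicator ?B' x * ennreal (K * v) \<partial>lborel)"
    using \<tau> by (subst nn_integral_multc) (auto simp: emeasure_\<mu>[symmetric] ennreal_mult')
  also have "\<dots> \<le> mutual s \<rho> (indicator E)"
    unfolding mutual_def
  proof (rule nn_integral_mono)
    fix x
    show "ennreal (\<rho> x) * indicator ?B' x * ennreal (K * v) \<le> ennreal (\<rho> x) * pot s (indicator E) x"
      using pot_near[of x] by (cases "x \<in> ?B'") (auto intro!: mult_left_mono)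
  qed
  finally have "\<tau> * (K * v) \<le> D" unfolding D(1) using D(2) by simp
  \<comment> \<open>By \<open>coupling_hit\<close>, every coupling gives at least this probability
    to a particle within \<delta>' of \<open>x0\<close>.\<close>
  define \<theta> where "\<theta> = \<tau> / real N"
  have \<theta>: "0 < \<theta>" "\<theta> \<le> \<tau>" "\<theta> \<le> 1" using \<tau> \<tau>_le N_pos by (auto simp: \<theta>_def field_simps)
  have "\<theta> * v \<le> D"
  proof -
    have "\<theta> * (1 * v) \<le> \<tau> * (K * v)" using \<theta> \<tau> K k v by (intro mult_mono) auto
    then show ?thesis using \<open>\<tau> * (K * v) \<le> D\<close> by simp
  qed
  show ?thesis
  proof (rule strict_gain_indicator[OF E E_ball E_pos _ order_refl _ _ _ _ G])
    have "AE x in lborel. ennreal (\<rho> x) * indicator E x = 0"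
      using E_null by (simp add: emeasure_\<mu> nn_integral_0_iff_AE)
    then have "AE x in lborel. ennreal (\<rho> x powr q * indicator E x) = 0"
      by (rule AE_mp) (auto simp: indicator_def ennreal_eq_0_iff \<rho>_nonneg antisym intro!: AE_I2)
    then show "(\<integral>\<^sup>+x. ennreal (\<rho> x powr q * indicator E x) \<partial>lborel) \<le> ennreal 0"
      by (subst nn_integral_0_iff_AE[THEN iffD2]) auto
    show "1 \<le> (3::real)" by simp
    \<comment> \<open>Moving mass \<theta> removes at least \<open>\<theta> * K * v\<close> from the
      mean repulsion \<open>D\<close> and adds at most \<open>\<theta> * k * v\<close>; as
      \<open>k + 1 \<le> K\<close>, the new mean is at most \<open>D - \<theta> * v\<close>.\<close>
    show "0 \<le> D - \<theta> * v" using \<open>\<theta> * v \<le> D\<close> by simp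
    show "ennreal (D - \<theta> * v + 2 * \<bar>Lam\<bar> * 0) < mutual s \<rho> (indicator E)"
      unfolding D(1) using \<theta> v \<open>\<theta> * v \<le> D\<close> by (subst ennreal_less_iff) auto
    fix P assume P: "P \<in> couplings N \<rho>"
    note setsP = sets_coupling[OF P]
    have spaceP: "space P = space (config_space N)" by (rule sets_eq_imp_space_eq[OF setsP])
    interpret P: prob_space P by (rule prob_space_coupling[OF P])
    define T where "T = hit ?B'"
    define U where "U = space P - hit ?B"
    have [measurable]: "hit A \<in> sets P" if "A \<in> sets borel" for A using sets_hit[OF that] by (simp add: setsP)
    have T [measurable]: "T \<in> sets P" and U [measurable]: "U \<in> sets P" by (auto simp: T_def U_def)
    have T' [measurable]: "T \<in> sets (config_space N)" and U' [measurable]: "U \<in> sets (config_space N)"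
      using T U by (simp_all add: setsP)
    have "ennreal \<tau> \<le> ennreal (real N) * ennreal (P.prob T)"
      using coupling_hit(2)[OF P, of ?B'] by (simp add: \<tau> T_def P.emeasure_eq_measure)
    also have "\<dots> = ennreal (real N * P.prob T)" by (simp add: ennreal_mult)
    finally have "\<tau> \<le> real N * P.prob T" by (subst (asm) ennreal_le_iff) auto
    then have pT: "\<theta> \<le> P.prob T" using N_pos by (simp add: \<theta>_def field_simps)
    have "ennreal (P.prob (hit ?B)) \<le> ennreal (1 / 2)"
      using coupling_hit(1)[OF P, of ?B] \<delta>(2) by (auto simp: P.emeasure_eq_measure intro: order_trans)
    then have "P.prob (hit ?B) \<le> 1 / 2" by (subst (asm) ennreal_le_iff) auto
    then have pU: "1 / 2 \<le> P.prob U" unfolding U_def by (subst P.prob_compl) auto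
    \<comment> \<open>\<alpha> and \<beta> remove and add the same mass \<theta>. The bounds
      \<open>\<alpha> \<le> 1\<close> and \<open>\<beta> \<le> 2\<close> keep \<open>a\<close>
      between 0 and 3.\<close>
    define \<alpha> where "\<alpha> = \<theta> / P.prob T"
    define \<beta> where "\<beta> = \<theta> / P.prob U"
    have \<alpha>: "0 \<le> \<alpha>" "\<alpha> \<le> 1" "\<alpha> * P.prob T = \<theta>" using \<theta> pT by (auto simp: \<alpha>_def)
    have \<beta>: "0 \<le> \<beta>" "\<beta> \<le> 2" "\<beta> * P.prob U = \<theta>" using \<theta> pU by (auto simp: \<beta>_def field_simps)
    define a where "a x = 1 - \<alpha> * indicator T x + \<beta> * indicator U x" for x :: "nat \<Rightarrow> 'a"
    have a0: "0 \<le> a x" "a x \<le> 3" for x using \<alpha> \<beta> by (auto simp: a_def indicator_def)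
    let ?V = "\<lambda>x. \<Sum>i<N. pot s (indicator E) (x i)"
    have V [measurable]: "?V \<in> borel_measurable P" by (rule measurable_pot_sum[OF P]) measurable
    have a_meas: "a \<in> borel_measurable (config_space N)" unfolding a_def by measurable
    have a_P [measurable]: "a \<in> borel_measurable P" unfolding a_def by measurable
    \<comment> \<open>The negative term is carried to the other side, so that integrals in
      \<open>ennreal\<close> can be compared without subtraction.\<close>
    have split: "ennreal (a x) + ennreal \<alpha> * indicator T x = 1 + ennreal \<beta> * indicator U x" for x
    proof -
      have "ennreal (a x) + ennreal (\<alpha> * indicator T x) = ennreal 1 + ennreal (\<beta> * indicator U x)"
        using a0[of x] \<alpha> \<beta> by (subst (1 2) ennreal_plus[symmetric]) (auto simp: a_def)
      then show ?thesis using \<alpha> \<beta> by (simp add: ennreal_mult' ennreal_indicator)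
    qed
    have "(\<integral>\<^sup>+x. ennreal (a x) \<partial>P) + ennreal \<theta> = (\<integral>\<^sup>+x. ennreal (a x) + ennreal \<alpha> * indicator T x \<partial>P)"
      using \<alpha> by (simp add: nn_integral_add nn_integral_cmult P.emeasure_eq_measure flip: ennreal_mult')
    also have "\<dots> = 1 + ennreal \<theta>"
      unfolding split using \<beta>
      by (simp add: nn_integral_add nn_integral_cmult P.emeasure_space_1)
        (simp add: P.emeasure_eq_measure flip: ennreal_mult')
    finally have a1: "(\<integral>\<^sup>+x. ennreal (a x) \<partial>P) = 1"
      by (simp add: add.commute[of _ "ennreal \<theta>"] ennreal_add_left_cancel)
    have int_const: "(\<integral>\<^sup>+x. ennreal c * ennreal y * indicator A x \<partial>P) = ennreal (c * P.prob A * y)"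
      if "A \<in> sets P" "0 \<le> c" for A c y
    proof -
      have "(\<integral>\<^sup>+x. ennreal c * ennreal y * indicator A x \<partial>P) = ennreal c * ennreal y * ennreal (P.prob A)"
        using that(1) by (simp only: nn_integral_cmult_indicator P.emeasure_eq_measure)
      also have "\<dots> = ennreal (c * P.prob A) * ennreal y"
        using that(2) by (simp only: ennreal_mult' mult_ac)
      also have "\<dots> = ennreal (c * P.prob A * y)" using that(2) by (simp add: ennreal_mult')
      finally show ?thesis .
    qed
    have "(\<integral>\<^sup>+x. ennreal (a x) * ?V x \<partial>P) + ennreal (\<theta> * (K * v))
        \<le> (\<integral>\<^sup>+x. ennreal (a x) * ?V x \<partial>P) + (\<integral>\<^sup>+x. ennreal \<alpha> * indicator T x * ?V x \<partial>P)"
    proof (rule add_left_mono)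
      have "ennreal (\<theta> * (K * v)) = (\<integral>\<^sup>+x. ennreal \<alpha> * ennreal (K * v) * indicator T x \<partial>P)"
        unfolding int_const[OF T \<alpha>(1)] \<alpha>(3) ..
      also have "\<dots> \<le> (\<integral>\<^sup>+x. ennreal \<alpha> * indicator T x * ?V x \<partial>P)"
      proof (rule nn_integral_mono)
        fix x
        show "ennreal \<alpha> * ennreal (K * v) * indicator T x \<le> ennreal \<alpha> * indicator T x * ?V x"
        proof (cases "x \<in> T")
          case True
          then obtain i where i: "i < N" "x i \<in> ?B'" by (auto simp: T_def hit_def)
          have "ennreal (K * v) \<le> pot s (indicator E) (x i)" by (rule pot_near[OF i(2)])
          also have "\<dots> \<le> ?V x" using i(1) by (intro member_le_sum) auto
          finally show ?thesis using True by (auto intro: mult_left_mono)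
        qed simp
      qed
      finally show "ennreal (\<theta> * (K * v)) \<le> (\<integral>\<^sup>+x. ennreal \<alpha> * indicator T x * ?V x \<partial>P)" .
    qed
    also have "\<dots> = (\<integral>\<^sup>+x. (ennreal (a x) + ennreal \<alpha> * indicator T x) * ?V x \<partial>P)"
      by (subst nn_integral_add[symmetric]) (auto simp: distrib_right)
    also have "\<dots> = (\<integral>\<^sup>+x. ?V x \<partial>P) + (\<integral>\<^sup>+x. ennreal \<beta> * indicator U x * ?V x \<partial>P)"
      unfolding split by (subst nn_integral_add[symmetric]) (auto simp: distrib_right)
    also have "(\<integral>\<^sup>+x. ?V x \<partial>P) = ennreal D"
      unfolding D(1)[symmetric] mutual_def by (rule nn_integral_coupling[OF P]) auto
    also have "(\<integral>\<^sup>+x. ennreal \<beta> * indicator U x * ?V x \<partial>P) \<le> (\<integral>\<^sup>+x. ennreal \<beta> * ennreal (k * v) * indicator U x \<partial>P)"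
    proof (rule nn_integral_mono)
      fix x
      show "ennreal \<beta> * indicator U x * ?V x \<le> ennreal \<beta> * ennreal (k * v) * indicator U x"
      proof (cases "x \<in> U")
        case True
        then have "x i \<notin> ?B" if "i < N" for i using that by (auto simp: U_def hit_def spaceP)
        then have "?V x \<le> (\<Sum>i<N. ennreal ((\<delta> / 2) powr - s * v))" by (intro sum_mono pot_far) auto
        also have "\<dots> = ennreal (k * v)" using v by (subst sum_ennreal) (auto simp: k_def)
        finally show ?thesis using True by (auto intro: mult_left_mono)
      qed simp
    qed
    also have "\<dots> = ennreal (\<theta> * (k * v))"
      unfolding int_const[OF U \<beta>(1)] \<beta>(3) ..
    finally have le: "(\<integral>\<^sup>+x. ennreal (a x) * ?V x \<partial>P) + ennreal (\<theta> * (K * v)) \<le> ennreal D + ennreal (\<theta> * (k * v))"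
      by (simp add: add_left_mono)
    have "(\<integral>\<^sup>+x. ennreal (a x) * ?V x \<partial>P) + ennreal (\<theta> * ((k + 1) * v)) \<le> (\<integral>\<^sup>+x. ennreal (a x) * ?V x \<partial>P) + ennreal (\<theta> * (K * v))"
      using K \<theta> v by (intro add_left_mono ennreal_leI mult_left_mono mult_right_mono) auto
    also note le
    also have "ennreal D + ennreal (\<theta> * (k * v)) = ennreal (D - \<theta> * v) + ennreal (\<theta> * ((k + 1) * v))"
      using \<open>\<theta> * v \<le> D\<close> D \<theta> k v by (subst (1 2) ennreal_plus[symmetric]) (auto simp: algebra_simps)
    finally have a_t: "(\<integral>\<^sup>+x. ennreal (a x) * ?V x \<partial>P) \<le> ennreal (D - \<theta> * v)"
      by (simp add: add.commute[of _ "ennreal (\<theta> * ((k + 1) * v))"] ennreal_add_left_cancel_le)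
    show "\<exists>a. a \<in> borel_measurable (config_space N) \<and> (\<forall>x. 0 \<le> a x \<and> a x \<le> 3) \<and>
        (\<integral>\<^sup>+x. ennreal (a x) \<partial>P) = 1 \<and>
        (\<integral>\<^sup>+x. ennreal (a x) * (\<Sum>i<N. pot s (indicator E) (x i)) \<partial>P) \<le> ennreal (D - \<theta> * v)"
      using a_meas a0 a1 a_t by blast
  qed
qed

end

section \<open>From an attained supremum to the strict inequality\<close>

theorem proposition6p4:
  fixes s :: real and N :: nat
  assumes "0 < s" and "s < real DIM('a::euclidean_space)" and "1 \<le> N"
    and "\<exists>\<rho>\<in>(admissible s N :: ('a \<Rightarrow> real) set).
           G_fun s N \<rho> / ereal (L_fun s \<rho>) = Lambda TYPE('a) s N"
  shows "Lambda TYPE('a) s (N + 1) > Lambda TYPE('a) s N"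
proof -
  obtain \<rho>0 :: "'a \<Rightarrow> real" where \<rho>0: "\<rho>0 \<in> admissible s N"
    and Lam: "G_fun s N \<rho>0 / ereal (L_fun s \<rho>0) = Lambda TYPE('a) s N"
    using assms(4) by blast
  define q where "q = s / real DIM('a)"
  have p: "p_exp TYPE('a) s = 1 + q" by (simp add: p_exp_def q_def)
  have int: "integrable lborel \<rho>0" "integrable lborel (\<lambda>x. \<bar>\<rho>0 x\<bar> powr (1 + q))"
    and AE0: "AE x in lborel. 0 \<le> \<rho>0 x" and mass: "(\<integral>x. \<rho>0 x \<partial>lborel) = real N"
    using \<rho>0 by (auto simp: admissible_def p)
  have meas [measurable]: "\<rho>0 \<in> borel_measurable borel" using borel_measurable_integrable[OF int(1)] by simp
  \<comment> \<open>A representative nonnegative everywhere. \<open>G_fun\<close> reads the density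
    only through \<open>ennreal\<close>, so it is unchanged; \<open>L_fun\<close> agrees by almost
    everywhere equality.\<close>
  define \<rho> where "\<rho> x = max 0 (\<rho>0 x)" for x
  have \<rho> [measurable]: "\<rho> \<in> borel_measurable borel" unfolding \<rho>_def by measurable
  have enn: "ennreal (\<rho> x) = ennreal (\<rho>0 x)" for x by (auto simp: \<rho>_def max_def ennreal_neg)
  have AE_eq: "AE x in lborel. \<rho> x = \<rho>0 x" using AE0 by eventually_elim (simp add: \<rho>_def)
  have G_eq: "G_fun s N \<rho> = G_fun s N \<rho>0"
    by (simp add: G_fun_def D_fun_def W_fun_def couplings_def enn)
  have L_eq: "L_fun s \<rho> = L_fun s \<rho>0"
    unfolding L_fun_def using AE_eq by (intro integral_cong_AE) auto
  have powr_fin: "(\<integral>\<^sup>+x. ennreal (\<rho> x powr (1 + q)) \<partial>lborel) < \<infinity>"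
  proof -
    have "(\<integral>\<^sup>+x. ennreal (\<rho> x powr (1 + q)) \<partial>lborel) = (\<integral>\<^sup>+x. ennreal (\<bar>\<rho>0 x\<bar> powr (1 + q)) \<partial>lborel)"
      using AE_eq AE0 by (intro nn_integral_cong_AE) (auto elim: eventually_elim2)
    also have "\<dots> = ennreal (\<integral>x. \<bar>\<rho>0 x\<bar> powr (1 + q) \<partial>lborel)"
      by (rule nn_integral_eq_integral[OF int(2)]) auto
    finally show ?thesis by simp
  qed
  have mass': "(\<integral>\<^sup>+x. ennreal (\<rho> x) \<partial>lborel) = ennreal (real N)"
    unfolding enn using nn_integral_eq_integral[OF int(1) AE0] mass by simp
  interpret riesz_density s q N \<rho>
    by unfold_locales (use assms(1-3) powr_fin mass' in \<open>auto simp: q_def \<rho>_def\<close>)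
  have L_nn: "ennreal (L_fun s \<rho>) = (\<integral>\<^sup>+x. ennreal (\<rho> x powr (1 + q)) \<partial>lborel)"
    unfolding L_fun_def p using powr_fin by (subst integral_eq_nn_integral) auto
  have L_pos: "0 < L_fun s \<rho>"
  proof (rule ccontr)
    assume "\<not> 0 < L_fun s \<rho>"
    then have "(\<integral>\<^sup>+x. ennreal (\<rho> x powr (1 + q)) \<partial>lborel) = 0" unfolding L_nn[symmetric] by (simp add: ennreal_neg)
    then have "(\<integral>\<^sup>+x. ennreal (\<rho> x) \<partial>lborel) = 0" by (rule nn_integral_powr_eq_0[OF \<rho>])
    then show False unfolding mass' using assms(3) by simp
  qed
  \<comment> \<open>Finiteness of both energies makes \<open>Lambda\<close> a real number, without
    which a strict increase could not be read off from \<open>ereal\<close> quotients.\<close>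
  obtain d w where d: "mutual s \<rho> \<rho> = ennreal d" "0 \<le> d" and w: "W_fun s N \<rho> = ennreal w" "0 \<le> w"
    using mutual_\<rho> W_fun_finite by (cases "mutual s \<rho> \<rho>"; cases "W_fun s N \<rho>") auto
  have "G_fun s N \<rho> = ereal (d / 2 - w)"
    unfolding G_fun_def D_fun_eq_mutual[OF \<rho>] d(1) w(1) using d(2) w(2) by simp
  moreover define l where "l = (d / 2 - w) / L_fun s \<rho>"
  ultimately have G: "G_fun s N \<rho> = ereal (l * L_fun s \<rho>)" using L_pos by simp
  have Lambda: "Lambda TYPE('a) s N = ereal l"
    unfolding Lam[symmetric] G_eq[symmetric] L_eq[symmetric] G using L_pos by simp
  have "\<exists>\<rho>'\<in>(admissible s (Suc N) :: ('a \<Rightarrow> real) set). 0 < L_fun s \<rho>' \<and> ereal (l * L_fun s \<rho>') < G_fun s (Suc N) \<rho>'"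
  proof (cases "\<forall>r. 0 < emeasure \<mu> (- ball 0 r)")
    case True
    then show ?thesis by (intro strict_gain_unbounded G) auto
  next
    case False
    then show ?thesis using strict_gain_bounded[OF _ G] by auto
  qed
  then obtain \<rho>' :: "'a \<Rightarrow> real" where \<rho>': "\<rho>' \<in> admissible s (Suc N)" "0 < L_fun s \<rho>'" "ereal (l * L_fun s \<rho>') < G_fun s (Suc N) \<rho>'"
    by blast
  have "ereal l < G_fun s (Suc N) \<rho>' / ereal (L_fun s \<rho>')"
    using \<rho>' by (subst ereal_less_divide_pos) (auto simp: mult.commute)
  also have "\<dots> \<le> Lambda TYPE('a) s (Suc N)"
    unfolding Lambda_def by (rule SUP_upper[OF \<rho>'(1)])
  finally show ?thesis by (simp add: Lambda)
qed

end
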